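(* For all integers $k\geq1$ and $0\leq l\leq k$, let $s_{l,k}$ be the substitution over the alphabet $\{a,b,c\}$ defined by $$s_{l,k}:\quad a\mapsto a^lba^{k-l},\qquad b\mapsto c,\qquad c\mapsto a.$$ Then the subshift generated by $s_{l,k}$ has pure discrete spectrum.
   Context: $a^m$ means that the letter $a$ is repeated $m$ times. A substitution is a morphism of the monoid of finite words over the alphabet, extended to infinite words. The subshift generated by a primitive substitution $s$ over $A$ is $(\overline{S^{\mathbb N}u},S)$, where $S$ is the shift on $A^{\mathbb N}$ (product topology), $S^{\mathbb N}u=\{S^nu:n\in\mathbb N\}$ and $u\in A^{\mathbb N}$ is any periodic point of $s$ (i.e. $s^m(u)=u$ for some $m\ge1$); it does not depend on the choice of $u$. It is considered with its unique shift-invariant probability measure; pure discrete spectrum means that the eigenfunctions of the Koopman operator span a dense subspace of $L^2$. *)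

theory Defs
  imports "HOL-Probability.Probability"
begin

section \<open>Substitutions and their periodic points\<close>

text \<open>A substitution is given by the images of the letters; infinite words over
  \<open>'a\<close> are functions \<open>nat \<Rightarrow> 'a\<close>.\<close>

definition subst_word :: "('a \<Rightarrow> 'a list) \<Rightarrow> 'a list \<Rightarrow> 'a list" where
  "subst_word s w = concat (map s w)"

text \<open>The image of \<open>u\<close> is the infinite word \<open>s(u\<^sub>0) s(u\<^sub>1) \<dots>\<close>: if no letter has an empty image, the image of the
  prefix of length \<open>n + 1\<close> has more than \<open>n\<close> letters, so its \<open>n\<close>-th letter is that of the
  infinite concatenation. The lemma \<open>subst_inf_prefix\<close> below confirms this. The
  definition is meaningless for erasing substitutions.\<close>

definition subst_inf :: "('a \<Rightarrow> 'a list) \<Rightarrow> (nat \<Rightarrow> 'a) \<Rightarrow> (nat \<Rightarrow> 'a)" where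
  "subst_inf s u = (\<lambda>n. subst_word s (map u [0..<Suc n]) ! n)"

definition primitive_subst :: "('a \<Rightarrow> 'a list) \<Rightarrow> bool" where
  "primitive_subst s \<longleftrightarrow> (\<exists>n\<ge>1. \<forall>x y. y \<in> set ((subst_word s ^^ n) [x]))"

definition periodic_point :: "('a \<Rightarrow> 'a list) \<Rightarrow> (nat \<Rightarrow> 'a) \<Rightarrow> bool" where
  "periodic_point s u \<longleftrightarrow> (\<exists>m\<ge>1. (subst_inf s ^^ m) u = u)"

lemma subst_word_append: "subst_word s (v @ w) = subst_word s v @ subst_word s w"
  by (simp add: subst_word_def)

lemma length_subst_word_ge:
  assumes "\<And>x. s x \<noteq> []"
  shows "length w \<le> length (subst_word s w)"
proof (induction w)
  case (Cons x w)
  have "1 \<le> length (s x)"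
    using assms[of x] by (simp add: Suc_le_eq)
  then show ?case
    using Cons by (simp add: subst_word_def)
qed (simp add: subst_word_def)

lemma subst_word_prefix_nth:
  assumes "\<And>x. s x \<noteq> []" and "i < length (subst_word s (map u [0..<m]))" and "m \<le> n"
  shows "subst_word s (map u [0..<n]) ! i = subst_word s (map u [0..<m]) ! i"
proof -
  have "[0..<n] = [0..<m] @ [m..<n]"
    using upt_add_eq_append[of 0 m "n - m"] assms(3) by simp
  then show ?thesis
    using assms(2) by (simp add: subst_word_append nth_append)
qed

lemma subst_inf_prefix:
  assumes "\<And>x. s x \<noteq> []" and "i < length (subst_word s (map u [0..<m]))"
  shows "subst_inf s u i = subst_word s (map u [0..<m]) ! i"
proof (cases "m \<le> Suc i")
  case True
  then show ?thesis
    unfolding subst_inf_def by (rule subst_word_prefix_nth[OF assms])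
next
  case False
  have "i < length (subst_word s (map u [0..<Suc i]))"
    using length_subst_word_ge[of s "map u [0..<Suc i]"] assms(1) by simp
  then show ?thesis
    unfolding subst_inf_def
    using subst_word_prefix_nth[of s i u "Suc i" m] False assms(1) by simp
qed


section \<open>Subshifts\<close>

definition shift_map :: "(nat \<Rightarrow> 'a) \<Rightarrow> (nat \<Rightarrow> 'a)" where
  "shift_map x = (\<lambda>n. x (Suc n))"

text \<open>The closure is taken in the product topology of \<open>nat \<Rightarrow> 'a\<close>, the alphabet being discrete.\<close>

definition orbit_closure :: "(nat \<Rightarrow> 'a::discrete_topology) \<Rightarrow> (nat \<Rightarrow> 'a) set" where
  "orbit_closure u = closure (range (\<lambda>n. (shift_map ^^ n) u))"

definition shift_invariant_prob ::
    "(nat \<Rightarrow> 'a::discrete_topology) set \<Rightarrow> (nat \<Rightarrow> 'a) measure \<Rightarrow> bool" where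
  "shift_invariant_prob X \<mu> \<longleftrightarrow>
     sets \<mu> = sets (restrict_space borel X) \<and> prob_space \<mu> \<and>
     shift_map \<in> \<mu> \<rightarrow>\<^sub>M \<mu> \<and> distr \<mu> \<mu> shift_map = \<mu>"


section \<open>Pure discrete spectrum\<close>

text \<open>Elements of \<open>L\<^sup>2\<close> are represented by square integrable complex functions, so equality
  of elements is equality almost everywhere.\<close>

definition L2_functions :: "'x measure \<Rightarrow> ('x \<Rightarrow> complex) set" where
  "L2_functions M =
     {f. f \<in> borel_measurable M \<and> integrable M (\<lambda>x. (cmod (f x))\<^sup>2)}"

definition L2_norm :: "'x measure \<Rightarrow> ('x \<Rightarrow> complex) \<Rightarrow> real" where
  "L2_norm M f = sqrt (\<integral>x. (cmod (f x))\<^sup>2 \<partial>M)"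

definition koopman :: "('x \<Rightarrow> 'x) \<Rightarrow> ('x \<Rightarrow> complex) \<Rightarrow> ('x \<Rightarrow> complex)" where
  "koopman T f = f \<circ> T"

definition koopman_eigenfunctions :: "'x measure \<Rightarrow> ('x \<Rightarrow> 'x) \<Rightarrow> ('x \<Rightarrow> complex) set" where
  "koopman_eigenfunctions M T =
     {f \<in> L2_functions M. \<not> (AE x in M. f x = 0) \<and>
        (\<exists>z::complex. AE x in M. koopman T f x = z * f x)}"

definition pure_discrete_spectrum :: "'x measure \<Rightarrow> ('x \<Rightarrow> 'x) \<Rightarrow> bool" where
  "pure_discrete_spectrum M T \<longleftrightarrow>
     (\<forall>f \<in> L2_functions M. \<forall>\<epsilon>>0. \<exists>F c. finite F \<and> F \<subseteq> koopman_eigenfunctions M T \<and>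
        L2_norm M (\<lambda>x. f x - (\<Sum>g\<in>F. c g * g x)) < \<epsilon>)"


section \<open>The substitutions\<close>

datatype letter = La | Lb | Lc

instantiation letter :: discrete_topology
begin

definition open_letter :: "letter set \<Rightarrow> bool" where
  "open_letter A \<longleftrightarrow> True"

instance
proof
  show "open A" for A :: "letter set"
    by (simp add: open_letter_def)
qed (simp_all add: open_letter_def)

end

lemma UNIV_letter: "UNIV = {La, Lb, Lc}"
  using letter.exhaust by auto

instance letter :: finite
  by standard (simp add: UNIV_letter)

instance letter :: second_countable_topology
proof
  show "\<exists>B::letter set set. countable B \<and> open = generate_topology B"
  proof (intro exI conjI)
    show "countable (UNIV :: letter set set)"
      by (simp add: countable_finite)
    show "open = generate_topology (UNIV :: letter set set)"
      by (auto simp: fun_eq_iff open_letter_def intro: generate_topology.Basis)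
  qed
qed

fun subst_lk :: "nat \<Rightarrow> nat \<Rightarrow> letter \<Rightarrow> letter list" where
  "subst_lk l k La = replicate l La @ [Lb] @ replicate (k - l) La"
| "subst_lk l k Lb = [Lc]"
| "subst_lk l k Lc = [La]"

lemma subst_lk_nonempty: "subst_lk l k x \<noteq> []"
  by (cases x) simp_all

lemma primitive_subst_lk:
  assumes "k \<ge> 1" and "l \<le> k"
  shows "primitive_subst (subst_lk l k)"
proof -
  have set_eq: "set (subst_word s w) = (\<Union>x\<in>set w. set (s x))" for s and w :: "letter list"
    by (simp add: subst_word_def)
  have a: "set (subst_lk l k La) = {La, Lb}"
    using assms by auto
  have "y \<in> set ((subst_word (subst_lk l k) ^^ 4) [x])" for x y
    by (cases x; cases y) (simp_all add: eval_nat_numeral set_eq a del: subst_lk.simps(1))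
  then show ?thesis
    unfolding primitive_subst_def by (intro exI[of _ 4]) simp
qed

end

theory Submission
  imports Defs "HOL-Library.Sublist"
begin

text \<open>Write \<open>s\<close> for the substitution. Applying \<open>s\<close> shows that the Hamming distances \<open>p\<^sub>j\<close>, \<open>q\<^sub>j\<close>, \<open>r\<^sub>j\<close> between
  \<open>s\<^sup>j(xy)\<close> and \<open>s\<^sup>j(yx)\<close>, for \<open>xy = ab, ac, bc\<close>, satisfy \<open>q\<^sub>j\<^sub>+\<^sub>1 = p\<^sub>j\<close>, \<open>r\<^sub>j\<^sub>+\<^sub>1 = q\<^sub>j\<close> and
  \<open>p\<^sub>j\<^sub>+\<^sub>1 \<le> k q\<^sub>j + r\<^sub>j\<close>, so they grow more slowly than \<open>\<beta>\<^sup>j\<close>, where \<open>\<beta>\<^sup>3 = k \<beta>\<^sup>2 + 1\<close>. Moving the letter \<open>a\<close>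
  through a word \<open>w\<close> one letter at a time, \<open>s\<^sup>j(aw)\<close> and \<open>s\<^sup>j(wa)\<close> differ at few places; hence a point of the
  subshift differs from its shift by \<open>H\<^sub>j = |s\<^sup>j(a)|\<close> with a frequency that is exponentially small in \<open>j\<close>.
  As \<open>\<beta>\<close> is a Pisot unit, every \<open>n\<close> for which \<open>n\<close> times the frequencies of \<open>b\<close> and \<open>c\<close> are close to integers
  is a combination, with bounded integer coefficients, of the \<open>H\<^sub>j\<close> with \<open>j\<close> large. So the orbit of a
  cylinder function is Bohr almost periodic in \<open>L\<^sup>2\<close>, with two frequencies, and its Fejer means, which by the
  mean ergodic theorem are combinations of eigenfunctions, approximate the function.\<close>

text \<open>The exchange costs obey a recursive bound with polynomial x^3 - k x - 1, the lengths a
  recurrence with x^3 - k x^2 - 1; the first polynomial is positive at \<open>\<beta>\<close>, and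
  this gap is the source of all decay. It yields small mismatches only along the sparse times
  \<open>H j\<close>, while almost periodicity asks for every time at which a rotation of the
  2-torus comes close to its start. Subadditivity of the mismatch frequency bridges this once times
  are decomposed, for which two facts on the incidence matrix are used. Its determinant is 1, so an
  integer vector of letter counts can be desubstituted as often as desired, at the price of an error
  growing geometrically; this fixes how close to integers one must be. Its other two eigenvalues
  have modulus \<open>\<beta>\<close> to the power -1/2, so the letter counts of the iterates of a
  approach the Perron line fast enough for the errors to be summed, and a greedy expansion leaves a
  bounded remainder. The frequencies of b and c suffice because the three frequencies add up to 1;
  irreducibility of the cubic makes them independent together with 1, which gives the product of two
  Fejer kernels mean 1.\<close>

abbreviation iter_subst :: "('a \<Rightarrow> 'a list) \<Rightarrow> nat \<Rightarrow> 'a list \<Rightarrow> 'a list" where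
  "iter_subst s j \<equiv> subst_word s ^^ j"

lemma subst_word_Nil [simp]: "subst_word s [] = []"
  by (simp add: subst_word_def)

lemma iter_subst_append: "iter_subst s j (v @ w) = iter_subst s j v @ iter_subst s j w"
  by (induction j) (simp_all add: subst_word_append)

lemma iter_subst_Nil [simp]: "iter_subst s j [] = []"
  by (induction j) simp_all

lemma iter_subst_Cons: "iter_subst s j (x # w) = iter_subst s j [x] @ iter_subst s j w"
  using iter_subst_append[of j s "[x]" w] by simp

lemma iter_subst_single_Suc: "iter_subst s (Suc j) [x] = iter_subst s j (s x)"
  by (simp add: funpow_Suc_right subst_word_def del: funpow.simps)

lemma length_iter_subst_ge:
  assumes "\<And>x. n \<le> length (iter_subst s j [x])"
  shows "n * length w \<le> length (iter_subst s j w)"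
proof (induction w)
  case (Cons x w)
  then show ?case using assms[of x] by (subst iter_subst_Cons) simp
qed simp

section \<open>Hamming distance\<close>

text \<open>\<open>zip\<close> stops at the end of the shorter word, so this is the Hamming distance
  only for words of equal length; the iterates compared below always have equal lengths.\<close>

definition hamming :: "'a list \<Rightarrow> 'a list \<Rightarrow> nat" where
  "hamming v w = length (filter (\<lambda>(x, y). x \<noteq> y) (zip v w))"

lemma hamming_append:
  "length v = length v' \<Longrightarrow> hamming (v @ w) (v' @ w') = hamming v v' + hamming w w'"
  by (simp add: hamming_def)

lemma hamming_same [simp]: "hamming v v = 0"
  by (induction v) (auto simp: hamming_def)

lemma hamming_commute: "length v = length w \<Longrightarrow> hamming v w = hamming w v"
  by (induction v w rule: list_induct2) (auto simp: hamming_def)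

lemma hamming_triangle:
  "length u = length v \<Longrightarrow> length v = length w \<Longrightarrow> hamming u w \<le> hamming u v + hamming v w"
  by (induction u v w rule: list_induct3) (auto simp: hamming_def)

lemma hamming_conv_card:
  "length v = length w \<Longrightarrow> hamming v w = card {i. i < length v \<and> v ! i \<noteq> w ! i}"
  unfolding hamming_def length_filter_conv_card by (rule arg_cong[where f = card]) auto

text \<open>For the pairs ab, ac, bc these are the numbers called p, q, r in the overview.\<close>

definition comm_cost :: "('a \<Rightarrow> 'a list) \<Rightarrow> nat \<Rightarrow> 'a \<Rightarrow> 'a \<Rightarrow> nat" where
  "comm_cost s j x y = hamming (iter_subst s j [x, y]) (iter_subst s j [y, x])"

lemma length_iter_subst_swap:
  "length (iter_subst s j (v @ w)) = length (iter_subst s j (w @ v))"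
  by (simp add: iter_subst_append)

lemma comm_cost_commute: "comm_cost s j x y = comm_cost s j y x"
  unfolding comm_cost_def using length_iter_subst_swap[of j s "[x]" "[y]"]
  by (simp add: hamming_commute)

lemma comm_cost_same [simp]: "comm_cost s j x x = 0"
  by (simp add: comm_cost_def)

text \<open>The letter passes the entries of \<open>w\<close> one at a time. An exchange does not
  change the length of the image, so the parts on both sides of it stay aligned, and the triangle
  inequality adds up the costs.\<close>

lemma hamming_move_letter:
  "hamming (iter_subst s j (x # w)) (iter_subst s j (w @ [x])) \<le> (\<Sum>y\<leftarrow>w. comm_cost s j x y)"
proof (induction w)
  case (Cons y w)
  have xy: "length (iter_subst s j [x, y]) = length (iter_subst s j [y, x])"
    using length_iter_subst_swap[of j s "[x]" "[y]"] by simp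
  have "hamming (iter_subst s j (x # y # w)) (iter_subst s j ((y # w) @ [x])) =
      hamming (iter_subst s j ([x, y] @ w)) (iter_subst s j ([y] @ (w @ [x])))"
    by simp
  also have "\<dots> \<le>
      hamming (iter_subst s j ([x, y] @ w)) (iter_subst s j ([y, x] @ w)) +
      hamming (iter_subst s j ([y, x] @ w)) (iter_subst s j ([y] @ (w @ [x])))"
  proof (rule hamming_triangle)
    show "length (iter_subst s j ([x, y] @ w)) = length (iter_subst s j ([y, x] @ w))"
      unfolding iter_subst_append[of j s "[_, _]" w] using xy by simp
    show "length (iter_subst s j ([y, x] @ w)) = length (iter_subst s j ([y] @ w @ [x]))"
      using length_iter_subst_swap[of j s "[x]" w] iter_subst_append[of j s "[y]" "x # w"]
        iter_subst_append[of j s "[y]" "w @ [x]"] by simp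
  qed
  also have "hamming (iter_subst s j ([y, x] @ w)) (iter_subst s j ([y] @ (w @ [x]))) =
      hamming (iter_subst s j (x # w)) (iter_subst s j (w @ [x]))"
    using hamming_append[of "iter_subst s j [y]" "iter_subst s j [y]" "iter_subst s j (x # w)"
        "iter_subst s j (w @ [x])"] iter_subst_append[of j s "[y]" "x # w"]
      iter_subst_append[of j s "[y]" "w @ [x]"] by simp
  also have "hamming (iter_subst s j ([x, y] @ w)) (iter_subst s j ([y, x] @ w)) = comm_cost s j x y"
    using xy by (simp only: iter_subst_append[of j s "[_, _]" w] hamming_append comm_cost_def
        hamming_same add_0_right)
  finally show ?case using Cons by simp
qed simp

section \<open>Self-mismatches of a word\<close>

definition self_mismatch :: "nat \<Rightarrow> 'a list \<Rightarrow> nat" where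
  "self_mismatch n w = card {i. i + n < length w \<and> w ! i \<noteq> w ! (i + n)}"

lemma self_mismatch_append:
  "self_mismatch n (v @ w) \<le> length v + self_mismatch n w"
proof -
  have "{i. i + n < length (v @ w) \<and> (v @ w) ! i \<noteq> (v @ w) ! (i + n)} \<subseteq>
      {..<length v} \<union> (\<lambda>i. i + length v) ` {i. i + n < length w \<and> w ! i \<noteq> w ! (i + n)}"
    (is "?A \<subseteq> _ \<union> ?f ` ?B")
  proof
    fix i assume i: "i \<in> ?A"
    show "i \<in> {..<length v} \<union> ?f ` ?B"
    proof (cases "i < length v")
      case False
      then have "i = ?f (i - length v)" "i - length v \<in> ?B"
        using i by (auto simp: nth_append)
      then show ?thesis by blast
    qed simp
  qed
  moreover have fB: "finite ?B" by (rule finite_subset[of _ "{..<length w}"]) auto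
  ultimately have "card ?A \<le> card ({..<length v} \<union> ?f ` ?B)"
    by (intro card_mono) auto
  also have "\<dots> \<le> card {..<length v} + card (?f ` ?B)" by (rule card_Un_le)
  also have "\<dots> \<le> length v + card ?B" using card_image_le[OF fB, of ?f] by simp
  finally show ?thesis by (simp add: self_mismatch_def)
qed

text \<open>Shifting by the length of the image of \<open>x\<close> turns the comparison of
  \<open>v\<close> with itself into one of the images of \<open>x # w\<close> and of
  \<open>w\<close>; completing \<open>w\<close> to \<open>w @ [x]\<close> makes this the move of one
  letter. Each letter of \<open>w\<close> has an image of at least \<open>l\<close> letters, which
  limits how many of them are needed to cover \<open>v\<close>.\<close>

lemma self_mismatch_prefix:
  fixes s :: "'a \<Rightarrow> 'a list"
  assumes pre: "prefix v (iter_subst s j (x # w))"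
    and l: "\<And>y. l \<le> length (iter_subst s j [y])" "l \<ge> 1"
    and c: "\<And>y. comm_cost s j x y \<le> c"
  shows "self_mismatch (length (iter_subst s j [x])) v \<le> (length v div l + 1) * c"
proof -
  let ?n = "length (iter_subst s j [x])"
  define w' where "w' = take (length v div l + 1) w"
  have wsplit: "w = w' @ drop (length v div l + 1) w" by (simp add: w'_def)
  let ?S = "iter_subst s j (x # w')" and ?S' = "iter_subst s j (w' @ [x])"
  have pw: "iter_subst s j w = iter_subst s j w' @ iter_subst s j (drop (length v div l + 1) w)"
    using wsplit by (metis iter_subst_append)
  note cons = iter_subst_Cons[of j s x w] iter_subst_Cons[of j s x w']
  have lenS: "length ?S = length ?S'"
    using length_iter_subst_swap[of j s "[x]" w'] by simp
  have "{i. i + ?n < length v \<and> v ! i \<noteq> v ! (i + ?n)} \<subseteq> {i. i < length ?S \<and> ?S ! i \<noteq> ?S' ! i}"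
  proof safe
    fix i assume i: "i + ?n < length v" and ne: "v ! i \<noteq> v ! (i + ?n)"
    have v: "v ! m = iter_subst s j (x # w) ! m" if "m < length v" for m
      using pre that by (auto simp: prefix_def nth_append)
    have len: "length v \<le> length (iter_subst s j (x # w))"
      using pre prefix_length_le by blast
    \<comment> \<open>A full \<open>w'\<close> covers \<open>v\<close> by its length; otherwise
      \<open>w'\<close> is all of \<open>w\<close>, and \<open>i + ?n\<close> lies inside the image
      of \<open>x # w\<close>.\<close>
    have iw': "i < length (iter_subst s j w')"
    proof (cases "length w' = length v div l + 1")
      case True
      have "length v < l * (length v div l + 1)"
        using l(2) by (metis Suc_eq_plus1 dividend_less_times_div less_le_trans mult_Suc_right zero_less_one add.commute)
      also have "\<dots> \<le> length (iter_subst s j w')"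
        using length_iter_subst_ge[of l j s w', OF l(1)] True by simp
      finally show ?thesis using i by simp
    next
      case False
      then have "w' = w" by (auto simp: w'_def)
      then show ?thesis using i len by (simp add: cons)
    qed
    show "i < length ?S"
      using iw' by (simp add: cons)
    assume "?S ! i = ?S' ! i"
    moreover have "?S' ! i = iter_subst s j w' ! i"
      using iw' by (simp add: iter_subst_append nth_append)
    moreover have "v ! (i + ?n) = iter_subst s j w' ! i"
      using v[OF i] iw' by (simp add: cons nth_append pw)
    moreover have "v ! i = ?S ! i"
      using v[of i] i iw' by (auto simp: cons nth_append pw)
    ultimately show False using ne by simp
  qed
  then have "self_mismatch ?n v \<le> card {i. i < length ?S \<and> ?S ! i \<noteq> ?S' ! i}"
    unfolding self_mismatch_def by (intro card_mono) auto
  also have "\<dots> = hamming ?S ?S'" using lenS by (simp add: hamming_conv_card)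
  also have "\<dots> \<le> (\<Sum>y\<leftarrow>w'. comm_cost s j x y)" by (rule hamming_move_letter)
  also have "\<dots> \<le> (\<Sum>y\<leftarrow>w'. c)" by (intro sum_list_mono c)
  also have "\<dots> = length w' * c" by (simp add: sum_list_triv)
  also have "\<dots> \<le> (length v div l + 1) * c" by (intro mult_right_mono) (auto simp: w'_def)
  finally show ?thesis .
qed

text \<open>Every block s^(j+r)(y) contains an image s^j(x). A factor therefore reaches one after
  the rest of the block in which it starts and an initial piece of the next block, two pieces of
  length at most \<open>M\<close>.\<close>

lemma factor_split:
  fixes s :: "'a \<Rightarrow> 'a list"
  assumes a: "\<And>y. x \<in> set (iter_subst s r [y])"
    and M: "\<And>y. length (iter_subst s (j + r) [y]) \<le> M"
    and "sublist v (iter_subst s (j + r) z)"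
  shows "\<exists>v1 v2 w. v = v1 @ v2 \<and> length v1 \<le> 2 * M \<and> prefix v2 (iter_subst s j (x # w))"
  using assms(3)
proof (induction z)
  case Nil
  then show ?case by (auto intro!: exI[of _ "[]"])
next
  case (Cons y z)
  have jr: "iter_subst s (j + r) w = iter_subst s j (iter_subst s r w)" for w
    by (simp add: funpow_add)
  have start: "\<exists>v1 v2 w. v' = v1 @ v2 \<and> length v1 \<le> M \<and> prefix v2 (iter_subst s j (x # w))"
    if "prefix v' (iter_subst s (j + r) z)" for v'
  proof (cases z)
    case Nil
    then show ?thesis using that by (auto intro!: exI[of _ "[]"])
  next
    case (Cons y' z')
    obtain P Q where PQ: "iter_subst s r [y'] = P @ x # Q"
      using a[of y'] by (meson split_list)
    have eq: "iter_subst s (j + r) z = iter_subst s j P @ iter_subst s j (x # Q @ iter_subst s r z')"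
      unfolding Cons jr iter_subst_Cons[of r s y' z'] PQ
      by (simp flip: iter_subst_append)
    have "length (iter_subst s j P) \<le> M"
      using M[of y'] by (simp add: jr PQ iter_subst_append)
    moreover from that eq have "prefix v' (iter_subst s j P) \<or>
        (\<exists>v2. v' = iter_subst s j P @ v2 \<and> prefix v2 (iter_subst s j (x # Q @ iter_subst s r z')))"
      by (simp add: prefix_append)
    ultimately show ?thesis
      by (metis append.right_neutral Nil_prefix prefix_length_le le_trans)
  qed
  have "iter_subst s (j + r) (y # z) = iter_subst s (j + r) [y] @ iter_subst s (j + r) z"
    by (rule iter_subst_Cons)
  then have "sublist v (iter_subst s (j + r) [y]) \<or> sublist v (iter_subst s (j + r) z) \<or>
     (\<exists>v1 v2. v = v1 @ v2 \<and> suffix v1 (iter_subst s (j + r) [y]) \<and> prefix v2 (iter_subst s (j + r) z))"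
    using Cons.prems by (simp add: sublist_append)
  then show ?case
  proof (elim disjE exE conjE)
    assume "sublist v (iter_subst s (j + r) [y])"
    then have "length v \<le> M" using M[of y] sublist_length_le le_trans by blast
    then show ?thesis by (intro exI[of _ v] exI[of _ "[]"]) auto
  next
    assume "sublist v (iter_subst s (j + r) z)"
    then show ?thesis by (rule Cons.IH)
  next
    fix v1 v2 assume v: "v = v1 @ v2" "suffix v1 (iter_subst s (j + r) [y])"
      and pre: "prefix v2 (iter_subst s (j + r) z)"
    have "length v1 \<le> M" using v(2) M[of y] suffix_length_le le_trans by blast
    moreover obtain v3 v4 w where "v2 = v3 @ v4" "length v3 \<le> M" "prefix v4 (iter_subst s j (x # w))"
      using start[OF pre] by blast
    ultimately show ?thesis using v(1)
      by (intro exI[of _ "v1 @ v3"] exI[of _ v4] exI[of _ w]) auto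
  qed
qed

text \<open>\<open>M\<close> may depend on \<open>j\<close> but not on the factor, so in long
  factors the frequency of mismatches is governed by \<open>c / l\<close>, cost against
  length.\<close>

lemma self_mismatch_sublist:
  fixes s :: "'a::finite \<Rightarrow> 'a list"
  assumes "\<And>y. x \<in> set (iter_subst s r [y])"
    and "\<And>y. l \<le> length (iter_subst s j [y])" "l \<ge> 1"
    and "\<And>y. comm_cost s j x y \<le> c"
  shows "\<exists>M. \<forall>v z. sublist v (iter_subst s (j + r) z) \<longrightarrow>
    self_mismatch (length (iter_subst s j [x])) v \<le> M + (length v div l + 1) * c"
proof -
  define M where "M = Max (range (\<lambda>y. length (iter_subst s (j + r) [y])))"
  have M: "length (iter_subst s (j + r) [y]) \<le> M" for y
    unfolding M_def by (intro Max_ge) auto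
  have "self_mismatch (length (iter_subst s j [x])) v \<le> 2 * M + (length v div l + 1) * c"
    if sub: "sublist v (iter_subst s (j + r) z)" for v z
  proof -
    obtain v1 v2 w where v: "v = v1 @ v2" "length v1 \<le> 2 * M" "prefix v2 (iter_subst s j (x # w))"
      using factor_split[OF assms(1) M sub] by blast
    have "self_mismatch (length (iter_subst s j [x])) v \<le> length v1 + (length v2 div l + 1) * c"
      using self_mismatch_append[of _ v1 v2] self_mismatch_prefix[OF v(3) assms(2-4)] v(1)
        add_left_mono order_trans by metis
    also have "\<dots> \<le> 2 * M + (length v div l + 1) * c"
      using v by (intro add_mono mult_right_mono) (auto intro: div_le_mono)
    finally show ?thesis .
  qed
  then show ?thesis by blast
qed

section \<open>Factors of periodic points\<close>

lemma iter_subst_prefix_subst_inf: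
  assumes "\<And>x. s x \<noteq> []"
  shows "\<exists>m'\<ge>m. iter_subst s j (map u [0..<m]) = map ((subst_inf s ^^ j) u) [0..<m']"
proof (induction j)
  case (Suc j)
  then obtain m' where m': "m' \<ge> m" "iter_subst s j (map u [0..<m]) = map ((subst_inf s ^^ j) u) [0..<m']"
    by blast
  let ?w = "subst_word s (map ((subst_inf s ^^ j) u) [0..<m'])"
  have "?w = map (subst_inf s ((subst_inf s ^^ j) u)) [0..<length ?w]"
    by (rule nth_equalityI) (simp_all add: subst_inf_prefix[OF assms])
  moreover have "m' \<le> length ?w"
    using length_subst_word_ge[of s "map ((subst_inf s ^^ j) u) [0..<m']"] assms by simp
  ultimately show ?case using m' by (intro exI[of _ "length ?w"]) simp
qed auto

text \<open>If the \<open>p\<close>-th power of the substitution fixes \<open>u\<close>, so does the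
  power \<open>p * j\<close>; hence \<open>u\<close> is the \<open>j\<close>-th image of some
  infinite word, for every \<open>j\<close>.\<close>

lemma periodic_point_factor:
  assumes "\<And>x. s x \<noteq> []" and "periodic_point s u"
  shows "\<exists>z. sublist (map u [m..<n]) (iter_subst s j z)"
proof -
  obtain p where p: "p \<ge> 1" "(subst_inf s ^^ p) u = u"
    using assms(2) by (auto simp: periodic_point_def)
  have "(subst_inf s ^^ (p * i)) u = u" for i
    by (induction i) (simp_all add: p(2) funpow_add)
  moreover have "p * j = j + (p * j - j)" using p(1) by (cases p) auto
  ultimately have u: "(subst_inf s ^^ j) ((subst_inf s ^^ (p * j - j)) u) = u"
    by (metis comp_apply funpow_add)
  obtain m' where m': "m' \<ge> n"
      "iter_subst s j (map ((subst_inf s ^^ (p * j - j)) u) [0..<n]) = map u [0..<m']"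
    using iter_subst_prefix_subst_inf[where s = s and m = n and j = j and u = "(subst_inf s ^^ (p * j - j)) u"] u assms(1) by auto
  have "sublist [m..<n] [0..<m']"
  proof (cases "m \<le> n")
    case True
    then have "[0..<m'] = [0..<m] @ [m..<n] @ [n..<m']"
      using m'(1) upt_add_eq_append[of 0 m "m' - m"] upt_add_eq_append[of m n "m' - n"] by simp
    then show ?thesis by (auto simp: sublist_def)
  qed simp
  then have "sublist (map u [m..<n]) (map u [0..<m'])" by (rule map_mono_sublist)
  then show ?thesis using m'(2) by metis
qed

section \<open>Mismatches for the substitutions\<close>

lemma comm_cost_Suc:
  "comm_cost s (Suc j) x y = hamming (iter_subst s j (s x @ s y)) (iter_subst s j (s y @ s x))"
  by (simp add: comm_cost_def funpow_Suc_right subst_word_def del: funpow.simps)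

text \<open>The two images are a^l (ba) a^(k-l) and a^l (ab) a^(k-l): they differ by one exchange of
  a and b.\<close>

lemma comm_cost_lk_ac: "comm_cost (subst_lk l k) (Suc j) La Lc = comm_cost (subst_lk l k) j La Lb"
proof -
  let ?s = "subst_lk l k"
  have eq: "subst_lk l k La @ subst_lk l k Lc = replicate l La @ [Lb, La] @ replicate (k - l) La"
      "subst_lk l k Lc @ subst_lk l k La = replicate l La @ [La, Lb] @ replicate (k - l) La"
    by (simp_all add: replicate_append_same)
  have "length (iter_subst ?s j [La, Lb]) = length (iter_subst ?s j [Lb, La])"
    using length_iter_subst_swap[of j ?s "[La]" "[Lb]"] by simp
  then have "comm_cost ?s (Suc j) La Lc = comm_cost ?s j Lb La"
    unfolding comm_cost_Suc eq iter_subst_append by (simp add: hamming_append comm_cost_def)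
  then show ?thesis by (simp add: comm_cost_commute)
qed

lemma comm_cost_lk_bc: "comm_cost (subst_lk l k) (Suc j) Lb Lc = comm_cost (subst_lk l k) j La Lc"
  unfolding comm_cost_Suc using comm_cost_commute[of "subst_lk l k" j La Lc] by (simp add: comm_cost_def)

text \<open>The images to compare are c s(a) and s(a) c, so c moves through the \<open>k\<close>
  letters a and the one letter b of s(a).\<close>

lemma comm_cost_lk_ab:
  assumes "l \<le> k"
  shows "comm_cost (subst_lk l k) (Suc j) La Lb \<le>
    k * comm_cost (subst_lk l k) j La Lc + comm_cost (subst_lk l k) j Lb Lc"
proof -
  let ?s = "subst_lk l k"
  have "comm_cost ?s (Suc j) La Lb = comm_cost ?s (Suc j) Lb La"
    by (rule comm_cost_commute)
  also have "\<dots> = hamming (iter_subst ?s j (Lc # ?s La)) (iter_subst ?s j (?s La @ [Lc]))"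
    by (simp add: comm_cost_Suc)
  also have "\<dots> \<le> (\<Sum>y\<leftarrow>?s La. comm_cost ?s j Lc y)" by (rule hamming_move_letter)
  also have "\<dots> = k * comm_cost ?s j Lc La + comm_cost ?s j Lc Lb"
    using assms add_mult_distrib[of l "k - l" "comm_cost ?s j Lc La"]
    by (simp add: sum_list_replicate)
  finally show ?thesis by (simp add: comm_cost_commute)
qed

lemma comm_cost_lk_rec:
  assumes "l \<le> k"
  shows "comm_cost (subst_lk l k) (j + 3) La Lb \<le>
    k * comm_cost (subst_lk l k) (j + 1) La Lb + comm_cost (subst_lk l k) j La Lb"
  using comm_cost_lk_ab[OF assms, of "Suc (Suc j)"]
  by (simp add: eval_nat_numeral comm_cost_lk_ac comm_cost_lk_bc)

text \<open>\<open>\<beta>\<close> is the dominant eigenvalue of the incidence matrix, with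
  characteristic polynomial x^3 - k x^2 - 1; the constant term makes it a unit.\<close>

locale cubic_unit =
  fixes k :: nat and \<beta> :: real
  assumes k: "k \<ge> 1" and beta_gt: "\<beta> > 1" and beta_cubic: "\<beta> ^ 3 = k * \<beta> ^ 2 + 1"
begin

text \<open>A geometric sequence dominates the recursive bound as soon as its ratio satisfies
  \<open>\<tau> ^ 3 \<ge> k * \<tau> + 1\<close>. At \<open>\<beta>\<close> this is strict, with gap
  \<open>k * \<beta> * (\<beta> - 1)\<close>, so it survives for some \<open>\<tau>\<close> slightly
  below \<open>\<beta>\<close>.\<close>

lemma comm_cost_lk_growth:
  assumes "l \<le> k"
  shows "\<exists>C \<tau>. C \<ge> 0 \<and> 1 < \<tau> \<and> \<tau> < \<beta> \<and> (\<forall>j y. real (comm_cost (subst_lk l k) j La y) \<le> C * \<tau> ^ j)"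
proof -
  have "((\<lambda>x. x ^ 3 - k * x - 1) \<longlongrightarrow> \<beta> ^ 3 - k * \<beta> - 1) (at_left \<beta>)"
    by (intro tendsto_intros)
  moreover have "\<beta> ^ 3 - k * \<beta> - 1 > 0"
    using k beta_gt by (simp add: beta_cubic power2_eq_square)
  ultimately have "\<forall>\<^sub>F x in at_left \<beta>. x ^ 3 - k * x - 1 > 0"
    by (rule order_tendstoD(1))
  moreover have "\<forall>\<^sub>F x in at_left \<beta>. x \<in> {1<..<\<beta>}"
    by (rule eventually_at_leftI[of 1]) (use beta_gt in auto)
  ultimately have "\<forall>\<^sub>F x in at_left \<beta>. x ^ 3 - k * x - 1 > 0 \<and> x \<in> {1<..<\<beta>}"
    by (rule eventually_conj)
  then have "\<exists>x::real. x ^ 3 - k * x - 1 > 0 \<and> x \<in> {1<..<\<beta>}"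
    by (rule eventually_happens'[OF trivial_limit_at_left_real])
  then obtain \<tau> :: real where \<tau>: "\<tau> ^ 3 - k * \<tau> - 1 > 0" "1 < \<tau>" "\<tau> < \<beta>"
    by (elim exE conjE) simp
  let ?p = "\<lambda>j. real (comm_cost (subst_lk l k) j La Lb)"
    and ?q = "\<lambda>j. real (comm_cost (subst_lk l k) j La Lc)"
  define C where "C = ?p 0 + ?p 1 + ?p 2 + ?q 0"
  have C: "C \<ge> 0" by (simp add: C_def)
  have \<tau>j: "C \<le> C * \<tau> ^ j" for j
    using mult_left_mono[OF one_le_power[of \<tau> j] C] \<tau>(2) by simp
  have p: "?p j \<le> C * \<tau> ^ j" for j
  proof (induction j rule: less_induct)
    case (less j)
    show ?case
    proof (cases "j < 3")
      case True
      then consider "j = 0" | "j = 1" | "j = 2" by linarith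
      then have "?p j \<le> C" by cases (simp_all add: C_def)
      then show ?thesis using \<tau>j[of j] by linarith
    next
      case False
      then obtain i where i: "j = i + 3" by (metis add.commute le_Suc_ex not_less)
      have "?p j \<le> k * ?p (i + 1) + ?p i"
        unfolding i using comm_cost_lk_rec[OF assms, of i] by (metis of_nat_add of_nat_le_iff of_nat_mult)
      also have "\<dots> \<le> k * (C * \<tau> ^ (i + 1)) + C * \<tau> ^ i"
        using less[of "i + 1"] less[of i] i by (intro add_mono mult_left_mono) (auto simp del: power_Suc)
      also have "\<dots> = C * \<tau> ^ i * (k * \<tau> + 1)" by (simp add: algebra_simps)
      also have "\<dots> \<le> C * \<tau> ^ i * \<tau> ^ 3" using \<tau> C by (intro mult_left_mono) auto
      finally show ?thesis by (simp add: i power_add)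
    qed
  qed
  have q: "?q j \<le> C * \<tau> ^ j" for j
  proof (cases j)
    case (Suc i)
    have "?q j \<le> C * \<tau> ^ i" using p[of i] by (simp add: Suc comm_cost_lk_ac)
    also have "\<dots> \<le> C * \<tau> ^ j" using \<tau> C Suc by (intro mult_left_mono power_increasing) auto
    finally show ?thesis .
  qed (simp add: C_def)
  have "real (comm_cost (subst_lk l k) j La y) \<le> C * \<tau> ^ j" for j y
    using p[of j] q[of j] C \<tau>(2) by (cases y) auto
  then show ?thesis using C \<tau> by blast
qed

text \<open>The weights form a left eigenvector of the incidence matrix, so the substitution
  multiplies the total weight by \<open>\<beta>\<close>. As no weight exceeds 1, total weight is a
  lower bound for length.\<close>

lemma length_iter_lk_ge:
  assumes "l \<le> k"
  shows "\<beta> ^ j / \<beta> ^ 2 \<le> length (iter_subst (subst_lk l k) j [x])"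
proof -
  define wt where "wt = (\<lambda>y. case y of La \<Rightarrow> 1 | Lb \<Rightarrow> 1 / \<beta> ^ 2 | Lc \<Rightarrow> 1 / \<beta>)"
  have "1 / \<beta> ^ 2 \<le> 1 / \<beta>" "1 / \<beta> \<le> 1"
    using beta_gt by (simp_all add: power2_eq_square divide_simps)
  then have wt: "1 / \<beta> ^ 2 \<le> wt y" "wt y \<le> 1" for y
    unfolding wt_def by (cases y; simp)+
  have sub: "sum_list (map wt (subst_lk l k y)) = \<beta> * wt y" for y
  proof -
    have "k + 1 / \<beta> ^ 2 = \<beta>"
      using beta_cubic beta_gt by (simp add: field_simps power3_eq_cube power2_eq_square)
    then show ?thesis using beta_gt assms
      by (cases y) (simp_all add: wt_def sum_list_replicate power2_eq_square)
  qed
  have "sum_list (map wt (subst_word (subst_lk l k) w)) = \<beta> * sum_list (map wt w)" for w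
    by (induction w) (simp_all add: subst_word_def sub algebra_simps)
  then have "sum_list (map wt (iter_subst (subst_lk l k) j w)) = \<beta> ^ j * sum_list (map wt w)" for w
    by (induction j) simp_all
  then have "\<beta> ^ j * wt x = sum_list (map wt (iter_subst (subst_lk l k) j [x]))" by simp
  also have "\<dots> \<le> sum_list (map (\<lambda>_. 1) (iter_subst (subst_lk l k) j [x]))"
    by (intro sum_list_mono wt)
  also have "\<dots> = length (iter_subst (subst_lk l k) j [x])" by (simp add: sum_list_triv)
  finally show ?thesis using mult_left_mono[OF wt(1)[of x], of "\<beta> ^ j"] beta_gt by simp
qed

lemma set_subst_word: "set (subst_word s w) = (\<Union>x\<in>set w. set (s x))"
  by (simp add: subst_word_def)

text \<open>Costs of order \<open>\<tau> ^ j\<close> against lengths of order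
  \<open>\<beta> ^ j\<close> give \<open>\<rho> = \<tau> / \<beta>\<close>; the additive constant
  depends on \<open>j\<close> and will disappear in the frequency.\<close>

lemma self_mismatch_periodic_point:
  assumes l: "l \<le> k" and u: "periodic_point (subst_lk l k) u"
  shows "\<exists>C \<rho>. C \<ge> 0 \<and> 0 < \<rho> \<and> \<rho> < 1 \<and> (\<forall>j. \<exists>M. \<forall>m n.
    real (self_mismatch (length (iter_subst (subst_lk l k) j [La])) (map u [m..<n])) \<le> M + C * \<rho> ^ j * real (n - m))"
proof -
  let ?s = "subst_lk l k"
  obtain C \<tau> where C: "C \<ge> 0" "1 < \<tau>" "\<tau> < \<beta>" "\<And>j y. real (comm_cost ?s j La y) \<le> C * \<tau> ^ j"
    using comm_cost_lk_growth[OF l] by blast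
  have a: "set (subst_lk l k La) = {La, Lb}" using k l by auto
  have La: "La \<in> set (iter_subst ?s 3 [y])" for y
    by (cases y) (simp_all add: eval_nat_numeral set_subst_word a del: subst_lk.simps(1))
  have "\<exists>M. \<forall>m n. real (self_mismatch (length (iter_subst ?s j [La])) (map u [m..<n])) \<le>
      M + (C * \<beta> ^ 2) * (\<tau> / \<beta>) ^ j * real (n - m)" for j
  proof -
    \<comment> \<open>Costs and lengths are integers, so rounding the upper bound down and the lower
      bound up loses nothing.\<close>
    define c where "c = nat \<lfloor>C * \<tau> ^ j\<rfloor>"
    define L where "L = nat \<lceil>\<beta> ^ j / \<beta> ^ 2\<rceil>"
    have pos: "\<beta> ^ j / \<beta> ^ 2 > 0" using beta_gt by simp
    have c: "comm_cost ?s j La y \<le> c" for y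
      unfolding c_def using C(4)[of j y] by (simp add: le_nat_floor)
    have c': "real c \<le> C * \<tau> ^ j" using C by (simp add: c_def)
    have L: "L \<le> length (iter_subst ?s j [y])" for y
      unfolding L_def using length_iter_lk_ge[OF l, of j y] by (simp add: ceiling_le_iff nat_le_iff)
    have L1: "L \<ge> 1" unfolding L_def using pos by linarith
    have L': "\<beta> ^ j / \<beta> ^ 2 \<le> real L" unfolding L_def by (rule real_nat_ceiling_ge)
    obtain M where M: "\<And>v z. sublist v (iter_subst ?s (j + 3) z) \<Longrightarrow>
        self_mismatch (length (iter_subst ?s j [La])) v \<le> M + (length v div L + 1) * c"
      using self_mismatch_sublist[OF La L L1 c] by blast
    have "real (self_mismatch (length (iter_subst ?s j [La])) (map u [m..<n])) \<le>
      (real M + real c) + (C * \<beta> ^ 2) * (\<tau> / \<beta>) ^ j * real (n - m)" for m n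
    proof -
      obtain z where "sublist (map u [m..<n]) (iter_subst ?s (j + 3) z)"
        using periodic_point_factor[OF subst_lk_nonempty u] by blast
      from M[OF this] have "real (self_mismatch (length (iter_subst ?s j [La])) (map u [m..<n])) \<le>
          real M + (real ((n - m) div L) + 1) * real c"
        by (simp add: algebra_simps flip: of_nat_add of_nat_mult)
      also have "\<dots> \<le> real M + (real (n - m) / (\<beta> ^ j / \<beta> ^ 2)) * (C * \<tau> ^ j) + real c"
      proof -
        have "real ((n - m) div L) \<le> real (n - m) / real L" by (rule of_nat_div_le_of_nat)
        also have "\<dots> \<le> real (n - m) / (\<beta> ^ j / \<beta> ^ 2)"
          by (rule divide_left_mono) (use L' pos L1 beta_gt in auto)
        finally have "real ((n - m) div L) * real c \<le> (real (n - m) / (\<beta> ^ j / \<beta> ^ 2)) * (C * \<tau> ^ j)"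
          by (rule mult_mono) (use c' pos beta_gt in auto)
        then show ?thesis by (simp add: algebra_simps)
      qed
      finally show ?thesis using beta_gt by (simp add: field_simps power_divide)
    qed
    then show ?thesis by blast
  qed
  then show ?thesis
    using C beta_gt by (intro exI[of _ "C * \<beta> ^ 2"] exI[of _ "\<tau> / \<beta>"]) auto
qed

text \<open>s^(j+1)(a) consists of k copies of s^j(a) and one of s^j(b), and b needs two further
  steps to become a.\<close>

lemma length_iter_lk_rec:
  assumes "l \<le> k"
  shows "length (iter_subst (subst_lk l k) 0 [La]) = 1"
    "length (iter_subst (subst_lk l k) 1 [La]) = k + 1"
    "length (iter_subst (subst_lk l k) 2 [La]) = k * (k + 1) + 1"
    "length (iter_subst (subst_lk l k) (j + 3) [La]) =
      k * length (iter_subst (subst_lk l k) (j + 2) [La]) + length (iter_subst (subst_lk l k) j [La])"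
proof -
  let ?s = "subst_lk l k"
  have rep: "length (iter_subst ?s j (replicate m La)) = m * length (iter_subst ?s j [La])" for j m
  proof (induction m)
    case (Suc m)
    then show ?case using iter_subst_append[of j ?s "[La]" "replicate m La"] by simp
  qed simp
  have "length (iter_subst ?s (Suc j) [La]) = k * length (iter_subst ?s j [La]) + length (iter_subst ?s j [Lb])" for j
    using assms rep[of j l] rep[of j "k - l"] iter_subst_append[of j ?s "[Lb]" "replicate (k - l) La"]
      add_mult_distrib[of l "k - l" "length (iter_subst ?s j [La])"]
    by (simp add: iter_subst_single_Suc iter_subst_append[of j ?s "replicate l La"] del: funpow.simps)
  moreover have "length (iter_subst ?s (Suc j) [Lb]) = length (iter_subst ?s j [Lc])"
     "length (iter_subst ?s (Suc j) [Lc]) = length (iter_subst ?s j [La])" for j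
    by (simp_all add: iter_subst_single_Suc del: funpow.simps)
  moreover have "length (iter_subst ?s 0 [x]) = 1" for x by simp
  ultimately show "length (iter_subst ?s 0 [La]) = 1" "length (iter_subst ?s 1 [La]) = k + 1"
    "length (iter_subst ?s 2 [La]) = k * (k + 1) + 1"
    "length (iter_subst ?s (j + 3) [La]) = k * length (iter_subst ?s (j + 2) [La]) + length (iter_subst ?s j [La])"
    by (simp_all add: numeral_eq_Suc del: funpow.simps)
qed

end

section \<open>Expansions in a cubic Pisot unit\<close>

text \<open>The \<open>i\<close>-th image of a contains the letters a, b, c respectively
  \<open>unit_seq k (i + 2)\<close>, \<open>unit_seq k (i + 1)\<close> and
  \<open>unit_seq k i\<close> times.\<close>

fun unit_seq :: "nat \<Rightarrow> nat \<Rightarrow> int" where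
  "unit_seq k 0 = 0"
| "unit_seq k (Suc 0) = 0"
| "unit_seq k (Suc (Suc 0)) = 1"
| "unit_seq k (Suc (Suc (Suc i))) = int k * unit_seq k (Suc (Suc i)) + unit_seq k i"

section \<open>Greedy numeration by letter counts, and their distance from the Perron line\<close>

context cubic_unit
begin

lemma beta_pos: "\<beta> > 0"
  using beta_gt by simp

lemma k_eq: "real k = \<beta> - 1 / \<beta> ^ 2"
  using beta_cubic beta_pos by (simp add: field_simps power3_eq_cube power2_eq_square)

lemma unit_seq_nonneg: "unit_seq k i \<ge> 0"
  by (induction k i rule: unit_seq.induct) auto

lemma unit_seq_le_Suc: "unit_seq k i \<le> unit_seq k (Suc i)"
proof (cases "i < 2")
  case True
  then show ?thesis by (auto simp: less_2_cases_iff)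
next
  case False
  then obtain j where 4: "i = Suc (Suc j)" by (metis add_2_eq_Suc le_Suc_ex not_less)
  have "1 * unit_seq k i \<le> int k * unit_seq k i"
    using k by (intro mult_right_mono unit_seq_nonneg) auto
  moreover have "unit_seq k (Suc i) = int k * unit_seq k i + unit_seq k j" by (simp add: 4)
  ultimately show ?thesis using unit_seq_nonneg[of j] by linarith
qed

lemma unit_seq_mono: "i \<le> j \<Longrightarrow> unit_seq k i \<le> unit_seq k j"
  by (rule lift_Suc_mono_le[of "unit_seq k"]) (rule unit_seq_le_Suc)

lemma unit_seq_pos: "unit_seq k (i + 2) \<ge> 1"
  using unit_seq_mono[of 2 "i + 2"] by (simp add: eval_nat_numeral)

text \<open>Linear growth is enough to find a term above a given integer. The -1 accommodates
  \<open>k = 1\<close>, where the terms of index 2, 3 and 4 are all 1.\<close>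

lemma unit_seq_unbounded: "unit_seq k (i + 3) > int i - 1"
proof (induction i)
  case 0
  then show ?case using unit_seq_nonneg[of 3] by simp
next
  case (Suc i)
  have "1 * unit_seq k (i + 3) \<le> int k * unit_seq k (i + 3)"
    using k by (intro mult_right_mono unit_seq_nonneg) auto
  moreover have "unit_seq k (Suc i + 3) = int k * unit_seq k (i + 3) + unit_seq k (i + 1)"
    by (simp add: numeral_eq_Suc)
  moreover have "unit_seq k (i + 3) \<ge> 1" using unit_seq_pos[of "i + 1"] by (simp add: numeral_eq_Suc)
  moreover have "i = 0 \<or> unit_seq k (i + 1) \<ge> 1"
    using unit_seq_pos[of "i - 1"] by (cases i) (simp_all add: numeral_eq_Suc)
  moreover have "unit_seq k (i + 1) \<ge> 0" by (rule unit_seq_nonneg)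
  ultimately show ?case using Suc by (elim disjE; simp only: of_nat_Suc; linarith)
qed

text \<open>Divide by the largest term and expand the remainder. Consecutive terms grow by a factor
  of at most \<open>k + 1\<close>, so the digits are bounded independently of \<open>m\<close> and
  \<open>x\<close>.\<close>

lemma greedy_expansion:
  assumes "0 \<le> x" "x < unit_seq k (m + 3)"
  shows "\<exists>c. (\<forall>i. 0 \<le> c i \<and> c i \<le> int k + 1) \<and> x = (\<Sum>i\<le>m. c i * unit_seq k (i + 2))"
  using assms
proof (induction m arbitrary: x)
  case 0
  then show ?case
    by (intro exI[of _ "\<lambda>i. if i = 0 then x else 0"]) (auto simp: numeral_eq_Suc)
next
  case (Suc m)
  let ?g = "unit_seq k (m + 3)"
  have g: "?g \<ge> 1" using unit_seq_pos[of "m + 1"] by (simp add: numeral_eq_Suc)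
  have "x mod ?g < ?g" "0 \<le> x mod ?g" using g by auto
  then obtain c where c: "\<And>i. 0 \<le> c i \<and> c i \<le> int k + 1"
      "x mod ?g = (\<Sum>i\<le>m. c i * unit_seq k (i + 2))"
    using Suc.IH by blast
  define c' where "c' = c(Suc m := x div ?g)"
  have "x < (int k + 1) * ?g"
    using Suc.prems(2) unit_seq_mono[of "m + 1" "m + 3"]
    by (simp add: numeral_eq_Suc algebra_simps)
  then have "x div ?g \<le> int k + 1"
    using g by (smt (verit) div_pos_geq int_div_less_self nonzero_mult_div_cancel_right zdiv_mono1)
  moreover have "0 \<le> x div ?g" using g Suc.prems by (simp add: pos_imp_zdiv_nonneg_iff)
  ultimately have "\<forall>i. 0 \<le> c' i \<and> c' i \<le> int k + 1" using c by (auto simp: c'_def)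
  moreover have "(\<Sum>i\<le>Suc m. c' i * unit_seq k (i + 2)) = (\<Sum>i\<le>m. c i * unit_seq k (i + 2)) + x div ?g * ?g"
    by (simp add: c'_def) (simp add: numeral_eq_Suc)
  ultimately show ?case using c(2) by (metis mod_div_mult_eq)
qed

text \<open>On the Perron line the counts of a, b, c are as 1, \<open>1 / \<beta>\<close>,
  \<open>1 / \<beta> ^ 2\<close>; the two errors measure the deviation from it. They evolve linearly
  with the conjugates of \<open>\<beta>\<close> as eigenvalues, complex numbers of modulus
  \<open>sqrt (1 / \<beta>)\<close>: this is the Pisot property.\<close>

lemma unit_seq_error:
  "\<exists>A r. A \<ge> 0 \<and> 0 < r \<and> r < 1 \<and> (\<forall>i.
     \<bar>unit_seq k (i + 1) - unit_seq k (i + 2) / \<beta>\<bar> \<le> A * r ^ i \<and>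
     \<bar>unit_seq k i - unit_seq k (i + 2) / \<beta> ^ 2\<bar> \<le> A * r ^ i)"
proof -
  define e1 where "e1 = (\<lambda>i. unit_seq k (i + 1) - unit_seq k (i + 2) / \<beta>)"
  define e2 where "e2 = (\<lambda>i. unit_seq k i - unit_seq k (i + 2) / \<beta> ^ 2)"
  \<comment> \<open>A quadratic form that the error dynamics multiplies by
    \<open>1 / \<beta>\<close>, the product of the two conjugates; it replaces complex
    eigenvectors.\<close>
  define Q where "Q = (\<lambda>i. e1 i ^ 2 - e1 i * e2 i / \<beta> ^ 2 + e2 i ^ 2 / \<beta>)"
  have s: "real_of_int (unit_seq k (Suc i + 2)) =
      (\<beta> - 1 / \<beta> ^ 2) * unit_seq k (i + 2) + unit_seq k i" for i
    unfolding k_eq[symmetric] by (simp add: numeral_eq_Suc)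
  have e1: "e1 (Suc i) = - e2 i / \<beta>" for i
    unfolding e1_def e2_def s using beta_pos
    by (simp add: field_simps power2_eq_square)
  have e2: "e2 (Suc i) = e1 i - e2 i / \<beta> ^ 2" for i
    unfolding e1_def e2_def s using beta_pos
    by (simp add: field_simps power2_eq_square)
  have "Q (Suc i) = Q i / \<beta>" for i
    unfolding Q_def e1 e2 using beta_pos by (simp add: field_simps power2_eq_square)
  then have Q: "Q i = Q 0 / \<beta> ^ i" for i
    by (induction i) auto
  \<comment> \<open>\<open>Q\<close> is positive definite: complete the square in
    \<open>e2 i\<close> for the first bound and in \<open>e1 i\<close> for the second.\<close>
  have b1: "e1 i ^ 2 \<le> 2 * \<beta> * Q i" and b2: "e2 i ^ 2 \<le> 2 * \<beta> * Q i" for i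
  proof -
    have "\<beta> - 1 / (4 * \<beta> ^ 2) \<ge> 3 / 4"
    proof -
      have "1 / (4 * \<beta> ^ 2) \<le> 1 / 4" using beta_gt by (simp add: divide_simps)
      then show ?thesis using beta_gt by linarith
    qed
    then have "3 / 4 * e1 i ^ 2 \<le> (\<beta> - 1 / (4 * \<beta> ^ 2)) * e1 i ^ 2"
      by (rule mult_right_mono) simp
    also have "\<dots> \<le> (e2 i - e1 i / (2 * \<beta>)) ^ 2 + \<dots>" by simp
    also have "\<dots> = \<beta> * Q i"
      unfolding Q_def using beta_pos by (simp add: field_simps power2_eq_square)
    finally have *: "3 / 4 * e1 i ^ 2 \<le> \<beta> * Q i" .
    then show "e1 i ^ 2 \<le> 2 * \<beta> * Q i"
      using zero_le_power2[of "e1 i"] unfolding mult.assoc by linarith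
    have "1 - 1 / (4 * \<beta> ^ 3) \<ge> 3 / 4"
      using one_le_power[of \<beta> 3] beta_gt by (simp add: divide_simps)
    then have "3 / 4 * e2 i ^ 2 \<le> (1 - 1 / (4 * \<beta> ^ 3)) * e2 i ^ 2"
      by (rule mult_right_mono) simp
    also have "\<dots> \<le> \<beta> * (e1 i - e2 i / (2 * \<beta> ^ 2)) ^ 2 + \<dots>" using beta_pos by simp
    also have "\<dots> = \<beta> * Q i"
      unfolding Q_def using beta_pos by (simp add: field_simps power2_eq_square power3_eq_cube)
    finally have *: "3 / 4 * e2 i ^ 2 \<le> \<beta> * Q i" .
    then show "e2 i ^ 2 \<le> 2 * \<beta> * Q i"
      using zero_le_power2[of "e2 i"] unfolding mult.assoc by linarith
  qed
  define A where "A = sqrt (2 * \<beta> * Q 0)"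
  define r where "r = sqrt (1 / \<beta>)"
  have A: "A * r ^ i = sqrt (2 * \<beta> * Q i)" for i
    by (simp add: A_def r_def Q[of i] power_one_over flip: real_sqrt_mult real_sqrt_power)
  have "\<bar>e1 i\<bar> \<le> A * r ^ i" "\<bar>e2 i\<bar> \<le> A * r ^ i" for i
    unfolding A using b1[of i] b2[of i] by (simp_all add: real_le_rsqrt)
  moreover have "A \<ge> 0"
    unfolding A_def by (rule real_sqrt_ge_zero[OF order_trans[OF zero_le_power2 b1[of 0]]])
  moreover have "0 < r" "r < 1" using beta_gt by (simp_all add: r_def)
  ultimately show ?thesis unfolding e1_def e2_def by blast
qed

lemma sum_power_le:
  fixes r :: real
  assumes "0 < r" "r < 1"
  shows "(\<Sum>i\<le>m. r ^ i) \<le> 1 / (1 - r)"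
proof -
  have "(\<Sum>i\<le>m. r ^ i) \<le> (\<Sum>i. r ^ i)"
    using assms by (intro sum_le_suminf summable_geometric) auto
  then show ?thesis using assms by (simp add: suminf_geometric)
qed

end

text \<open>\<open>D\<close> plays the role of the function measuring how far the \<open>n\<close>-th power of the shift is from the
  identity, and \<open>H j\<close> that of the length of the image of the first letter under the \<open>j\<close>-th power of
  the substitution.\<close>

locale cubic_unit_lengths = cubic_unit k \<beta> for k \<beta> +
  fixes H :: "nat \<Rightarrow> int" and D :: "int \<Rightarrow> real" and C \<rho> :: real
  assumes H_rec: "H (j + 3) = int k * H (j + 2) + H j"
    and H_init: "H 0 = 1" "H 1 = int k + 1" "H 2 = int k * (int k + 1) + 1"
    and D_add: "D (x + y) \<le> D x + D y" and D_minus: "D (- x) = D x" and D_0: "D 0 = 0"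
    and D_H: "D (H j) \<le> C * \<rho> ^ j" and C: "C \<ge> 0" and rho: "0 < \<rho>" "\<rho> < 1"
begin

lemma D_nonneg: "D x \<ge> 0"
  using D_add[of x "- x"] by (simp add: D_minus D_0)

lemma D_mult: "D (m * x) \<le> \<bar>real_of_int m\<bar> * D x"
proof -
  have nat: "D (int n * x) \<le> real n * D x" for n
  proof (induction n)
    case (Suc n)
    then show ?case using D_add[of x "int n * x"] by (simp add: algebra_simps)
  qed (simp add: D_0)
  show ?thesis
  proof (cases "m \<ge> 0")
    case True
    then show ?thesis using nat[of "nat m"] by simp
  next
    case False
    then show ?thesis using nat[of "nat (- m)"] D_minus[of "m * x"] by simp
  qed
qed

lemma D_sum: "D (\<Sum>i\<le>(m::nat). f i) \<le> (\<Sum>i\<le>m. D (f i))"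
proof (induction m)
  case (Suc m)
  then show ?case using D_add[of "\<Sum>i\<le>m. f i" "f (Suc m)"] by simp
qed simp

text \<open>The length of \<open>s\<^sup>J(w)\<close> for a word \<open>w\<close> with \<open>x\<close>, \<open>y\<close> and \<open>z\<close> occurrences of the three letters.\<close>

definition lin :: "nat \<Rightarrow> int \<Rightarrow> int \<Rightarrow> int \<Rightarrow> int" where
  "lin J x y z = z * H (J + 2) + (y - int k * z) * H (J + 1) + (x - int k * y) * H J"

lemma lin_0: "lin 0 x y z = x + y + z"
  using H_init by (simp add: lin_def algebra_simps numeral_2_eq_2)

text \<open>\<open>(y, z, x - k * y)\<close> is the preimage of \<open>(x, y, z)\<close> under the
  incidence matrix. It is integral because the determinant is 1, but may have negative entries, so
  no word need stand behind it.\<close>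

lemma lin_Suc: "lin (Suc J) y z (x - int k * y) = lin J x y z"
  using H_rec[of J] by (simp add: lin_def algebra_simps numeral_eq_Suc)

lemma lin_unit_seq: "lin J (unit_seq k (i + 2)) (unit_seq k (i + 1)) (unit_seq k i) = H (J + i)"
proof (induction i arbitrary: J)
  case 0
  then show ?case by (simp add: lin_def numeral_eq_Suc)
next
  case (Suc i)
  have "lin J (unit_seq k (Suc i + 2)) (unit_seq k (Suc i + 1)) (unit_seq k (Suc i)) =
      lin (Suc J) (unit_seq k (i + 2)) (unit_seq k (i + 1)) (unit_seq k i)"
    using lin_Suc[of J "unit_seq k (i + 2)" "unit_seq k (i + 1)" "unit_seq k (Suc i + 2)"]
    by (simp add: numeral_eq_Suc)
  then show ?case using Suc[of "Suc J"] by simp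
qed

lemma lin_diff_sum:
  "lin J (x - (\<Sum>i\<le>(m::nat). c i * f i)) (y - (\<Sum>i\<le>m. c i * f' i)) (z - (\<Sum>i\<le>m. c i * f'' i)) =
    lin J x y z - (\<Sum>i\<le>m. c i * lin J (f i) (f' i) (f'' i))"
  by (induction m) (simp_all add: lin_def algebra_simps)

text \<open>Expand the first coordinate greedily and subtract the same combination of full count
  vectors, each of which contributes some \<open>H (J + i)\<close>. What remains has first
  coordinate 0 and, since the deviations in \<open>unit_seq_error\<close> sum geometrically, bounded
  other coordinates. The point is that \<open>K\<close> does not depend on the vector.\<close>

lemma D_lin_close:
  "\<exists>K \<ge> 0. \<forall>J x y z. \<bar>y - x / \<beta>\<bar> \<le> 1 \<longrightarrow> \<bar>z - x / \<beta> ^ 2\<bar> \<le> 1 \<longrightarrow> D (lin J x y z) \<le> K * \<rho> ^ J"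
proof -
  obtain A r where A: "A \<ge> 0" "0 < r" "r < 1"
      "\<And>i. \<bar>unit_seq k (i + 1) - unit_seq k (i + 2) / \<beta>\<bar> \<le> A * r ^ i"
      "\<And>i. \<bar>unit_seq k i - unit_seq k (i + 2) / \<beta> ^ 2\<bar> \<le> A * r ^ i"
    using unit_seq_error by blast
  define B where "B = 1 + (k + 1) * (A / (1 - r))"
  \<comment> \<open>The first summand comes from digits up to \<open>k + 1\<close> and the geometric
    series bounding \<open>D (H (J + i))\<close>, the second from the four terms of
    \<open>lin J 0 y' z'\<close>, with coefficients up to \<open>B\<close>, \<open>B\<close>,
    \<open>k * B\<close>, \<open>k * B\<close>.\<close>
  define K where "K = (k + 1) * (C / (1 - \<rho>)) + (B + 2 * B * k + B) * C"
  have B: "B \<ge> 0" using A by (simp add: B_def)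
  have K: "K \<ge> 0" using B C rho by (simp add: K_def)
  have pos: "D (lin J x y z) \<le> K * \<rho> ^ J"
    if "x \<ge> 0" and y: "\<bar>y - x / \<beta>\<bar> \<le> 1" and z: "\<bar>z - x / \<beta> ^ 2\<bar> \<le> 1" for J x y z
  proof -
    have "x < unit_seq k (nat x + 1 + 3)"
      using unit_seq_unbounded[of "nat x + 1"] \<open>x \<ge> 0\<close> by simp
    then obtain c m where c: "\<And>i. 0 \<le> c i \<and> c i \<le> int k + 1" and x: "x = (\<Sum>i\<le>(m::nat). c i * unit_seq k (i + 2))"
      using greedy_expansion \<open>x \<ge> 0\<close> by blast
    define y' where "y' = y - (\<Sum>i\<le>m. c i * unit_seq k (i + 1))"
    define z' where "z' = z - (\<Sum>i\<le>m. c i * unit_seq k i)"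
    have err: "\<bar>\<Sum>i\<le>m. c i * (e i :: real)\<bar> \<le> (k + 1) * (A / (1 - r))"
      if "\<And>i. \<bar>e i\<bar> \<le> A * r ^ i" for e
    proof -
      have "\<bar>\<Sum>i\<le>m. c i * e i\<bar> \<le> (\<Sum>i\<le>m. \<bar>c i * e i\<bar>)" by (rule sum_abs)
      also have "\<dots> \<le> (\<Sum>i\<le>m. (k + 1) * (A * r ^ i))"
      proof (rule sum_mono)
        fix i
        have "\<bar>real_of_int (c i)\<bar> \<le> k + 1" using c[of i] by linarith
        then show "\<bar>c i * e i\<bar> \<le> (k + 1) * (A * r ^ i)"
          unfolding abs_mult by (rule mult_mono) (use that[of i] in auto)
      qed
      also have "\<dots> = (k + 1) * A * (\<Sum>i\<le>m. r ^ i)"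
        by (simp add: sum_distrib_left mult.assoc)
      also have "\<dots> \<le> (k + 1) * A * (1 / (1 - r))"
        using sum_power_le[OF A(2,3)] A(1) by (intro mult_left_mono) auto
      finally show ?thesis by simp
    qed
    have "real_of_int y' = (y - x / \<beta>) - (\<Sum>i\<le>m. c i * (unit_seq k (i + 1) - unit_seq k (i + 2) / \<beta>))"
      by (simp add: y'_def x sum_subtractf sum_divide_distrib algebra_simps)
    then have y': "\<bar>real_of_int y'\<bar> \<le> B" using err[OF A(4)] y unfolding B_def by linarith
    have "real_of_int z' = (z - x / \<beta> ^ 2) - (\<Sum>i\<le>m. c i * (unit_seq k i - unit_seq k (i + 2) / \<beta> ^ 2))"
      by (simp add: z'_def x sum_subtractf sum_divide_distrib algebra_simps)
    then have z': "\<bar>real_of_int z'\<bar> \<le> B" using err[OF A(5)] z unfolding B_def by linarith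
    have "lin J 0 y' z' = lin J x y z - (\<Sum>i\<le>m. c i * H (J + i))"
      using lin_diff_sum[of J x c "\<lambda>i. unit_seq k (i + 2)" m y "\<lambda>i. unit_seq k (i + 1)" z "unit_seq k"]
      unfolding lin_unit_seq y'_def z'_def by (simp add: x)
    then have "D (lin J x y z) \<le> D (\<Sum>i\<le>m. c i * H (J + i)) + D (lin J 0 y' z')"
      using D_add[of "\<Sum>i\<le>m. c i * H (J + i)" "lin J 0 y' z'"] by simp
    also have "D (\<Sum>i\<le>m. c i * H (J + i)) \<le> (\<Sum>i\<le>m. D (c i * H (J + i)))" by (rule D_sum)
    also have "\<dots> \<le> (\<Sum>i\<le>m. (k + 1) * (C * \<rho> ^ (J + i)))"
    proof (rule sum_mono)
      fix i
      have "D (c i * H (J + i)) \<le> \<bar>real_of_int (c i)\<bar> * D (H (J + i))" by (rule D_mult)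
      also have "\<dots> \<le> (k + 1) * (C * \<rho> ^ (J + i))"
        using c[of i] D_H[of "J + i"] D_nonneg by (intro mult_mono) auto
      finally show "D (c i * H (J + i)) \<le> (k + 1) * (C * \<rho> ^ (J + i))" .
    qed
    also have "\<dots> = (k + 1) * C * \<rho> ^ J * (\<Sum>i\<le>m. \<rho> ^ i)"
      by (simp add: sum_distrib_left power_add mult.assoc)
    also have "\<dots> \<le> (k + 1) * C * \<rho> ^ J * (1 / (1 - \<rho>))"
      using sum_power_le[OF rho] C rho by (intro mult_left_mono) auto
    also have "D (lin J 0 y' z') \<le> (B + 2 * B * k + B) * C * \<rho> ^ J"
    proof -
      have Hle: "D (H (J + i)) \<le> C * \<rho> ^ J" for i
        using D_H[of "J + i"] power_decreasing[of J "J + i" \<rho>] C rho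
        by (meson le_add1 less_imp_le mult_left_mono order_trans)
      have dm: "D (a * H (J + i)) \<le> b * (C * \<rho> ^ J)" if "\<bar>real_of_int a\<bar> \<le> b" for a i b
        using D_mult[of a "H (J + i)"] mult_mono[OF that Hle[of i]] D_nonneg[of "H (J + i)"] that
        by linarith
      have "lin J 0 y' z' = z' * H (J + 2) + (y' * H (J + 1) + ((- int k * z') * H (J + 1) + (- int k * y') * H (J + 0)))"
        by (simp add: lin_def algebra_simps)
      also have "D \<dots> \<le> D (z' * H (J + 2)) + (D (y' * H (J + 1)) + (D ((- int k * z') * H (J + 1)) + D ((- int k * y') * H (J + 0))))"
        by (intro order_trans[OF D_add] add_left_mono order_refl)
      also have "\<dots> \<le> B * (C * \<rho> ^ J) + (B * (C * \<rho> ^ J) + ((k * B) * (C * \<rho> ^ J) + (k * B) * (C * \<rho> ^ J)))"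
        using y' z' by (intro add_mono dm) (auto simp: abs_mult intro!: mult_left_mono)
      finally show ?thesis by (simp add: algebra_simps)
    qed
    finally show ?thesis by (simp add: K_def algebra_simps add_divide_distrib)
  qed
  have "D (lin J x y z) \<le> K * \<rho> ^ J"
    if y: "\<bar>y - x / \<beta>\<bar> \<le> 1" and z: "\<bar>z - x / \<beta> ^ 2\<bar> \<le> 1" for J x y z
  proof (cases "x \<ge> 0")
    case False
    have "lin J (- x) (- y) (- z) = - lin J x y z" by (simp add: lin_def algebra_simps)
    moreover have "D (lin J (- x) (- y) (- z)) \<le> K * \<rho> ^ J"
      using False y z by (intro pos) (auto simp: abs_le_iff)
    ultimately show ?thesis by (simp add: D_minus)
  qed (use pos y z in blast)
  then show ?thesis using K by blast
qed

text \<open>Going backwards preserves the value of \<open>lin\<close>, but the inverse matrix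
  enlarges the deviation from the Perron line; \<open>\<beta> + 2\<close> is a generous bound for
  one step.\<close>

lemma lin_desubstitute:
  assumes "\<bar>real_of_int y - x / \<beta>\<bar> \<le> e" "\<bar>real_of_int z - x / \<beta> ^ 2\<bar> \<le> e"
  shows "\<exists>x' y' z'. lin J x' y' z' = x + y + z \<and>
    \<bar>real_of_int y' - x' / \<beta>\<bar> \<le> (\<beta> + 2) ^ J * e \<and> \<bar>real_of_int z' - x' / \<beta> ^ 2\<bar> \<le> (\<beta> + 2) ^ J * e"
proof (induction J)
  case 0
  then show ?case using assms by (intro exI[of _ x] exI[of _ y] exI[of _ z]) (simp add: lin_0)
next
  case (Suc J)
  let ?E = "(\<beta> + 2) ^ J * e"
  obtain x' y' z' where *: "lin J x' y' z' = x + y + z"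
      "\<bar>real_of_int y' - x' / \<beta>\<bar> \<le> ?E" "\<bar>real_of_int z' - x' / \<beta> ^ 2\<bar> \<le> ?E"
    using Suc by blast
  have E: "?E \<ge> 0" using *(2) by linarith
  have "real_of_int z' - y' / \<beta> = (z' - x' / \<beta> ^ 2) - (y' - x' / \<beta>) / \<beta>"
    using beta_pos by (simp add: field_simps power2_eq_square)
  moreover have "\<bar>(y' - x' / \<beta>) / \<beta>\<bar> \<le> ?E"
  proof -
    have "\<bar>(y' - x' / \<beta>) / \<beta>\<bar> \<le> \<bar>y' - x' / \<beta>\<bar>"
      using beta_gt by (simp add: abs_divide divide_le_eq mult_le_cancel_left1)
    then show ?thesis using *(2) by linarith
  qed
  ultimately have "\<bar>real_of_int z' - y' / \<beta>\<bar> \<le> 2 * ?E" using *(3) by linarith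
  also have "\<dots> \<le> (\<beta> + 2) * ?E" using E beta_pos by (intro mult_right_mono) auto
  finally have 1: "\<bar>real_of_int z' - y' / \<beta>\<bar> \<le> (\<beta> + 2) ^ Suc J * e" by simp
  have "real_of_int (x' - int k * y') - y' / \<beta> ^ 2 = - \<beta> * (y' - x' / \<beta>)"
    using beta_pos by (simp add: k_eq field_simps power2_eq_square)
  then have "\<bar>real_of_int (x' - int k * y') - y' / \<beta> ^ 2\<bar> \<le> \<beta> * ?E"
    using *(2) beta_pos by (simp add: abs_mult)
  also have "\<dots> \<le> (\<beta> + 2) * ?E" using E by (intro mult_right_mono) auto
  finally have 2: "\<bar>real_of_int (x' - int k * y') - y' / \<beta> ^ 2\<bar> \<le> (\<beta> + 2) ^ Suc J * e" by simp
  show ?case using 1 2 *(1) lin_Suc by metis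
qed

lemma D_small:
  assumes "\<epsilon> > 0"
  shows "\<exists>\<delta>>0. \<forall>n p q. \<bar>n * (\<beta> / (\<beta> ^ 2 + \<beta> + 1)) - real_of_int p\<bar> < \<delta> \<longrightarrow>
     \<bar>n * (1 / (\<beta> ^ 2 + \<beta> + 1)) - real_of_int q\<bar> < \<delta> \<longrightarrow> D n < \<epsilon>"
proof -
  obtain K where K: "K \<ge> 0" "\<And>J x y z. \<bar>y - x / \<beta>\<bar> \<le> 1 \<Longrightarrow> \<bar>z - x / \<beta> ^ 2\<bar> \<le> 1 \<Longrightarrow> D (lin J x y z) \<le> K * \<rho> ^ J"
    using D_lin_close by blast
  have "(\<lambda>J. K * \<rho> ^ J) \<longlonglongrightarrow> K * 0"
    using rho by (intro tendsto_mult_left LIMSEQ_power_zero) auto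
  then have "\<forall>\<^sub>F J in sequentially. K * \<rho> ^ J < \<epsilon>"
    using assms by (auto intro: order_tendstoD(2))
  then obtain J where J: "K * \<rho> ^ J < \<epsilon>" by (auto simp: eventually_sequentially)
  \<comment> \<open>\<open>J\<close> backward steps turn a deviation of \<open>3 * \<delta>\<close>
    into at most 1, as required by \<open>D_lin_close\<close>.\<close>
  define \<delta> where "\<delta> = 1 / (3 * (\<beta> + 2) ^ J)"
  have \<delta>: "\<delta> > 0" using beta_pos by (simp add: \<delta>_def)
  have "D n < \<epsilon>"
    if p: "\<bar>n * (\<beta> / (\<beta> ^ 2 + \<beta> + 1)) - real_of_int p\<bar> < \<delta>"
      and q: "\<bar>n * (1 / (\<beta> ^ 2 + \<beta> + 1)) - real_of_int q\<bar> < \<delta>" for n p q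
  proof -
    \<comment> \<open>The count vector is \<open>(?x, p, q)\<close>: its sum is \<open>n\<close>,
      and it is close to \<open>n\<close> times the letter frequencies, which are as
      \<open>\<beta> ^ 2\<close>, \<open>\<beta>\<close>, 1.\<close>
    let ?x = "n - p - q" and ?s = "\<beta> ^ 2 + \<beta> + 1"
    have s: "?s > 0" using beta_pos by (simp add: add_pos_pos)
    define a where "a = p - n * (\<beta> / ?s)"
    define b where "b = q - n * (1 / ?s)"
    have ab: "\<bar>a\<bar> < \<delta>" "\<bar>b\<bar> < \<delta>" using p q by (simp_all add: a_def b_def abs_minus_commute)
    have "n * (1 / ?s) * \<beta> ^ 2 + n * (1 / ?s) * \<beta> + n * (1 / ?s) = n * (1 / ?s) * ?s"
      by (simp only: distrib_left mult_1_right)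
    then have n: "n = n * (1 / ?s) * \<beta> ^ 2 + n * (1 / ?s) * \<beta> + n * (1 / ?s)"
      using s by simp
    define t where "t = n * (1 / ?s)"
    have n': "n = t * \<beta> ^ 2 + t * \<beta> + t" and pq: "p = t * \<beta> + a" "q = t + b"
      using n by (simp_all add: t_def a_def b_def)
    have "p - ?x / \<beta> = a + (a + b) / \<beta>" "q - ?x / \<beta> ^ 2 = b + (a + b) / \<beta> ^ 2"
      unfolding of_int_diff n' pq using beta_pos by (simp_all add: field_simps power2_eq_square)
    moreover have "\<bar>(a + b) / \<beta>\<bar> \<le> \<bar>a + b\<bar>" "\<bar>(a + b) / \<beta> ^ 2\<bar> \<le> \<bar>a + b\<bar>"
      using beta_gt one_le_power[of \<beta> 2] by (simp_all add: abs_divide divide_le_eq mult_le_cancel_left1)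
    ultimately have "\<bar>p - ?x / \<beta>\<bar> \<le> 3 * \<delta>" "\<bar>q - ?x / \<beta> ^ 2\<bar> \<le> 3 * \<delta>" using ab by linarith+
    from lin_desubstitute[OF this, of J] obtain x' y' z' where
      "lin J x' y' z' = n" "\<bar>real_of_int y' - x' / \<beta>\<bar> \<le> (\<beta> + 2) ^ J * (3 * \<delta>)"
      "\<bar>real_of_int z' - x' / \<beta> ^ 2\<bar> \<le> (\<beta> + 2) ^ J * (3 * \<delta>)" by auto
    moreover have "(\<beta> + 2) ^ J * (3 * \<delta>) = 1" using beta_pos by (simp add: \<delta>_def)
    ultimately have "D n \<le> K * \<rho> ^ J" using K(2)[of y' x' z' J] by simp
    then show ?thesis using J by linarith
  qed
  then show ?thesis using \<delta> by blast
qed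

end

section \<open>Irreducibility of the cubic and rational independence of the frequencies\<close>

context cubic_unit
begin

lemma no_rational_root:
  fixes r :: real
  assumes "r \<in> \<rat>"
  shows "r ^ 3 \<noteq> k * r ^ 2 + 1"
proof
  assume eq: "r ^ 3 = k * r ^ 2 + 1"
  obtain m n :: int where mn: "n > 0" "coprime m n" "r = m / n"
    using assms by (metis Rats_cases')
  have "real_of_int (m ^ 3) = real_of_int (int k * m ^ 2 * n + n ^ 3)"
    using eq mn(1) unfolding mn(3) by (simp add: field_simps power3_eq_cube power2_eq_square)
  then have m3: "m ^ 3 = int k * m ^ 2 * n + n ^ 3" by linarith
  have "n dvd m ^ 3" unfolding m3 by (intro dvd_add) (auto intro: dvd_power)
  then have "n dvd 1" using mn(2)
    by (metis coprime_commute coprime_power_right_iff coprime_def dvd_refl)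
  then have n: "n = 1" using mn(1) by simp
  have "n ^ 3 = m ^ 2 * (m - int k * n)" using m3 by (simp add: algebra_simps power3_eq_cube power2_eq_square)
  then have "m dvd 1" using n by (metis dvd_mult2 dvd_triv_left power2_eq_square power_one)
  then have "m = 1 \<or> m = -1" by auto
  then show False using m3 n k by auto
qed

lemma beta_irrational: "\<beta> \<notin> \<rat>"
  using no_rational_root beta_cubic by blast

text \<open>Multiplying by \<open>\<beta>\<close> and reducing the cube gives a second relation.
  Eliminating \<open>\<beta> ^ 2\<close> leaves a linear one, trivial by irrationality; the
  vanishing of its coefficients would make \<open>(k * a + b) / a\<close> a rational root of the
  cubic.\<close>

lemma linear_independent:
  fixes a b c :: int
  assumes "a * \<beta> ^ 2 + b * \<beta> + c = 0"
  shows "a = 0 \<and> b = 0 \<and> c = 0"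
proof -
  have lin: "b' = 0 \<and> c' = 0" if "b' * \<beta> + c' = 0" for b' c' :: int
  proof -
    have "b' = 0"
    proof (rule ccontr)
      assume "b' \<noteq> 0"
      then have "\<beta> = - c' / b'" using that by (simp add: field_simps)
      then show False using beta_irrational by simp
    qed
    then show ?thesis using that by simp
  qed
  have "a = 0"
  proof (rule ccontr)
    assume a: "a \<noteq> 0"
    have "(int k * a + b) * \<beta> ^ 2 + c * \<beta> + a =
        (a * \<beta> ^ 2 + b * \<beta> + c) * \<beta> - a * (\<beta> ^ 3 - (k * \<beta> ^ 2 + 1))"
      by (simp add: power3_eq_cube power2_eq_square algebra_simps)
    then have 2: "(int k * a + b) * \<beta> ^ 2 + c * \<beta> + a = 0"
      using assms by (simp add: beta_cubic)
    have "real_of_int ((int k * a + b) * b - a * c) * \<beta> + real_of_int ((int k * a + b) * c - a * a) =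
      (int k * a + b) * (a * \<beta> ^ 2 + b * \<beta> + c) - a * ((int k * a + b) * \<beta> ^ 2 + c * \<beta> + a)"
      by (simp add: algebra_simps)
    also have "\<dots> = 0" using assms 2 by simp
    finally have "(int k * a + b) * b - a * c = 0 \<and> (int k * a + b) * c - a * a = 0"
      by (rule lin)
    then have e: "(int k * a + b) * b = a * c" "(int k * a + b) * c = a * a" by simp_all
    define r where "r = real_of_int (int k * a + b) / a"
    have ra: "r * a = k * a + b" using a by (simp add: r_def)
    have rb: "r * b = c"
      using a arg_cong[OF e(1), of real_of_int] by (simp add: r_def field_simps)
    have rc: "r * c = a"
      using a arg_cong[OF e(2), of real_of_int] by (simp add: r_def field_simps)
    have "b = (r - k) * a" using ra by (simp add: algebra_simps)
    then have "r ^ 2 * (r - k) * a = a" using rb rc by (simp add: power2_eq_square mult.assoc)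
    then have "r ^ 2 * (r - k) = 1" using a by (metis mult_cancel_right2 of_int_eq_0_iff)
    then have "r ^ 3 = k * r ^ 2 + 1" by (simp add: power3_eq_cube power2_eq_square algebra_simps)
    moreover have "r \<in> \<rat>" by (simp add: r_def)
    ultimately show False using no_rational_root by blast
  qed
  moreover from this have "b = 0 \<and> c = 0" using lin assms by simp
  ultimately show ?thesis by simp
qed

lemma frequencies_independent:
  fixes d d' c :: int
  assumes "d * (\<beta> / (\<beta> ^ 2 + \<beta> + 1)) + d' * (1 / (\<beta> ^ 2 + \<beta> + 1)) = c"
  shows "d = 0 \<and> d' = 0"
proof -
  have "\<beta> ^ 2 + \<beta> + 1 > 0" using beta_pos by (simp add: add_pos_pos)
  moreover have "(d * \<beta> + d') / (\<beta> ^ 2 + \<beta> + 1) = c" using assms by (simp add: add_divide_distrib)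
  ultimately have "d * \<beta> + d' = c * (\<beta> ^ 2 + \<beta> + 1)" by (simp add: divide_eq_eq)
  then have "c * \<beta> ^ 2 + (c - d) * \<beta> + (c - d') = 0" by (simp add: algebra_simps)
  then show ?thesis using linear_independent[of c "c - d" "c - d'"] by simp
qed

end

lemma ex_cubic_unit:
  assumes "k \<ge> 1"
  shows "\<exists>\<beta>. cubic_unit k \<beta>"
proof -
  let ?f = "\<lambda>x::real. x ^ 3 - k * x ^ 2 - 1"
  have "\<exists>x\<ge>real k. x \<le> k + 1 \<and> ?f x = 0"
    by (rule IVT') (auto intro!: continuous_intros simp: power3_eq_cube power2_eq_square algebra_simps)
  then obtain x :: real where x: "x \<ge> k" "?f x = 0" by blast
  \<comment> \<open>The polynomial is -1 at \<open>k\<close>; excluding this endpoint gives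
    \<open>x > 1\<close> also for \<open>k = 1\<close>.\<close>
  have "x \<noteq> k" using x(2) by (auto simp: power3_eq_cube power2_eq_square)
  then have "x > 1" using x(1) assms by simp
  then show ?thesis using x assms by (intro exI[of _ x]) (unfold_locales, auto)
qed

section \<open>The seminorm of square integrable functions\<close>

lemma L2_functions_measurable: "f \<in> L2_functions M \<Longrightarrow> f \<in> borel_measurable M"
  by (simp add: L2_functions_def)

lemma L2_functions_integrable: "f \<in> L2_functions M \<Longrightarrow> integrable M (\<lambda>x. (cmod (f x))\<^sup>2)"
  by (simp add: L2_functions_def)

lemma L2_norm_nonneg [simp]: "L2_norm M f \<ge> 0"
  by (simp add: L2_norm_def)

lemma L2_norm_power2: "(L2_norm M f)\<^sup>2 = (\<integral>x. (cmod (f x))\<^sup>2 \<partial>M)"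
  by (simp add: L2_norm_def)

lemma weighted_square_add:
  fixes a b t :: real
  assumes "t > 0"
  shows "(a + b)\<^sup>2 \<le> (1 + t) * a\<^sup>2 + (1 + 1 / t) * b\<^sup>2"
proof -
  have "0 \<le> (t * a - b)\<^sup>2 / t" using assms by simp
  also have "\<dots> = (1 + t) * a\<^sup>2 + (1 + 1 / t) * b\<^sup>2 - (a + b)\<^sup>2"
    using assms by (simp add: field_simps power2_eq_square)
  finally show ?thesis by simp
qed

lemma cmod_weighted_square_add:
  assumes "t > 0"
  shows "(cmod (a + b))\<^sup>2 \<le> (1 + t) * (cmod a)\<^sup>2 + (1 + 1 / t) * (cmod b)\<^sup>2"
  using order_trans[OF power_mono[OF norm_triangle_ineq norm_ge_zero] weighted_square_add[OF assms]] .

lemma L2_functions_add: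
  assumes "f \<in> L2_functions M" "g \<in> L2_functions M"
  shows "(\<lambda>x. f x + g x) \<in> L2_functions M"
proof -
  have [measurable]: "f \<in> borel_measurable M" "g \<in> borel_measurable M"
    using assms by (simp_all add: L2_functions_measurable)
  have "integrable M (\<lambda>x. (cmod (f x + g x))\<^sup>2)"
  proof (rule Bochner_Integration.integrable_bound)
    show "integrable M (\<lambda>x. (1 + 1) * (cmod (f x))\<^sup>2 + (1 + 1 / 1) * (cmod (g x))\<^sup>2)"
      using assms[THEN L2_functions_integrable] by auto
    show "AE x in M. norm ((cmod (f x + g x))\<^sup>2) \<le>
        norm ((1 + 1) * (cmod (f x))\<^sup>2 + (1 + 1 / 1) * (cmod (g x))\<^sup>2)"
      using cmod_weighted_square_add[of 1] by (intro AE_I2) (fastforce intro: order_trans[OF _ abs_ge_self])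
  qed measurable
  then show ?thesis by (simp add: L2_functions_def)
qed

lemma L2_functions_cmult:
  assumes "f \<in> L2_functions M"
  shows "(\<lambda>x. c * f x) \<in> L2_functions M"
  using assms by (auto simp: L2_functions_def norm_mult power_mult_distrib intro: borel_measurable_times)

lemma L2_functions_diff:
  assumes "f \<in> L2_functions M" "g \<in> L2_functions M"
  shows "(\<lambda>x. f x - g x) \<in> L2_functions M"
  using L2_functions_add[OF assms(1) L2_functions_cmult[OF assms(2), of "-1"]] by simp

lemma L2_functions_zero: "(\<lambda>x. 0) \<in> L2_functions M"
  by (simp add: L2_functions_def)

lemma L2_functions_sum:
  "(\<And>i. i \<in> I \<Longrightarrow> f i \<in> L2_functions M) \<Longrightarrow> (\<lambda>x. \<Sum>i\<in>I. f i x) \<in> L2_functions M"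
  by (induction I rule: infinite_finite_induct) (simp_all add: L2_functions_zero L2_functions_add)

lemma L2_norm_cmult: "L2_norm M (\<lambda>x. c * f x) = cmod c * L2_norm M f"
  by (simp add: L2_norm_def norm_mult power_mult_distrib real_sqrt_mult)

lemma L2_norm_minus: "L2_norm M (\<lambda>x. f x - g x) = L2_norm M (\<lambda>x. g x - f x)"
  by (simp add: L2_norm_def norm_minus_commute)

lemma L2_norm_zero [simp]: "L2_norm M (\<lambda>x. 0) = 0"
  by (simp add: L2_norm_def)

text \<open>Minkowski's inequality, by optimising the weighted estimate over \<open>t\<close>: the
  choice \<open>B / A\<close> turns the right-hand side into the square of \<open>A + B\<close>. The
  added \<open>e / 2\<close> keeps both numbers positive.\<close>

lemma L2_norm_triangle:
  assumes f: "f \<in> L2_functions M" and g: "g \<in> L2_functions M"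
  shows "L2_norm M (\<lambda>x. f x + g x) \<le> L2_norm M f + L2_norm M g"
proof (rule field_le_epsilon)
  fix e :: real assume e: "e > 0"
  define A where "A = L2_norm M f + e / 2"
  define B where "B = L2_norm M g + e / 2"
  have A: "A > 0" "L2_norm M f \<le> A" and B: "B > 0" "L2_norm M g \<le> B"
    using e by (auto simp: A_def B_def intro: add_nonneg_pos)
  define t where "t = B / A"
  have t: "t > 0" using A B by (simp add: t_def)
  note int = f[THEN L2_functions_integrable] g[THEN L2_functions_integrable]
    L2_functions_add[OF f g, THEN L2_functions_integrable]
  have "(L2_norm M (\<lambda>x. f x + g x))\<^sup>2 \<le>
      (\<integral>x. (1 + t) * (cmod (f x))\<^sup>2 + (1 + 1 / t) * (cmod (g x))\<^sup>2 \<partial>M)"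
    unfolding L2_norm_power2 using int
    by (intro integral_mono cmod_weighted_square_add t) auto
  also have "\<dots> = (1 + t) * (L2_norm M f)\<^sup>2 + (1 + 1 / t) * (L2_norm M g)\<^sup>2"
    using int by (simp add: L2_norm_power2)
  also have "\<dots> \<le> (1 + t) * A\<^sup>2 + (1 + 1 / t) * B\<^sup>2"
    using t A B by (intro add_mono mult_left_mono power_mono) auto
  also have "\<dots> = (A + B)\<^sup>2"
    using A B by (simp add: t_def field_simps power2_eq_square)
  finally have "L2_norm M (\<lambda>x. f x + g x) \<le> A + B"
    by (rule power2_le_imp_le) (use A B in auto)
  then show "L2_norm M (\<lambda>x. f x + g x) \<le> L2_norm M f + L2_norm M g + e"
    by (simp add: A_def B_def)
qed

lemma L2_norm_triangle_diff:
  assumes "f \<in> L2_functions M" "g \<in> L2_functions M" "h \<in> L2_functions M"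
  shows "L2_norm M (\<lambda>x. f x - h x) \<le> L2_norm M (\<lambda>x. f x - g x) + L2_norm M (\<lambda>x. g x - h x)"
  using L2_norm_triangle[OF L2_functions_diff[OF assms(1,2)] L2_functions_diff[OF assms(2,3)]] by simp

lemma L2_norm_diff_le:
  assumes "f \<in> L2_functions M" "g \<in> L2_functions M"
  shows "L2_norm M (\<lambda>x. f x - g x) \<le> L2_norm M f + L2_norm M g"
  using L2_norm_triangle_diff[OF assms(1) L2_functions_zero assms(2)]
  by (simp add: L2_norm_def)

lemma L2_norm_sum:
  assumes "\<And>i. i \<in> I \<Longrightarrow> f i \<in> L2_functions M"
  shows "L2_norm M (\<lambda>x. \<Sum>i\<in>I. f i x) \<le> (\<Sum>i\<in>I. L2_norm M (f i))"
  using assms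
proof (induction I rule: infinite_finite_induct)
  case (insert i I)
  then show ?case
    using L2_norm_triangle[of "f i" M "\<lambda>x. \<Sum>i\<in>I. f i x"] L2_functions_sum[of I f M] by simp
qed simp_all

lemma L2_norm_parallelogram:
  assumes "f \<in> L2_functions M" "g \<in> L2_functions M"
  shows "(L2_norm M (\<lambda>x. f x - g x))\<^sup>2 =
    2 * (L2_norm M f)\<^sup>2 + 2 * (L2_norm M g)\<^sup>2 - (L2_norm M (\<lambda>x. f x + g x))\<^sup>2"
proof -
  have "(cmod (a - b))\<^sup>2 = 2 * (cmod a)\<^sup>2 + 2 * (cmod b)\<^sup>2 - (cmod (a + b))\<^sup>2" for a b
    unfolding cmod_power2 by (simp add: power2_eq_square algebra_simps)
  then show ?thesis
    using assms[THEN L2_functions_integrable] L2_functions_add[OF assms, THEN L2_functions_integrable]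
    by (simp add: L2_norm_power2)
qed

lemma L2_norm_eq_0:
  assumes "f \<in> L2_functions M"
  shows "L2_norm M f = 0 \<longleftrightarrow> (AE x in M. f x = 0)"
  using integral_nonneg_eq_0_iff_AE[OF L2_functions_integrable[OF assms]] by (simp add: L2_norm_def)

lemma (in prob_space) L2_functions_bounded:
  assumes "f \<in> borel_measurable M" "\<And>x. cmod (f x) \<le> B"
  shows "f \<in> L2_functions M"
proof -
  have "integrable M (\<lambda>x. (cmod (f x))\<^sup>2)"
    using assms by (intro integrable_const_bound[of _ "B\<^sup>2"] AE_I2) (auto intro: power_mono)
  then show ?thesis using assms by (simp add: L2_functions_def)
qed

text \<open>The Riesz-Fischer argument: a subsequence with summable increments converges almost
  everywhere, and the uniform bound allows dominated convergence.\<close>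

lemma (in prob_space) L2_bounded_complete:
  fixes g :: "nat \<Rightarrow> 'a \<Rightarrow> complex"
  assumes meas [measurable]: "\<And>n. g n \<in> borel_measurable M" and bound: "\<And>n x. cmod (g n x) \<le> B"
    and Cauchy: "\<And>e. e > 0 \<Longrightarrow> \<exists>N. \<forall>m\<ge>N. \<forall>n\<ge>N. L2_norm M (\<lambda>x. g m x - g n x) < e"
  shows "\<exists>h \<in> L2_functions M. (\<lambda>n. L2_norm M (\<lambda>x. g n x - h x)) \<longlonglongrightarrow> 0"
proof -
  have gL2: "g n \<in> L2_functions M" for n
    using bound by (intro L2_functions_bounded) auto
  have "\<exists>N. \<forall>m\<ge>N. \<forall>n\<ge>N. L2_norm M (\<lambda>x. g m x - g n x) < (1/2) ^ k" for k
    by (rule Cauchy) simp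
  then obtain N where N: "\<And>k m n. m \<ge> N k \<Longrightarrow> n \<ge> N k \<Longrightarrow> L2_norm M (\<lambda>x. g m x - g n x) < (1/2) ^ k"
    by metis
  define r where "r = (\<lambda>k. \<Sum>i\<le>k. N i)"
  have r: "N k \<le> r k" "N k \<le> r (Suc k)" for k
    by (auto simp: r_def intro: order_trans[OF member_le_sum[of k]] trans_le_add1)
  define d where "d = (\<lambda>k x. g (r (Suc k)) x - g (r k) x)"
  have [measurable]: "d k \<in> borel_measurable M" for k by (simp add: d_def)
  have d_int: "(\<integral>\<^sup>+x. ennreal (norm (d k x)) \<partial>M) \<le> ennreal ((1/2) ^ k)" for k
  proof -
    let ?q = "(1/2::real) ^ k"
    have q: "?q > 0" by simp
    have sq: "integrable M (\<lambda>x. (norm (d k x))\<^sup>2)"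
      using L2_functions_integrable[OF L2_functions_diff[OF gL2 gL2]] by (simp add: d_def)
    \<comment> \<open>An AM-GM estimate at scale \<open>?q\<close> in place of
      Cauchy-Schwarz.\<close>
    have pt: "norm (d k x) \<le> ((norm (d k x))\<^sup>2 / ?q + ?q) / 2" for x
    proof -
      have "0 \<le> (norm (d k x) - ?q)\<^sup>2 / ?q" using q by simp
      also have "\<dots> = (norm (d k x))\<^sup>2 / ?q + ?q - 2 * norm (d k x)"
        using q by (simp add: power2_eq_square diff_divide_distrib add_divide_distrib algebra_simps)
      finally show ?thesis by simp
    qed
    have "(\<integral>\<^sup>+x. ennreal (norm (d k x)) \<partial>M) \<le> (\<integral>\<^sup>+x. ennreal (((norm (d k x))\<^sup>2 / ?q + ?q) / 2) \<partial>M)"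
      using pt by (intro nn_integral_mono ennreal_leI)
    also have "\<dots> = ennreal (\<integral>x. ((norm (d k x))\<^sup>2 / ?q + ?q) / 2 \<partial>M)"
      using sq q by (intro nn_integral_eq_integral) auto
    also have "(\<integral>x. ((norm (d k x))\<^sup>2 / ?q + ?q) / 2 \<partial>M) = ((L2_norm M (d k))\<^sup>2 / ?q + ?q) / 2"
      using sq by (simp add: L2_norm_power2 prob_space)
    also have "ennreal \<dots> \<le> ennreal ?q"
    proof (rule ennreal_leI)
      have "L2_norm M (d k) \<le> ?q"
        unfolding d_def using N[OF r(2) r(1)] by (rule less_imp_le)
      then have "(L2_norm M (d k))\<^sup>2 \<le> ?q\<^sup>2" by (rule power_mono) simp
      then have "(L2_norm M (d k))\<^sup>2 / ?q \<le> ?q" using q by (simp add: divide_le_eq power2_eq_square)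
      then show "((L2_norm M (d k))\<^sup>2 / ?q + ?q) / 2 \<le> ?q" by simp
    qed
    finally show ?thesis .
  qed
  have "(\<integral>\<^sup>+x. (\<Sum>k. ennreal (norm (d k x))) \<partial>M) = (\<Sum>k. \<integral>\<^sup>+x. ennreal (norm (d k x)) \<partial>M)"
    by (rule nn_integral_suminf) simp
  also have "\<dots> \<le> (\<Sum>k. ennreal ((1/2) ^ k))" by (intro suminf_le d_int) auto
  also have "\<dots> = ennreal (\<Sum>k. (1/2) ^ k)" by (rule suminf_ennreal2) (auto intro: summable_geometric)
  finally have "(\<integral>\<^sup>+x. (\<Sum>k. ennreal (norm (d k x))) \<partial>M) \<noteq> \<infinity>" by (auto simp: top_unique)
  then have "AE x in M. (\<Sum>k. ennreal (norm (d k x))) \<noteq> \<infinity>"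
    by (intro nn_integral_noteq_infinite) auto
  then have conv: "AE x in M. convergent (\<lambda>k. g (r k) x)"
  proof (rule AE_mp, intro AE_I2 impI)
    fix x assume "(\<Sum>k. ennreal (norm (d k x))) \<noteq> \<infinity>"
    then have "summable (\<lambda>k. norm (d k x))" by (intro summable_suminf_not_top) auto
    then have "summable (\<lambda>k. d k x)" by (rule summable_norm_cancel)
    then have "convergent (\<lambda>n. \<Sum>k<n. d k x)" by (simp add: summable_iff_convergent)
    then have "convergent (\<lambda>n. (\<Sum>k<n. d k x) + g (r 0) x)" by (rule convergent_add) (rule convergent_const)
    moreover have "(\<Sum>k<n. d k x) + g (r 0) x = g (r n) x" for n
      using sum_lessThan_telescope[of "\<lambda>k. g (r k) x" n] by (simp add: d_def)
    ultimately show "convergent (\<lambda>k. g (r k) x)" by simp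
  qed
  define h where "h = (\<lambda>x. lim (\<lambda>k. g (r k) x))"
  have [measurable]: "h \<in> borel_measurable M" unfolding h_def by measurable
  have lim: "AE x in M. (\<lambda>k. g (r k) x) \<longlonglongrightarrow> h x"
    using conv by eventually_elim (simp add: h_def convergent_LIMSEQ_iff)
  have hB: "AE x in M. cmod (h x) \<le> B"
    using lim by eventually_elim (rule Lim_bounded[OF tendsto_norm], auto intro: bound)
  have "AE x in M. norm ((cmod (h x))\<^sup>2) \<le> B\<^sup>2"
    using hB by eventually_elim (simp add: power_mono)
  then have "integrable M (\<lambda>x. (cmod (h x))\<^sup>2)"
    by (rule integrable_const_bound) measurable
  then have hL2: "h \<in> L2_functions M" by (simp add: L2_functions_def)
  have "(\<lambda>k. \<integral>x. (cmod (g (r k) x - h x))\<^sup>2 \<partial>M) \<longlonglongrightarrow> (\<integral>x. 0 \<partial>M)"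
  proof (rule integral_dominated_convergence[where w = "\<lambda>x. (2 * B)\<^sup>2"])
    show "AE x in M. (\<lambda>k. (cmod (g (r k) x - h x))\<^sup>2) \<longlonglongrightarrow> 0"
      using lim
    proof eventually_elim
      case (elim x)
      have "(\<lambda>k. (cmod (g (r k) x - h x))\<^sup>2) \<longlonglongrightarrow> (cmod (h x - h x))\<^sup>2"
        by (intro tendsto_intros elim)
      then show ?case by simp
    qed
    show "AE x in M. norm ((cmod (g (r k) x - h x))\<^sup>2) \<le> (2 * B)\<^sup>2" for k
      using hB
    proof eventually_elim
      case (elim x)
      have "cmod (g (r k) x - h x) \<le> 2 * B"
        using norm_triangle_ineq4[of "g (r k) x" "h x"] bound[of "r k" x] elim by linarith
      then have "(cmod (g (r k) x - h x))\<^sup>2 \<le> (2 * B)\<^sup>2" by (rule power_mono) simp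
      then show ?case by simp
    qed
  qed auto
  then have "(\<lambda>k. (L2_norm M (\<lambda>x. g (r k) x - h x))\<^sup>2) \<longlonglongrightarrow> 0" by (simp add: L2_norm_power2)
  then have sub: "(\<lambda>k. L2_norm M (\<lambda>x. g (r k) x - h x)) \<longlonglongrightarrow> 0"
    using tendsto_real_sqrt by fastforce
  have "(\<lambda>n. L2_norm M (\<lambda>x. g n x - h x)) \<longlonglongrightarrow> 0"
  proof (rule LIMSEQ_I)
    fix e :: real assume e: "e > 0"
    then obtain k0 where k0: "\<And>k. k \<ge> k0 \<Longrightarrow> L2_norm M (\<lambda>x. g (r k) x - h x) < e / 2"
      using LIMSEQ_D[OF sub, of "e / 2"] by auto
    obtain k1 where k1: "(1/2::real) ^ k1 < e / 2"
      using e real_arch_pow_inv[of "e / 2" "1/2"] by auto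
    define k where "k = max k0 k1"
    have "(1/2::real) ^ k \<le> (1/2) ^ k1" by (intro power_decreasing) (auto simp: k_def)
    then have k: "(1/2::real) ^ k < e / 2" using k1 by linarith
    have "L2_norm M (\<lambda>x. g n x - h x) < e" if "n \<ge> N k" for n
      using N[OF that r(1)] k0[of k] k L2_norm_triangle_diff[OF gL2 gL2 hL2, of n "r k"]
      by (simp add: k_def)
    then show "\<exists>no. \<forall>n\<ge>no. norm (L2_norm M (\<lambda>x. g n x - h x) - 0) < e" by auto
  qed
  then show ?thesis using hL2 by blast
qed

section \<open>The mean ergodic theorem\<close>

locale measure_preserving_map = prob_space M for M :: "'x measure" +
  fixes T :: "'x \<Rightarrow> 'x"
  assumes T_meas: "T \<in> M \<rightarrow>\<^sub>M M" and T_distr: "distr M M T = M"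
begin

lemma iter_meas [measurable]: "T ^^ n \<in> M \<rightarrow>\<^sub>M M"
proof (induction n)
  case (Suc n)
  then show ?case using T_meas by simp
qed simp

lemma iter_distr: "distr M M (T ^^ n) = M"
proof (induction n)
  case (Suc n)
  have "distr M M (T ^^ Suc n) = distr (distr M M (T ^^ n)) M T"
    by (simp only: distr_distr[OF T_meas iter_meas] funpow.simps)
  then show ?case by (simp only: Suc T_distr)
qed simp

lemma L2_functions_iter:
  assumes "f \<in> L2_functions M"
  shows "(\<lambda>x. f ((T ^^ n) x)) \<in> L2_functions M"
proof -
  note [measurable] = L2_functions_measurable[OF assms]
  have "integrable (distr M M (T ^^ n)) (\<lambda>x. (cmod (f x))\<^sup>2)"
    using L2_functions_integrable[OF assms] by (simp add: iter_distr)
  then have "integrable M (\<lambda>x. (cmod (f ((T ^^ n) x)))\<^sup>2)"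
    by (subst (asm) integrable_distr_eq) auto
  then show ?thesis by (simp add: L2_functions_def)
qed

lemma L2_norm_iter:
  assumes "f \<in> borel_measurable M"
  shows "L2_norm M (\<lambda>x. f ((T ^^ n) x)) = L2_norm M f"
proof -
  have "(\<integral>x. (cmod (f x))\<^sup>2 \<partial>distr M M (T ^^ n)) = (\<integral>x. (cmod (f ((T ^^ n) x)))\<^sup>2 \<partial>M)"
    using assms by (intro integral_distr) auto
  then show ?thesis by (simp add: L2_norm_def iter_distr)
qed

text \<open>The \<open>n\<close>-th iterate on \<open>f\<close> of z U, with U the Koopman operator.
  Fixed vectors of z U are eigenvectors of U for 1 / z, so the mean ergodic theorem for the isometry
  z U, with z on the unit circle, extracts one spectral component.\<close>

definition twisted :: "complex \<Rightarrow> ('x \<Rightarrow> complex) \<Rightarrow> nat \<Rightarrow> 'x \<Rightarrow> complex" where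
  "twisted z f n x = z ^ n * f ((T ^^ n) x)"

definition average :: "complex \<Rightarrow> ('x \<Rightarrow> complex) \<Rightarrow> nat \<Rightarrow> 'x \<Rightarrow> complex" where
  "average z f n x = (\<Sum>i<n. twisted z f i x) / of_nat n"

lemma twisted_L2:
  assumes "f \<in> L2_functions M"
  shows "twisted z f n \<in> L2_functions M"
  unfolding twisted_def by (intro L2_functions_cmult L2_functions_iter assms)

lemma twisted_norm:
  assumes "f \<in> L2_functions M" "cmod z = 1"
  shows "L2_norm M (twisted z f n) = L2_norm M f"
  unfolding twisted_def using assms
  by (simp add: L2_norm_cmult L2_norm_iter L2_functions_measurable norm_power)

lemma average_L2:
  assumes "f \<in> L2_functions M"
  shows "average z f n \<in> L2_functions M"
proof -
  have "(\<lambda>x. (1 / of_nat n) * (\<Sum>i<n. twisted z f i x)) \<in> L2_functions M"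
    by (intro L2_functions_cmult L2_functions_sum twisted_L2 assms)
  then show ?thesis unfolding average_def[abs_def] by simp
qed

lemma twisted_sum_shift_norm:
  assumes f: "f \<in> L2_functions M" and z: "cmod z = 1"
  shows "L2_norm M (\<lambda>x. (\<Sum>n<N. twisted z f n x) - (\<Sum>n<N. twisted z f (n + i) x)) \<le> 2 * real i * L2_norm M f"
proof (induction i)
  case (Suc i)
  let ?P = "\<lambda>i x. \<Sum>n<N. twisted z f (n + i) x"
  have L2: "?P i \<in> L2_functions M" for i
    by (intro L2_functions_sum twisted_L2 f)
  have "?P i x - ?P (Suc i) x = twisted z f i x - twisted z f (N + i) x" for x
    using sum_lessThan_telescope'[of "\<lambda>n. twisted z f (n + i) x" N] by (simp add: sum_subtractf add.commute)
  then have "L2_norm M (\<lambda>x. ?P i x - ?P (Suc i) x) \<le> 2 * L2_norm M f"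
    using L2_norm_diff_le[OF twisted_L2[OF f, of z i] twisted_L2[OF f, of z "N + i"]]
    by (simp add: twisted_norm[OF f z])
  then show ?case
    using Suc L2_norm_triangle_diff[OF L2[of 0] L2[of i] L2[of "Suc i"]] by (simp add: algebra_simps)
qed simp

text \<open>Averaging the convex combination along its own orbit gives the average of
  \<open>f\<close> up to shifts of the window by fewer than \<open>R\<close> steps, a boundary term;
  averaging the orbit under an isometry does not increase the norm.\<close>

lemma average_norm_le_combination:
  assumes f: "f \<in> L2_functions M" and z: "cmod z = 1" and N: "N > 0"
    and c: "\<And>i. c i \<ge> 0" "(\<Sum>i<R. c i) = (1::real)"
  shows "L2_norm M (average z f N) \<le>
    L2_norm M (\<lambda>x. \<Sum>i<R. complex_of_real (c i) * twisted z f i x) + 2 * R * L2_norm M f / N"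
proof -
  let ?G = "\<lambda>x. \<Sum>i<R. complex_of_real (c i) * twisted z f i x"
  let ?P = "\<lambda>i x. \<Sum>n<N. twisted z f (n + i) x"
  have G: "?G \<in> L2_functions M"
    by (intro L2_functions_sum L2_functions_cmult twisted_L2 f)
  have P: "?P i \<in> L2_functions M" for i
    by (intro L2_functions_sum twisted_L2 f)
  have tG: "twisted z ?G n x = (\<Sum>i<R. complex_of_real (c i) * twisted z f (n + i) x)" for n x
  proof -
    have "(T ^^ i) ((T ^^ n) x) = (T ^^ (n + i)) x" for i
      by (metis add.commute comp_apply funpow_add)
    then show ?thesis
      by (simp add: twisted_def sum_distrib_left power_add mult.assoc mult.left_commute)
  qed
  have c1: "(\<Sum>i<R. complex_of_real (c i)) = 1"
    using c(2) by (metis of_real_1 of_real_sum)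
  have eq: "(\<Sum>n<N. twisted z f n x) = (\<Sum>n<N. twisted z ?G n x) +
      (\<Sum>i<R. complex_of_real (c i) * (?P 0 x - ?P i x))" for x
  proof -
    have "(\<Sum>n<N. twisted z ?G n x) = (\<Sum>i<R. complex_of_real (c i) * ?P i x)"
      unfolding tG by (subst sum.swap) (simp add: sum_distrib_left)
    moreover have "?P 0 x = (\<Sum>i<R. complex_of_real (c i) * ?P 0 x)"
      by (simp only: c1 mult_1 flip: sum_distrib_right)
    ultimately show ?thesis by (simp add: right_diff_distrib sum_subtractf)
  qed
  have "L2_norm M (\<lambda>x. \<Sum>n<N. twisted z f n x) \<le> L2_norm M (\<lambda>x. \<Sum>n<N. twisted z ?G n x) +
      L2_norm M (\<lambda>x. \<Sum>i<R. complex_of_real (c i) * (?P 0 x - ?P i x))"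
    unfolding eq
    by (intro L2_norm_triangle L2_functions_sum L2_functions_cmult L2_functions_diff twisted_L2 G P f)
  also have "L2_norm M (\<lambda>x. \<Sum>n<N. twisted z ?G n x) \<le> (\<Sum>n<N. L2_norm M (twisted z ?G n))"
    by (intro L2_norm_sum twisted_L2 G)
  also have "\<dots> = N * L2_norm M ?G" by (simp add: twisted_norm[OF G z])
  also have "L2_norm M (\<lambda>x. \<Sum>i<R. complex_of_real (c i) * (?P 0 x - ?P i x)) \<le>
      (\<Sum>i<R. L2_norm M (\<lambda>x. complex_of_real (c i) * (?P 0 x - ?P i x)))"
    by (intro L2_norm_sum L2_functions_cmult L2_functions_diff P)
  also have "\<dots> \<le> (\<Sum>i<R. c i * (2 * R * L2_norm M f))"
  proof (rule sum_mono)
    fix i assume i: "i \<in> {..<R}"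
    have "L2_norm M (\<lambda>x. ?P 0 x - ?P i x) \<le> 2 * real i * L2_norm M f"
      using twisted_sum_shift_norm[OF f z, of N i] by simp
    also have "\<dots> \<le> 2 * R * L2_norm M f" using i by (intro mult_right_mono) auto
    finally show "L2_norm M (\<lambda>x. complex_of_real (c i) * (?P 0 x - ?P i x)) \<le> c i * (2 * R * L2_norm M f)"
      using c(1)[of i] by (simp only: L2_norm_cmult norm_of_real abs_of_nonneg mult_left_mono)
  qed
  also have "\<dots> = 2 * R * L2_norm M f" by (simp only: c(2) mult_1 flip: sum_distrib_right)
  finally have *: "L2_norm M (\<lambda>x. \<Sum>n<N. twisted z f n x) \<le> N * L2_norm M ?G + 2 * R * L2_norm M f"
    by simp
  have "L2_norm M (average z f N) = L2_norm M (\<lambda>x. \<Sum>n<N. twisted z f n x) / N"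
    using L2_norm_cmult[of M "1 / of_nat N" "\<lambda>x. \<Sum>n<N. twisted z f n x"]
    by (simp add: average_def[abs_def] norm_divide)
  then show ?thesis using * N by (simp add: field_simps)
qed

text \<open>Riesz's argument: the norms of the averages tend to the infimum of the norms over the convex
  hull of the orbit, so by the parallelogram law the averages form a Cauchy sequence.\<close>

lemma average_Cauchy:
  assumes f: "f \<in> L2_functions M" and z: "cmod z = 1" and e: "e > 0"
  shows "\<exists>N0. \<forall>m\<ge>N0. \<forall>n\<ge>N0. L2_norm M (\<lambda>x. average z f m x - average z f n x) < e"
proof -
  define S where "S = {L2_norm M (\<lambda>x. \<Sum>i<R. complex_of_real (c i) * twisted z f i x) | c R.
    (\<forall>i. c i \<ge> 0) \<and> (\<Sum>i<(R::nat). c i) = (1::real)}"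
  define m where "m = Inf S"
  have S0: "s \<ge> 0" if "s \<in> S" for s using that by (auto simp: S_def)
  have bdd: "bdd_below S" using S0 by (rule bdd_belowI)
  have "L2_norm M (\<lambda>x. \<Sum>i<(1::nat). complex_of_real 1 * twisted z f i x) \<in> S"
    unfolding S_def by (intro CollectI exI[of _ "\<lambda>_. 1"] exI[of _ 1]) auto
  then have Sne: "S \<noteq> {}" by blast
  have m0: "m \<ge> 0" unfolding m_def using Sne S0 by (intro cInf_greatest)
  \<comment> \<open>Chosen so that \<open>4 * (m + 2 * d)\<^sup>2 - (2 * m)\<^sup>2\<close>, which
    is \<open>16 * m * d + 16 * d\<^sup>2\<close>, stays below \<open>e\<^sup>2\<close>;
    \<open>d \<le> 1\<close> makes the last term linear.\<close>
  define d where "d = min 1 (e\<^sup>2 / (16 * m + 17))"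
  have d: "d > 0" "d \<le> 1" using e m0 by (simp_all add: d_def divide_pos_pos)
  have "d * (16 * m + 17) \<le> e\<^sup>2"
    using m0 by (simp add: d_def min_def divide_simps)
  moreover have "d * (16 * m + 16) < d * (16 * m + 17)" using d by simp
  ultimately have d16: "d * (16 * m + 16) < e\<^sup>2" by linarith
  obtain s where "s \<in> S" "s < m + d"
    using cInf_lessD[OF Sne, of "m + d"] d by (auto simp: m_def)
  then obtain c R where c: "\<And>i. c i \<ge> 0" "(\<Sum>i<(R::nat). c i) = (1::real)"
      "L2_norm M (\<lambda>x. \<Sum>i<R. complex_of_real (c i) * twisted z f i x) < m + d"
    by (auto simp: S_def)
  have "(\<lambda>N. 2 * R * L2_norm M f / real N) \<longlonglongrightarrow> 0"
    by (rule lim_const_over_n)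
  then have "\<forall>\<^sub>F N in sequentially. 2 * R * L2_norm M f / real N < d"
    using d(1) by (rule order_tendstoD(2))
  then obtain N1 where N1: "\<And>N. N \<ge> N1 \<Longrightarrow> 2 * R * L2_norm M f / real N < d"
    by (auto simp: eventually_sequentially)
  have small: "L2_norm M (average z f N) < m + 2 * d" if "N \<ge> max N1 1" for N
    using average_norm_le_combination[OF f z _ c(1,2), of N] c(3) N1[of N] that by simp
  have "L2_norm M (\<lambda>x. average z f a x - average z f b x) < e" if a: "a \<ge> max N1 1" and b: "b \<ge> max N1 1" for a b
  proof -
    \<comment> \<open>The coefficients of half the sum of the two averages. They are convex, so its
      norm is at least \<open>m\<close>, the lower bound needed in the parallelogram law.\<close>
    define c' where "c' = (\<lambda>i. ((if i < a then 1 / real a else 0) + (if i < b then 1 / real b else 0)) / 2)"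
    let ?R = "max a b"
    have sub: "{..<?R} \<inter> {i. i < a} = {..<a}" "{..<?R} \<inter> {i. i < b} = {..<b}" by auto
    have "(\<Sum>i<?R. c' i) = ((\<Sum>i<?R. if i < a then 1 / real a else 0) + (\<Sum>i<?R. if i < b then 1 / real b else 0)) / 2"
      by (simp only: c'_def sum.distrib flip: sum_divide_distrib)
    also have "\<dots> = 1" using a b by (simp add: sum.If_cases sub)
    finally have c'1: "(\<Sum>i<?R. c' i) = 1" .
    have comb: "(\<Sum>i<?R. complex_of_real (c' i) * twisted z f i x) = (1/2) * (average z f a x + average z f b x)" for x
    proof -
      have "(\<Sum>i<?R. complex_of_real (c' i) * twisted z f i x) =
          (1/2) * ((\<Sum>i<?R. if i < a then twisted z f i x / of_nat a else 0) +
            (\<Sum>i<?R. if i < b then twisted z f i x / of_nat b else 0))"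
        unfolding sum.distrib[symmetric] sum_distrib_left
        by (rule sum.cong) (auto simp: c'_def add_divide_distrib algebra_simps)
      also have "\<dots> = (1/2) * (average z f a x + average z f b x)"
        by (simp add: sum.If_cases sub average_def sum_divide_distrib)
      finally show ?thesis .
    qed
    have "L2_norm M (\<lambda>x. (1/2) * (average z f a x + average z f b x)) \<in> S"
      unfolding S_def comb[symmetric] using c'1 by (intro CollectI exI[of _ c'] exI[of _ ?R]) (auto simp: c'_def)
    then have "m \<le> L2_norm M (\<lambda>x. (1/2) * (average z f a x + average z f b x))"
      unfolding m_def using bdd by (rule cInf_lower)
    then have "2 * m \<le> L2_norm M (\<lambda>x. average z f a x + average z f b x)"
      unfolding L2_norm_cmult by simp
    then have "(2 * m)\<^sup>2 \<le> (L2_norm M (\<lambda>x. average z f a x + average z f b x))\<^sup>2"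
      using m0 by (intro power_mono) auto
    moreover have "(L2_norm M (average z f a))\<^sup>2 \<le> (m + 2 * d)\<^sup>2" "(L2_norm M (average z f b))\<^sup>2 \<le> (m + 2 * d)\<^sup>2"
      using small[OF a] small[OF b] by (auto intro!: power_mono)
    ultimately have "(L2_norm M (\<lambda>x. average z f a x - average z f b x))\<^sup>2 \<le> 4 * (m + 2 * d)\<^sup>2 - (2 * m)\<^sup>2"
      unfolding L2_norm_parallelogram[OF average_L2[OF f] average_L2[OF f]] by linarith
    also have "\<dots> = d * (16 * m + 16 * d)" by (simp add: power2_eq_square algebra_simps)
    also have "\<dots> \<le> d * (16 * m + 16)" using d by (intro mult_left_mono) auto
    also note d16
    finally show ?thesis by (rule power2_less_imp_less) (use e in auto)
  qed
  then show ?thesis by blast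
qed

text \<open>Applying the twisted operator to an average changes only the two end terms, a difference
  that vanishes after division by \<open>n\<close>; so the limit is fixed.\<close>

lemma average_limit:
  assumes f: "f \<in> borel_measurable M" "\<And>x. cmod (f x) \<le> B" and z: "cmod z = 1"
  shows "\<exists>g \<in> L2_functions M. (\<lambda>n. L2_norm M (\<lambda>x. average z f n x - g x)) \<longlonglongrightarrow> 0 \<and>
    (AE x in M. z * g (T x) = g x)"
proof -
  have fL2: "f \<in> L2_functions M" using f by (rule L2_functions_bounded)
  have "B \<ge> 0" using f(2) norm_ge_zero order_trans by blast
  have "cmod (average z f n x) \<le> B" for n x
  proof (cases "n = 0")
    case False
    have "cmod (\<Sum>i<n. twisted z f i x) \<le> (\<Sum>i<n. B)"
      using f(2) z by (intro sum_norm_le) (simp add: twisted_def norm_mult norm_power)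
    then show ?thesis using False by (simp add: average_def norm_divide field_simps)
  qed (simp add: average_def \<open>B \<ge> 0\<close>)
  then have "\<exists>g \<in> L2_functions M. (\<lambda>n. L2_norm M (\<lambda>x. average z f n x - g x)) \<longlonglongrightarrow> 0"
    by (intro L2_bounded_complete average_Cauchy[OF fL2 z] L2_functions_measurable average_L2[OF fL2])
  then obtain g where g: "g \<in> L2_functions M" "(\<lambda>n. L2_norm M (\<lambda>x. average z f n x - g x)) \<longlonglongrightarrow> 0"
    by blast
  have A: "average z f n \<in> L2_functions M" for n by (rule average_L2[OF fL2])
  have comp: "(\<lambda>x. z * h (T x)) \<in> L2_functions M" if "h \<in> L2_functions M" for h
    using L2_functions_cmult[OF L2_functions_iter[OF that, of 1]] by simp
  have "L2_norm M (\<lambda>x. z * g (T x) - g x) \<le>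
      2 * L2_norm M (\<lambda>x. average z f n x - g x) + 2 * L2_norm M f / n" for n
  proof -
    let ?a = "average z f n"
    have "L2_norm M (\<lambda>x. z * g (T x) - g x) \<le> L2_norm M (\<lambda>x. z * g (T x) - z * ?a (T x)) +
        (L2_norm M (\<lambda>x. z * ?a (T x) - ?a x) + L2_norm M (\<lambda>x. ?a x - g x))"
      using L2_norm_triangle_diff[OF comp[OF g(1)] comp[OF A[of n]] g(1)]
        L2_norm_triangle_diff[OF comp[OF A[of n]] A[of n] g(1)] by linarith
    also have "L2_norm M (\<lambda>x. z * g (T x) - z * ?a (T x)) = L2_norm M (\<lambda>x. g x - ?a x)"
      using L2_norm_iter[of "\<lambda>x. g x - ?a x" 1] L2_norm_cmult[of M z "\<lambda>x. g (T x) - ?a (T x)"] z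
        L2_functions_measurable[OF L2_functions_diff[OF g(1) A[of n]]]
      by (simp add: right_diff_distrib)
    also have "L2_norm M (\<lambda>x. z * ?a (T x) - ?a x) = L2_norm M (\<lambda>x. (1 / of_nat n) * (twisted z f n x - twisted z f 0 x))"
    proof -
      have "z * ?a (T x) - ?a x = (1 / of_nat n) * (twisted z f n x - twisted z f 0 x)" for x
      proof -
        have "z * twisted z f i (T x) = twisted z f (Suc i) x" for i
          by (simp add: twisted_def funpow_swap1 mult.assoc)
        then have "z * (\<Sum>i<n. twisted z f i (T x)) = (\<Sum>i<n. twisted z f (Suc i) x)"
          by (simp add: sum_distrib_left)
        then have "z * (\<Sum>i<n. twisted z f i (T x)) - (\<Sum>i<n. twisted z f i x) = twisted z f n x - twisted z f 0 x"
          using sum_lessThan_telescope[of "\<lambda>i. twisted z f i x" n] by (simp add: sum_subtractf)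
        then show ?thesis by (simp add: average_def diff_divide_distrib[symmetric])
      qed
      then show ?thesis by simp
    qed
    also have "\<dots> \<le> 2 * L2_norm M f / n"
    proof -
      have "L2_norm M (\<lambda>x. twisted z f n x - twisted z f 0 x) \<le> 2 * L2_norm M f"
        using L2_norm_diff_le[OF twisted_L2[OF fL2, of z n] twisted_L2[OF fL2, of z 0]]
        by (simp add: twisted_norm[OF fL2 z])
      then show ?thesis unfolding L2_norm_cmult
        by (simp add: norm_divide divide_right_mono)
    qed
    finally show ?thesis by (simp add: L2_norm_minus[of M g])
  qed
  moreover have "(\<lambda>n. 2 * L2_norm M (\<lambda>x. average z f n x - g x) + 2 * L2_norm M f / real n) \<longlonglongrightarrow> 2 * 0 + 0"
    by (intro tendsto_add tendsto_mult_left g(2) lim_const_over_n)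
  ultimately have "L2_norm M (\<lambda>x. z * g (T x) - g x) \<le> 2 * 0 + 0"
    by (intro LIMSEQ_le_const) auto
  then have "L2_norm M (\<lambda>x. z * g (T x) - g x) = 0"
    using L2_norm_nonneg[of M "\<lambda>x. z * g (T x) - g x"] by linarith
  then have "AE x in M. z * g (T x) - g x = 0"
    using L2_norm_eq_0[OF L2_functions_diff[OF comp[OF g(1)] g(1)]] by simp
  then show ?thesis using g by auto
qed

end

section \<open>Approximation by eigenfunctions\<close>

definition eigen_span :: "'x measure \<Rightarrow> ('x \<Rightarrow> 'x) \<Rightarrow> ('x \<Rightarrow> complex) set" where
  "eigen_span M T = {\<lambda>x. \<Sum>g\<in>F. c g * g x | F c. finite F \<and> F \<subseteq> koopman_eigenfunctions M T}"

definition eigen_approximable :: "'x measure \<Rightarrow> ('x \<Rightarrow> 'x) \<Rightarrow> ('x \<Rightarrow> complex) \<Rightarrow> bool" where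
  "eigen_approximable M T f \<longleftrightarrow> f \<in> L2_functions M \<and>
    (\<forall>e>0. \<exists>h \<in> eigen_span M T. L2_norm M (\<lambda>x. f x - h x) < e)"

lemma pure_discrete_spectrumI:
  assumes "\<And>f. f \<in> L2_functions M \<Longrightarrow> eigen_approximable M T f"
  shows "pure_discrete_spectrum M T"
  unfolding pure_discrete_spectrum_def
proof (intro ballI allI impI)
  fix f and e :: real assume "f \<in> L2_functions M" "e > 0"
  then obtain h where "h \<in> eigen_span M T" "L2_norm M (\<lambda>x. f x - h x) < e"
    using assms by (auto simp: eigen_approximable_def)
  then show "\<exists>F c. finite F \<and> F \<subseteq> koopman_eigenfunctions M T \<and>
      L2_norm M (\<lambda>x. f x - (\<Sum>g\<in>F. c g * g x)) < e"
    unfolding eigen_span_def by blast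
qed

lemma eigen_span_L2: "h \<in> eigen_span M T \<Longrightarrow> h \<in> L2_functions M"
  by (auto simp: eigen_span_def koopman_eigenfunctions_def intro!: L2_functions_sum L2_functions_cmult)

lemma eigen_span_zero: "(\<lambda>x. 0) \<in> eigen_span M T"
  unfolding eigen_span_def by (intro CollectI exI[of _ "{}"]) simp

lemma eigen_span_eigenfunction: "g \<in> koopman_eigenfunctions M T \<Longrightarrow> g \<in> eigen_span M T"
  unfolding eigen_span_def by (intro CollectI exI[of _ "{g}"] exI[of _ "\<lambda>_. 1"]) simp

lemma eigen_span_cmult:
  assumes "h \<in> eigen_span M T"
  shows "(\<lambda>x. a * h x) \<in> eigen_span M T"
proof -
  obtain F c where F: "finite F" "F \<subseteq> koopman_eigenfunctions M T" "h = (\<lambda>x. \<Sum>g\<in>F. c g * g x)"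
    using assms by (auto simp: eigen_span_def)
  show ?thesis
    unfolding eigen_span_def using F(1,2)
    by (intro CollectI exI[of _ F] exI[of _ "\<lambda>g. a * c g"]) (simp add: F(3) sum_distrib_left mult.assoc)
qed

lemma eigen_span_add:
  assumes "h \<in> eigen_span M T" "h' \<in> eigen_span M T"
  shows "(\<lambda>x. h x + h' x) \<in> eigen_span M T"
proof -
  obtain F c where F: "finite F" "F \<subseteq> koopman_eigenfunctions M T" "h = (\<lambda>x. \<Sum>g\<in>F. c g * g x)"
    using assms(1) by (auto simp: eigen_span_def)
  obtain F' c' where F': "finite F'" "F' \<subseteq> koopman_eigenfunctions M T" "h' = (\<lambda>x. \<Sum>g\<in>F'. c' g * g x)"
    using assms(2) by (auto simp: eigen_span_def)
  define d where "d = (\<lambda>g. (if g \<in> F then c g else 0) + (if g \<in> F' then c' g else 0))"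
  have "(\<Sum>g\<in>F. c g * g x) = (\<Sum>g\<in>F \<union> F'. (if g \<in> F then c g else 0) * g x)" for x
    using F(1) F'(1) by (intro sum.mono_neutral_cong_left) auto
  moreover have "(\<Sum>g\<in>F'. c' g * g x) = (\<Sum>g\<in>F \<union> F'. (if g \<in> F' then c' g else 0) * g x)" for x
    using F(1) F'(1) by (intro sum.mono_neutral_cong_left) auto
  ultimately have "h x + h' x = (\<Sum>g\<in>F \<union> F'. d g * g x)" for x
    by (simp add: F(3) F'(3) d_def distrib_right sum.distrib)
  then show ?thesis
    unfolding eigen_span_def using F(1,2) F'(1,2)
    by (intro CollectI exI[of _ "F \<union> F'"] exI[of _ d]) auto
qed

lemma eigen_approximable_L2: "eigen_approximable M T f \<Longrightarrow> f \<in> L2_functions M"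
  by (simp add: eigen_approximable_def)

lemma eigen_approximableD:
  "eigen_approximable M T f \<Longrightarrow> e > 0 \<Longrightarrow> \<exists>h \<in> eigen_span M T. L2_norm M (\<lambda>x. f x - h x) < e"
  by (simp add: eigen_approximable_def)

lemma eigen_approximable_add:
  assumes f: "eigen_approximable M T f" and f': "eigen_approximable M T f'"
  shows "eigen_approximable M T (\<lambda>x. f x + f' x)"
  unfolding eigen_approximable_def
proof (intro conjI allI impI)
  note L2 = f[THEN eigen_approximable_L2] f'[THEN eigen_approximable_L2]
  show "(\<lambda>x. f x + f' x) \<in> L2_functions M" by (intro L2_functions_add L2)
  fix e :: real assume "e > 0"
  then have e: "e / 2 > 0" by simp
  obtain h where h: "h \<in> eigen_span M T" "L2_norm M (\<lambda>x. f x - h x) < e / 2"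
    using eigen_approximableD[OF f e] by blast
  obtain h' where h': "h' \<in> eigen_span M T" "L2_norm M (\<lambda>x. f' x - h' x) < e / 2"
    using eigen_approximableD[OF f' e] by blast
  have "L2_norm M (\<lambda>x. (f x - h x) + (f' x - h' x)) < e"
    using L2_norm_triangle[OF L2_functions_diff[OF L2(1) eigen_span_L2[OF h(1)]]
        L2_functions_diff[OF L2(2) eigen_span_L2[OF h'(1)]]] h(2) h'(2) by linarith
  then have "L2_norm M (\<lambda>x. (f x + f' x) - (h x + h' x)) < e" by (simp add: algebra_simps)
  then show "\<exists>k\<in>eigen_span M T. L2_norm M (\<lambda>x. (f x + f' x) - k x) < e"
    using eigen_span_add[OF h(1) h'(1)] by (intro bexI[of _ "\<lambda>x. h x + h' x"])
qed

lemma eigen_approximable_zero: "eigen_approximable M T (\<lambda>x. 0)"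
  unfolding eigen_approximable_def
  using L2_functions_zero eigen_span_zero by (auto intro!: bexI[of _ "\<lambda>x. 0"])

lemma eigen_approximable_cmult:
  assumes f: "eigen_approximable M T f"
  shows "eigen_approximable M T (\<lambda>x. a * f x)"
proof (cases "a = 0")
  case False
  show ?thesis
    unfolding eigen_approximable_def
  proof (intro conjI allI impI)
    show "(\<lambda>x. a * f x) \<in> L2_functions M" by (intro L2_functions_cmult eigen_approximable_L2[OF f])
    fix e :: real assume "e > 0"
    then have e: "e / cmod a > 0" using False by simp
    obtain h where h: "h \<in> eigen_span M T" "L2_norm M (\<lambda>x. f x - h x) < e / cmod a"
      using eigen_approximableD[OF f e] by blast
    have "L2_norm M (\<lambda>x. a * (f x - h x)) < e"
      unfolding L2_norm_cmult using h(2) False by (simp add: field_simps)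
    then have "L2_norm M (\<lambda>x. a * f x - a * h x) < e" by (simp add: right_diff_distrib)
    then show "\<exists>k\<in>eigen_span M T. L2_norm M (\<lambda>x. a * f x - k x) < e"
      using eigen_span_cmult[OF h(1)] by (intro bexI[of _ "\<lambda>x. a * h x"])
  qed
qed (simp add: eigen_approximable_zero)

lemma eigen_approximable_sum:
  "(\<And>i. i \<in> I \<Longrightarrow> eigen_approximable M T (f i)) \<Longrightarrow> eigen_approximable M T (\<lambda>x. \<Sum>i\<in>I. f i x)"
  by (induction I rule: infinite_finite_induct) (simp_all add: eigen_approximable_zero eigen_approximable_add)

lemma eigen_approximable_limit:
  assumes f: "f \<in> L2_functions M"
    and "\<And>e. e > 0 \<Longrightarrow> \<exists>f'. eigen_approximable M T f' \<and> L2_norm M (\<lambda>x. f x - f' x) < e"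
  shows "eigen_approximable M T f"
  unfolding eigen_approximable_def
proof (intro conjI allI impI f)
  fix e :: real assume "e > 0"
  then have e: "e / 2 > 0" by simp
  obtain f' where f': "eigen_approximable M T f'" "L2_norm M (\<lambda>x. f x - f' x) < e / 2"
    using assms(2)[OF e] by blast
  obtain h where h: "h \<in> eigen_span M T" "L2_norm M (\<lambda>x. f' x - h x) < e / 2"
    using eigen_approximableD[OF f'(1) e] by blast
  have "L2_norm M (\<lambda>x. f x - h x) < e"
    using L2_norm_triangle_diff[OF f eigen_approximable_L2[OF f'(1)] eigen_span_L2[OF h(1)]] f'(2) h(2)
    by linarith
  then show "\<exists>k\<in>eigen_span M T. L2_norm M (\<lambda>x. f x - k x) < e" using h(1) by blast
qed

lemma eigen_approximable_eigen:
  assumes g: "g \<in> L2_functions M" and "z \<noteq> 0" and eq: "AE x in M. z * g (T x) = g x"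
  shows "eigen_approximable M T g"
proof (cases "AE x in M. g x = 0")
  \<comment> \<open>\<open>koopman_eigenfunctions\<close> excludes functions vanishing almost
    everywhere, so these are approximated by the empty sum.\<close>
  case True
  then have "L2_norm M g = 0" using L2_norm_eq_0[OF g] by simp
  then show ?thesis
    using g eigen_span_zero by (auto simp: eigen_approximable_def intro!: bexI[of _ "\<lambda>x. 0"])
next
  case False
  have "AE x in M. koopman T g x = (1 / z) * g x"
    using eq by eventually_elim (use \<open>z \<noteq> 0\<close> in \<open>auto simp: koopman_def field_simps\<close>)
  then have "g \<in> koopman_eigenfunctions M T"
    using g False unfolding koopman_eigenfunctions_def by blast
  from eigen_span_eigenfunction[OF this] show ?thesis
    using g by (auto simp: eigen_approximable_def intro!: bexI[of _ g])
qed

section \<open>Trigonometric averages and the Fejer kernel\<close>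

lemma mean_power_tendsto:
  fixes z :: complex
  assumes "cmod z = 1"
  shows "(\<lambda>N. (\<Sum>n<N. z ^ n) / of_nat N) \<longlonglongrightarrow> (if z = 1 then 1 else 0)"
proof (cases "z = 1")
  case True
  have "\<forall>\<^sub>F N in sequentially. (\<Sum>n<N. z ^ n) / of_nat N = 1"
    using eventually_gt_at_top[of 0] by eventually_elim (simp add: True)
  then show ?thesis using True by (simp add: tendsto_eventually)
next
  case False
  have "norm ((\<Sum>n<N. z ^ n) / of_nat N) \<le> (2 / cmod (z - 1)) / real N" for N
  proof -
    have "cmod (z ^ N - 1) \<le> 2"
      using norm_triangle_ineq4[of "z ^ N" 1] assms by (simp add: norm_power)
    then show ?thesis
      using False by (simp add: geometric_sum norm_divide norm_mult divide_right_mono)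
  qed
  then have "(\<lambda>N. (\<Sum>n<N. z ^ n) / of_nat N) \<longlonglongrightarrow> 0"
    by (intro Lim_null_comparison[OF always_eventually lim_const_over_n[of "2 / cmod (z - 1)"]]) blast
  then show ?thesis using False by simp
qed

text \<open>The Fejer kernel along the rotation by \<open>t\<close>, concentrated where
  \<open>n * t\<close> is near an integer. Order 1 gives the constant 1, so one-variable kernels are
  covered by statements on products.\<close>

definition fejer :: "nat \<Rightarrow> real \<Rightarrow> nat \<Rightarrow> real" where
  "fejer R t n = (cmod (\<Sum>a<R. cis (2 * pi * n * t) ^ a))\<^sup>2 / R"

lemma fejer_nonneg: "fejer R t n \<ge> 0"
  by (simp add: fejer_def)

lemma fejer_1 [simp]: "fejer (Suc 0) t n = 1"
  by (simp add: fejer_def)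

lemma fejer_le:
  assumes "\<delta> > 0" "cmod (1 - cis (2 * pi * n * t)) \<ge> \<delta>"
  shows "fejer R t n \<le> 4 / (R * \<delta>\<^sup>2)"
proof -
  let ?z = "cis (2 * pi * n * t)"
  have z: "?z \<noteq> 1" using assms by auto
  have "cmod (?z ^ R - 1) \<le> 2"
    using norm_triangle_ineq4[of "?z ^ R" 1] by (simp add: norm_power)
  then have "cmod (\<Sum>a<R. ?z ^ a) \<le> 2 / \<delta>"
    using z assms by (auto simp: geometric_sum norm_divide norm_minus_commute[of 1] intro!: frac_le)
  then have "(cmod (\<Sum>a<R. ?z ^ a))\<^sup>2 \<le> (2 / \<delta>)\<^sup>2" by (rule power_mono) simp
  then have "fejer R t n \<le> (2 / \<delta>)\<^sup>2 / R" unfolding fejer_def by (rule divide_right_mono) simp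
  then show ?thesis by (simp add: power_divide mult.commute)
qed

lemma fejer_expand:
  "complex_of_real (fejer R t n) =
    (\<Sum>(a, b)\<in>{..<R} \<times> {..<R}. (1 / of_nat R) * cis (2 * pi * ((real a - real b) * t)) ^ n)"
proof -
  let ?z = "cis (2 * pi * n * t)"
  have "complex_of_real ((cmod (\<Sum>a<R. ?z ^ a))\<^sup>2) = (\<Sum>a<R. ?z ^ a) * cnj (\<Sum>a<R. ?z ^ a)"
    by (rule complex_norm_square)
  also have "\<dots> = (\<Sum>a<R. \<Sum>b<R. ?z ^ a * cnj ?z ^ b)"
    by (simp add: sum_product)
  also have "\<dots> = (\<Sum>(a, b)\<in>{..<R} \<times> {..<R}. cis (2 * pi * ((real a - real b) * t)) ^ n)"
  proof -
    have "?z ^ a * cnj ?z ^ b = cis (2 * pi * ((real a - real b) * t)) ^ n" for a b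
      unfolding cis_cnj Complex.DeMoivre cis_mult by (rule arg_cong[where f = cis]) (simp add: algebra_simps)
    then show ?thesis by (simp add: sum.cartesian_product)
  qed
  finally show ?thesis
    by (simp add: fejer_def sum_divide_distrib split_beta)
qed

lemma fejer_product_expand:
  fixes t t' :: real
  defines "w \<equiv> \<lambda>((a, b), (a', b')). cis (2 * pi * ((real a - real b) * t + (real a' - real b') * t'))"
  shows "complex_of_real (fejer R t n * fejer R' t' n) =
    (\<Sum>i\<in>({..<R} \<times> {..<R}) \<times> ({..<R'} \<times> {..<R'}). (1 / (of_nat R * of_nat R')) * w i ^ n)"
proof -
  have "complex_of_real (fejer R t n * fejer R' t' n) =
      (\<Sum>p\<in>{..<R} \<times> {..<R}. \<Sum>p'\<in>{..<R'} \<times> {..<R'}.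
        (case p of (a, b) \<Rightarrow> (1 / of_nat R) * cis (2 * pi * ((real a - real b) * t)) ^ n) *
        (case p' of (a, b) \<Rightarrow> (1 / of_nat R') * cis (2 * pi * ((real a - real b) * t')) ^ n))"
    unfolding of_real_mult fejer_expand by (rule sum_product)
  also have "\<dots> = (\<Sum>p\<in>{..<R} \<times> {..<R}. \<Sum>p'\<in>{..<R'} \<times> {..<R'}. (1 / (of_nat R * of_nat R')) * w (p, p') ^ n)"
  proof (intro sum.cong refl)
    fix p p' :: "nat \<times> nat"
    have "cis (2 * pi * (x + y)) ^ n = cis (2 * pi * x) ^ n * cis (2 * pi * y) ^ n" for x y
      by (simp add: cis_mult distrib_left flip: power_mult_distrib)
    then show "(case p of (a, b) \<Rightarrow> (1 / of_nat R) * cis (2 * pi * ((real a - real b) * t)) ^ n) *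
        (case p' of (a, b) \<Rightarrow> (1 / of_nat R') * cis (2 * pi * ((real a - real b) * t')) ^ n) =
        (1 / (of_nat R * of_nat R')) * w (p, p') ^ n"
      by (simp add: w_def split_beta)
  qed
  finally show ?thesis by (simp add: sum.cartesian_product)
qed

lemma cis_eq_1D:
  assumes "cis (2 * pi * x) = 1"
  shows "x \<in> \<int>"
proof -
  have "cos (2 * pi * x) = 1" using assms by (metis Re_complex_of_real cis.sel(1) of_real_1)
  then obtain m :: int where "2 * pi * x = m * 2 * pi" by (auto simp: cos_one_2pi_int)
  then have "x = m" by simp
  then show ?thesis by simp
qed

text \<open>The time average of the powers of w tends to 0 unless w = 1. By independence this
  happens exactly on the diagonal \<open>a = b\<close>, \<open>a' = b'\<close>, that is for
  \<open>R * R'\<close> terms of weight \<open>1 / (R * R')\<close>.\<close>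

lemma mean_fejer_product:
  fixes t t' :: real
  assumes indep: "\<And>m m'. real_of_int m * t + real_of_int m' * t' \<in> \<int> \<Longrightarrow> m = 0 \<and> m' = 0" and R: "R > 0" "R' > 0"
  shows "(\<lambda>N. (\<Sum>n<N. fejer R t n * fejer R' t' n) / real N) \<longlonglongrightarrow> 1"
proof -
  let ?I = "({..<R} \<times> {..<R}) \<times> ({..<R'} \<times> {..<R'})"
  let ?c = "1 / (of_nat R * of_nat R') :: complex"
  define w where "w = (\<lambda>((a, b), (a', b')). cis (2 * pi * ((real a - real b) * t + (real a' - real b') * t')))"
  have w1: "cmod (w i) = 1" for i by (simp add: w_def split_beta)
  have "(\<lambda>N. \<Sum>i\<in>?I. ?c * ((\<Sum>n<N. w i ^ n) / of_nat N)) \<longlonglongrightarrow> (\<Sum>i\<in>?I. ?c * (if w i = 1 then 1 else 0))"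
    by (intro tendsto_sum tendsto_mult_left mean_power_tendsto w1)
  moreover have "(\<Sum>i\<in>?I. ?c * ((\<Sum>n<N. w i ^ n) / of_nat N)) =
      complex_of_real ((\<Sum>n<N. fejer R t n * fejer R' t' n) / real N)" for N
  proof -
    have "complex_of_real (\<Sum>n<N. fejer R t n * fejer R' t' n) = (\<Sum>n<N. \<Sum>i\<in>?I. ?c * w i ^ n)"
      unfolding of_real_sum fejer_product_expand w_def ..
    also have "\<dots> = (\<Sum>i\<in>?I. ?c * (\<Sum>n<N. w i ^ n))"
      by (subst sum.swap) (simp add: sum_distrib_left)
    finally have eq: "complex_of_real (\<Sum>n<N. fejer R t n * fejer R' t' n) = \<dots>" .
    show ?thesis
      by (simp only: of_real_divide of_real_of_nat_eq eq sum_divide_distrib[of _ ?I] times_divide_eq_right)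
  qed
  moreover have "(\<Sum>i\<in>?I. ?c * (if w i = 1 then 1 else 0)) = 1"
  proof -
    let ?D = "(\<lambda>(a, a'). ((a, a), (a', a'))) ` ({..<R} \<times> {..<R'})"
    have iff: "w i = 1 \<longleftrightarrow> i \<in> ?D" if "i \<in> ?I" for i
    proof -
      obtain a b a' b' where i: "i = ((a, b), (a', b'))" by (metis surj_pair)
      show ?thesis
      proof
        assume "w i = 1"
        then have "(real a - real b) * t + (real a' - real b') * t' \<in> \<int>"
          unfolding i w_def by (intro cis_eq_1D) simp
        then have "real_of_int (int a - int b) * t + real_of_int (int a' - int b') * t' \<in> \<int>" by simp
        from indep[OF this] show "i \<in> ?D" using that by (auto simp: i)
      qed (auto simp: w_def)
    qed
    have "(\<Sum>i\<in>?I. ?c * (if w i = 1 then 1 else 0)) = (\<Sum>i\<in>?D. ?c)"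
      using iff by (intro sum.mono_neutral_cong_right) auto
    also have "\<dots> = of_nat (card ?D) * ?c" by simp
    also have "card ?D = R * R'" by (subst card_image) (auto simp: inj_on_def card_cartesian_product)
    finally show ?thesis using R by simp
  qed
  ultimately have "(\<lambda>N. complex_of_real ((\<Sum>n<N. fejer R t n * fejer R' t' n) / real N)) \<longlonglongrightarrow> complex_of_real 1"
    by simp
  then show ?thesis by (simp only: tendsto_of_real_iff)
qed

section \<open>Bohr almost periodic functions\<close>

context measure_preserving_map
begin

text \<open>A weight that is a trigonometric polynomial in \<open>n\<close> splits the average into
  finitely many twisted averages, each converging to an eigenfunction or to 0.\<close>

lemma weighted_average_approximable:
  assumes f: "f \<in> borel_measurable M" "\<And>x. cmod (f x) \<le> B"
    and w: "\<And>i. i \<in> I \<Longrightarrow> cmod (w i) = 1" and K: "\<And>n. K n = (\<Sum>i\<in>I. c i * w i ^ n)"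
  shows "\<exists>g. eigen_approximable M T g \<and>
    (\<lambda>N. L2_norm M (\<lambda>x. (\<Sum>n<N. K n * f ((T ^^ n) x)) / of_nat N - g x)) \<longlonglongrightarrow> 0"
proof -
  have fL2: "f \<in> L2_functions M" using f by (rule L2_functions_bounded)
  have "\<forall>i\<in>I. \<exists>g. g \<in> L2_functions M \<and>
    (\<lambda>n. L2_norm M (\<lambda>x. average (w i) f n x - g x)) \<longlonglongrightarrow> 0 \<and> (AE x in M. w i * g (T x) = g x)"
    using average_limit[OF f w] by blast
  from bchoice[OF this]
  obtain g where g: "\<And>i. i \<in> I \<Longrightarrow> g i \<in> L2_functions M"
      "\<And>i. i \<in> I \<Longrightarrow> (\<lambda>n. L2_norm M (\<lambda>x. average (w i) f n x - g i x)) \<longlonglongrightarrow> 0"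
      "\<And>i. i \<in> I \<Longrightarrow> AE x in M. w i * g i (T x) = g i x"
    by blast
  have wne: "w i \<noteq> 0" if "i \<in> I" for i using w[OF that] by auto
  have "eigen_approximable M T (\<lambda>x. \<Sum>i\<in>I. c i * g i x)"
    by (intro eigen_approximable_sum eigen_approximable_cmult eigen_approximable_eigen[OF g(1) wne g(3)])
  moreover have "(\<lambda>N. L2_norm M (\<lambda>x. (\<Sum>n<N. K n * f ((T ^^ n) x)) / of_nat N - (\<Sum>i\<in>I. c i * g i x))) \<longlonglongrightarrow> 0"
  proof (rule tendsto_sandwich[OF _ _ tendsto_const])
    have "(\<Sum>n<N. K n * f ((T ^^ n) x)) / of_nat N - (\<Sum>i\<in>I. c i * g i x) =
        (\<Sum>i\<in>I. c i * (average (w i) f N x - g i x))" for N x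
    proof -
      have "(\<Sum>n<N. K n * f ((T ^^ n) x)) = (\<Sum>n<N. \<Sum>i\<in>I. c i * (w i ^ n * f ((T ^^ n) x)))"
        by (simp add: K sum_distrib_right mult.assoc)
      also have "\<dots> = (\<Sum>i\<in>I. c i * (\<Sum>n<N. w i ^ n * f ((T ^^ n) x)))"
        by (subst sum.swap) (simp add: sum_distrib_left)
      finally have "(\<Sum>n<N. K n * f ((T ^^ n) x)) / of_nat N = (\<Sum>i\<in>I. c i * average (w i) f N x)"
        by (simp only: average_def twisted_def sum_divide_distrib[of _ I] times_divide_eq_right)
      then show ?thesis by (simp only: sum_subtractf right_diff_distrib)
    qed
    moreover have "L2_norm M (\<lambda>x. \<Sum>i\<in>I. c i * (average (w i) f N x - g i x)) \<le>
        (\<Sum>i\<in>I. L2_norm M (\<lambda>x. c i * (average (w i) f N x - g i x)))" for N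
      by (intro L2_norm_sum L2_functions_cmult L2_functions_diff average_L2 fL2 g)
    ultimately show "\<forall>\<^sub>F N in sequentially. L2_norm M (\<lambda>x. (\<Sum>n<N. K n * f ((T ^^ n) x)) / of_nat N - (\<Sum>i\<in>I. c i * g i x))
        \<le> (\<Sum>i\<in>I. cmod (c i) * L2_norm M (\<lambda>x. average (w i) f N x - g i x))"
      by (simp add: L2_norm_cmult)
    have "(\<lambda>N. \<Sum>i\<in>I. cmod (c i) * L2_norm M (\<lambda>x. average (w i) f N x - g i x)) \<longlonglongrightarrow> (\<Sum>i\<in>I. cmod (c i) * 0)"
      by (intro tendsto_sum tendsto_mult_left g(2))
    then show "(\<lambda>N. \<Sum>i\<in>I. cmod (c i) * L2_norm M (\<lambda>x. average (w i) f N x - g i x)) \<longlonglongrightarrow> 0" by simp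
  qed simp
  ultimately show ?thesis by blast
qed

text \<open>The Fejer means of the orbit of \<open>f\<close> are combinations of eigenfunctions and, the kernel being
  concentrated on the times at which the orbit returns close to \<open>f\<close>, they are close to \<open>f\<close>.\<close>

lemma almost_periodic_approximable:
  fixes t t' :: real
  assumes f: "f \<in> borel_measurable M" "\<And>x. cmod (f x) \<le> B"
    and indep: "\<And>m m'. real_of_int m * t + real_of_int m' * t' \<in> \<int> \<Longrightarrow> m = 0 \<and> m' = 0"
    and ap: "\<And>e. e > 0 \<Longrightarrow> \<exists>\<delta>>0. \<forall>n. cmod (1 - cis (2 * pi * real n * t)) < \<delta> \<longrightarrow>
      cmod (1 - cis (2 * pi * real n * t')) < \<delta> \<longrightarrow> L2_norm M (\<lambda>x. f ((T ^^ n) x) - f x) < e"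
  shows "eigen_approximable M T f"
proof (rule eigen_approximable_limit)
  show fL2: "f \<in> L2_functions M" using f by (rule L2_functions_bounded)
  fix e :: real assume e: "e > 0"
  obtain \<delta> where \<delta>: "\<delta> > 0" "\<And>n. cmod (1 - cis (2 * pi * real n * t)) < \<delta> \<Longrightarrow>
      cmod (1 - cis (2 * pi * real n * t')) < \<delta> \<Longrightarrow> L2_norm M (\<lambda>x. f ((T ^^ n) x) - f x) < e / 4"
    using ap[of "e / 4"] e by auto
  \<comment> \<open>For times that are not near returns: \<open>2 * L2_norm M f\<close> bounds the
    displacement trivially, and \<open>4 / \<delta>\<^sup>2\<close> is the constant of
    \<open>fejer_le\<close>.\<close>
  define C where "C = 2 * L2_norm M f * (4 / \<delta>\<^sup>2)"
  have C: "C \<ge> 0" by (simp add: C_def)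
  obtain R :: nat where "R > 16 * C / e" using reals_Archimedean2 by blast
  then have "16 * C / e < real (Suc R)" by simp
  then have R: "2 * (C / real (Suc R)) < e / 4" using e C by (simp add: field_simps)
  let ?R = "Suc R"
  define \<kappa> where "\<kappa> = (\<lambda>n. fejer ?R t n * fejer ?R t' n)"
  have \<kappa>0: "\<kappa> n \<ge> 0" for n by (simp add: \<kappa>_def fejer_nonneg)
  let ?I = "({..<?R} \<times> {..<?R}) \<times> ({..<?R} \<times> {..<?R})"
  have "\<exists>g. eigen_approximable M T g \<and>
    (\<lambda>N. L2_norm M (\<lambda>x. (\<Sum>n<N. complex_of_real (\<kappa> n) * f ((T ^^ n) x)) / of_nat N - g x)) \<longlonglongrightarrow> 0"
    by (rule weighted_average_approximable[OF f, where I = ?I and c = "\<lambda>_. 1 / (of_nat ?R * of_nat ?R)" and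
          w = "\<lambda>((a, b), (a', b')). cis (2 * pi * ((real a - real b) * t + (real a' - real b') * t'))"])
      (simp only: split_beta norm_cis, simp only: \<kappa>_def fejer_product_expand)
  then obtain g where g: "eigen_approximable M T g"
      "(\<lambda>N. L2_norm M (\<lambda>x. (\<Sum>n<N. complex_of_real (\<kappa> n) * f ((T ^^ n) x)) / of_nat N - g x)) \<longlonglongrightarrow> 0"
    by blast
  have gL2: "g \<in> L2_functions M" using g(1) by (rule eigen_approximable_L2)
  define G where "G = (\<lambda>N x. (\<Sum>n<N. complex_of_real (\<kappa> n) * f ((T ^^ n) x)) / of_nat N)"
  have GL2: "G N \<in> L2_functions M" for N
    using L2_functions_cmult[of "\<lambda>x. \<Sum>n<N. complex_of_real (\<kappa> n) * f ((T ^^ n) x)" M "1 / of_nat N"]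
      L2_functions_sum[of "{..<N}" "\<lambda>n x. complex_of_real (\<kappa> n) * f ((T ^^ n) x)" M]
      L2_functions_cmult[OF L2_functions_iter[OF fL2]] by (simp add: G_def)
  define mean where "mean = (\<lambda>a N. (\<Sum>n<N. a n) / real N)"
  \<comment> \<open>If \<open>n\<close> is far from a return in one coordinate, the kernel of that
    coordinate is of order \<open>1 / ?R\<close>. It is replaced by its bound times
    \<open>fejer 1\<close>, so that only kernel products with mean tending to 1 remain.\<close>
  have pt: "\<kappa> n * L2_norm M (\<lambda>x. f ((T ^^ n) x) - f x) \<le>
      \<kappa> n * (e / 4) + C / ?R * (fejer ?R t n * fejer 1 t' n) + C / ?R * (fejer 1 t n * fejer ?R t' n)" for n
  proof -
    have 2: "L2_norm M (\<lambda>x. f ((T ^^ n) x) - f x) \<le> 2 * L2_norm M f"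
      using L2_norm_diff_le[OF L2_functions_iter[OF fL2, of n] fL2] L2_norm_iter[of f n] f(1) by simp
    have nn: "C / ?R * (fejer ?R t n * fejer 1 t' n) \<ge> 0" "C / ?R * (fejer 1 t n * fejer ?R t' n) \<ge> 0"
        "\<kappa> n * (e / 4) \<ge> 0"
      using e by (intro mult_nonneg_nonneg divide_nonneg_nonneg fejer_nonneg C \<kappa>0; simp)+
    consider "cmod (1 - cis (2 * pi * real n * t)) < \<delta>" "cmod (1 - cis (2 * pi * real n * t')) < \<delta>"
      | "cmod (1 - cis (2 * pi * real n * t)) \<ge> \<delta>" | "cmod (1 - cis (2 * pi * real n * t')) \<ge> \<delta>"
      by linarith
    then show ?thesis
    proof cases
      case 1
      then have "\<kappa> n * L2_norm M (\<lambda>x. f ((T ^^ n) x) - f x) \<le> \<kappa> n * (e / 4)"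
        using \<delta>(2) \<kappa>0 by (intro mult_left_mono) (auto intro: less_imp_le)
      then show ?thesis using nn by linarith
    next
      case 2
      have "\<kappa> n * L2_norm M (\<lambda>x. f ((T ^^ n) x) - f x) \<le> (4 / (?R * \<delta>\<^sup>2) * fejer ?R t' n) * (2 * L2_norm M f)"
        unfolding \<kappa>_def using fejer_le[OF \<delta>(1) 2, of ?R] fejer_nonneg \<open>L2_norm M _ \<le> 2 * _\<close>
        by (intro mult_mono mult_nonneg_nonneg) auto
      also have "\<dots> = C / ?R * (fejer 1 t n * fejer ?R t' n)" by (simp add: C_def field_simps)
      finally show ?thesis using nn by linarith
    next
      case 3
      have "\<kappa> n * L2_norm M (\<lambda>x. f ((T ^^ n) x) - f x) \<le> (fejer ?R t n * (4 / (?R * \<delta>\<^sup>2))) * (2 * L2_norm M f)"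
        unfolding \<kappa>_def using fejer_le[OF \<delta>(1) 3, of ?R] fejer_nonneg \<open>L2_norm M _ \<le> 2 * _\<close>
        by (intro mult_mono mult_nonneg_nonneg) auto
      also have "\<dots> = C / ?R * (fejer ?R t n * fejer 1 t' n)" by (simp add: C_def field_simps)
      finally show ?thesis using nn by linarith
    qed
  qed
  have bound: "L2_norm M (\<lambda>x. f x - G N x) \<le> \<bar>1 - mean \<kappa> N\<bar> * L2_norm M f +
      (mean \<kappa> N * (e / 4) + C / ?R * mean (\<lambda>n. fejer ?R t n * fejer 1 t' n) N +
       C / ?R * mean (\<lambda>n. fejer 1 t n * fejer ?R t' n) N)" for N
  proof -
    have eq: "f x - G N x = complex_of_real (1 - mean \<kappa> N) * f x +
        (1 / of_nat N) * (\<Sum>n<N. complex_of_real (\<kappa> n) * (f x - f ((T ^^ n) x)))" for x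
      by (simp add: G_def mean_def right_diff_distrib left_diff_distrib sum_subtractf diff_divide_distrib
          flip: sum_distrib_right)
    have d: "(\<lambda>x. complex_of_real (\<kappa> n) * (f x - f ((T ^^ n) x))) \<in> L2_functions M" for n
      by (intro L2_functions_cmult L2_functions_diff fL2 L2_functions_iter)
    have "L2_norm M (\<lambda>x. f x - G N x) \<le> L2_norm M (\<lambda>x. complex_of_real (1 - mean \<kappa> N) * f x) +
        L2_norm M (\<lambda>x. (1 / of_nat N) * (\<Sum>n<N. complex_of_real (\<kappa> n) * (f x - f ((T ^^ n) x))))"
      unfolding eq by (intro L2_norm_triangle L2_functions_cmult fL2 L2_functions_sum d)
    also have "\<dots> = \<bar>1 - mean \<kappa> N\<bar> * L2_norm M f +
        L2_norm M (\<lambda>x. \<Sum>n<N. complex_of_real (\<kappa> n) * (f x - f ((T ^^ n) x))) / N"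
      unfolding L2_norm_cmult norm_of_real by (simp add: norm_divide)
    also have "L2_norm M (\<lambda>x. \<Sum>n<N. complex_of_real (\<kappa> n) * (f x - f ((T ^^ n) x))) \<le>
        (\<Sum>n<N. L2_norm M (\<lambda>x. complex_of_real (\<kappa> n) * (f x - f ((T ^^ n) x))))"
      by (intro L2_norm_sum d)
    also have "\<dots> = (\<Sum>n<N. \<kappa> n * L2_norm M (\<lambda>x. f ((T ^^ n) x) - f x))"
      using \<kappa>0 by (simp add: L2_norm_cmult L2_norm_minus[of M f])
    also have "\<dots> \<le> (\<Sum>n<N. \<kappa> n * (e / 4) + C / ?R * (fejer ?R t n * fejer 1 t' n) + C / ?R * (fejer 1 t n * fejer ?R t' n))"
      by (intro sum_mono pt)
    also have "\<dots> / real N = mean \<kappa> N * (e / 4) + C / ?R * mean (\<lambda>n. fejer ?R t n * fejer 1 t' n) N +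
       C / ?R * mean (\<lambda>n. fejer 1 t n * fejer ?R t' n) N"
      unfolding mean_def sum.distrib sum_distrib_left[symmetric] sum_distrib_right[symmetric]
      by (simp add: add_divide_distrib)
    finally show ?thesis by (simp add: divide_right_mono)
  qed
  have lim: "mean \<kappa> \<longlonglongrightarrow> 1" "mean (\<lambda>n. fejer ?R t n * fejer 1 t' n) \<longlonglongrightarrow> 1"
      "mean (\<lambda>n. fejer 1 t n * fejer ?R t' n) \<longlonglongrightarrow> 1"
    unfolding mean_def \<kappa>_def by (intro mean_fejer_product indep; simp)+
  have "(\<lambda>N. \<bar>1 - mean \<kappa> N\<bar> * L2_norm M f +
      (mean \<kappa> N * (e / 4) + C / ?R * mean (\<lambda>n. fejer ?R t n * fejer 1 t' n) N +
       C / ?R * mean (\<lambda>n. fejer 1 t n * fejer ?R t' n) N) + L2_norm M (\<lambda>x. G N x - g x)) \<longlonglongrightarrow>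
      \<bar>1 - 1\<bar> * L2_norm M f + (1 * (e / 4) + C / ?R * 1 + C / ?R * 1) + 0"
    unfolding G_def by (intro tendsto_intros lim g(2))
  moreover have "\<bar>1 - 1\<bar> * L2_norm M f + (1 * (e / 4) + C / ?R * 1 + C / ?R * 1) + 0 < e"
    using R e by simp
  ultimately have "\<forall>\<^sub>F N in sequentially. \<bar>1 - mean \<kappa> N\<bar> * L2_norm M f +
      (mean \<kappa> N * (e / 4) + C / ?R * mean (\<lambda>n. fejer ?R t n * fejer 1 t' n) N +
       C / ?R * mean (\<lambda>n. fejer 1 t n * fejer ?R t' n) N) + L2_norm M (\<lambda>x. G N x - g x) < e"
    by (rule order_tendstoD(2))
  then obtain N where "\<bar>1 - mean \<kappa> N\<bar> * L2_norm M f +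
      (mean \<kappa> N * (e / 4) + C / ?R * mean (\<lambda>n. fejer ?R t n * fejer 1 t' n) N +
       C / ?R * mean (\<lambda>n. fejer 1 t n * fejer ?R t' n) N) + L2_norm M (\<lambda>x. G N x - g x) < e"
    using eventually_happens'[OF sequentially_bot] by blast
  then have "L2_norm M (\<lambda>x. f x - g x) < e"
    using bound[of N] L2_norm_triangle_diff[OF fL2 GL2[of N] gL2] by linarith
  then show "\<exists>f'. eigen_approximable M T f' \<and> L2_norm M (\<lambda>x. f x - f' x) < e"
    using g(1) by blast
qed

end

section \<open>Cylinder functions are dense\<close>

text \<open>Cylinders and their indicators live on the whole type, while \<open>M\<close> sees only
  its space; this bridges the difference.\<close>

lemma eigen_approximable_cong:
  assumes f: "eigen_approximable M T f" and eq: "\<And>x. x \<in> space M \<Longrightarrow> f x = g x"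
  shows "eigen_approximable M T g"
proof -
  have "g \<in> borel_measurable M"
    using eigen_approximable_L2[OF f] eq measurable_cong[of M f g borel] by (simp add: L2_functions_def)
  moreover have "integrable M (\<lambda>x. (cmod (g x))\<^sup>2)"
    using eigen_approximable_L2[OF f] eq
    by (simp add: L2_functions_def cong: Bochner_Integration.integrable_cong)
  moreover have "L2_norm M (\<lambda>x. f x - h x) = L2_norm M (\<lambda>x. g x - h x)" for h
    unfolding L2_norm_def using eq by (intro arg_cong[where f = sqrt] Bochner_Integration.integral_cong) auto
  ultimately show ?thesis using f by (simp add: eigen_approximable_def L2_functions_def)
qed

lemma (in prob_space) L2_functions_indicator_iff:
  "(indicator A :: _ \<Rightarrow> complex) \<in> L2_functions M \<longleftrightarrow> A \<inter> space M \<in> sets M"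
proof
  assume "(indicator A :: _ \<Rightarrow> complex) \<in> L2_functions M"
  then have "(indicator A :: _ \<Rightarrow> complex) -` {1} \<inter> space M \<in> sets M"
    by (intro measurable_sets[of _ _ borel]) (auto simp: L2_functions_def)
  moreover have "(indicator A :: _ \<Rightarrow> complex) -` {1} \<inter> space M = A \<inter> space M"
    by (auto simp: indicator_def)
  ultimately show "A \<inter> space M \<in> sets M" by simp
next
  assume "A \<inter> space M \<in> sets M"
  then have "(indicator (A \<inter> space M) :: _ \<Rightarrow> complex) \<in> borel_measurable M" by simp
  then have "(indicator A :: _ \<Rightarrow> complex) \<in> borel_measurable M"
    by (subst measurable_cong[of M _ "indicator (A \<inter> space M)"]) (auto simp: indicator_def)
  then show "(indicator A :: _ \<Rightarrow> complex) \<in> L2_functions M"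
    by (rule L2_functions_bounded[of _ 1]) (simp add: indicator_def)
qed

lemma (in prob_space) L2_dominated_limit:
  fixes F :: "nat \<Rightarrow> 'a \<Rightarrow> complex"
  assumes f: "f \<in> L2_functions M" and w: "integrable M w"
    and F: "\<And>i. F i \<in> borel_measurable M" and lim: "\<And>x. x \<in> space M \<Longrightarrow> (\<lambda>i. F i x) \<longlonglongrightarrow> f x"
    and dom: "\<And>i x. x \<in> space M \<Longrightarrow> (cmod (f x - F i x))\<^sup>2 \<le> w x"
  shows "(\<lambda>i. L2_norm M (\<lambda>x. f x - F i x)) \<longlonglongrightarrow> 0"
proof -
  note [measurable] = L2_functions_measurable[OF f] F
  have "(\<lambda>i. \<integral>x. (cmod (f x - F i x))\<^sup>2 \<partial>M) \<longlonglongrightarrow> (\<integral>x. 0 \<partial>M)"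
  proof (rule integral_dominated_convergence[OF _ _ w])
    show "AE x in M. (\<lambda>i. (cmod (f x - F i x))\<^sup>2) \<longlonglongrightarrow> 0"
    proof (rule AE_I2)
      fix x assume "x \<in> space M"
      then have "(\<lambda>i. (cmod (f x - F i x))\<^sup>2) \<longlonglongrightarrow> (cmod (f x - f x))\<^sup>2"
        by (intro tendsto_intros lim)
      then show "(\<lambda>i. (cmod (f x - F i x))\<^sup>2) \<longlonglongrightarrow> 0" by simp
    qed
    show "AE x in M. norm ((cmod (f x - F i x))\<^sup>2) \<le> w x" for i
      by (rule AE_I2) (simp add: dom)
  qed measurable
  then have "(\<lambda>i. sqrt (\<integral>x. (cmod (f x - F i x))\<^sup>2 \<partial>M)) \<longlonglongrightarrow> sqrt 0"
    by (intro tendsto_real_sqrt) simp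
  then show ?thesis by (simp add: L2_norm_def)
qed

context measure_preserving_map
begin

lemma eigen_approximable_of_limit:
  assumes f: "f \<in> L2_functions M" and F: "\<And>i. eigen_approximable M T (F i)"
    and lim: "(\<lambda>i::nat. L2_norm M (\<lambda>x. f x - F i x)) \<longlonglongrightarrow> 0"
  shows "eigen_approximable M T f"
proof (rule eigen_approximable_limit[OF f])
  fix e :: real assume "e > 0"
  then have "\<forall>\<^sub>F i in sequentially. L2_norm M (\<lambda>x. f x - F i x) < e"
    by (rule order_tendstoD(2)[OF lim])
  then obtain i where "L2_norm M (\<lambda>x. f x - F i x) < e"
    using eventually_happens'[OF sequentially_bot] by blast
  then show "\<exists>f'. eigen_approximable M T f' \<and> L2_norm M (\<lambda>x. f x - f' x) < e" using F by blast
qed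

lemma eigen_approximable_disjoint_Union:
  assumes A: "\<And>i. eigen_approximable M T (indicator (A i))" and dis: "disjoint_family (A :: nat \<Rightarrow> _)"
  shows "eigen_approximable M T (indicator (\<Union>i. A i))"
proof (rule eigen_approximable_of_limit)
  have "A i \<inter> space M \<in> sets M" for i
    using eigen_approximable_L2[OF A] by (simp add: L2_functions_indicator_iff)
  then have "(\<Union>i. A i \<inter> space M) \<in> sets M" by blast
  moreover have "(\<Union>i. A i \<inter> space M) = (\<Union>i. A i) \<inter> space M" by blast
  ultimately show L2: "(indicator (\<Union>i. A i) :: _ \<Rightarrow> complex) \<in> L2_functions M"
    by (simp add: L2_functions_indicator_iff)
  let ?F = "\<lambda>n x. \<Sum>i<n. indicator (A i) x :: complex"
  show F: "eigen_approximable M T (?F n)" for n by (intro eigen_approximable_sum A)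
  have sum: "?F n x = indicator (\<Union>i<n. A i) x" for n x
    using dis by (intro indicator_UN_disjoint[symmetric]) (auto simp: disjoint_family_on_def)
  show "(\<lambda>n. L2_norm M (\<lambda>x. indicator (\<Union>i. A i) x - ?F n x)) \<longlonglongrightarrow> 0"
  proof (rule L2_dominated_limit[OF L2, where w = "\<lambda>_. 1"])
    show "?F n \<in> borel_measurable M" for n
      by (rule L2_functions_measurable[OF eigen_approximable_L2[OF F]])
    fix x
    show "(\<lambda>n. ?F n x) \<longlonglongrightarrow> indicator (\<Union>i. A i) x"
    proof (cases "x \<in> (\<Union>i. A i)")
      case True
      then obtain i where "x \<in> A i" by blast
      then have "\<forall>n\<ge>Suc i. ?F n x = 1" unfolding sum by (auto simp: indicator_def)
      then have "\<forall>\<^sub>F n in sequentially. ?F n x = 1" by (auto simp: eventually_sequentially)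
      then show ?thesis using True by (simp add: tendsto_eventually)
    next
      case False
      then have "?F n x = 0" for n unfolding sum by (auto simp: indicator_def)
      then show ?thesis using False by simp
    qed
    show "(cmod (indicator (\<Union>i. A i) x - ?F n x))\<^sup>2 \<le> 1" for n
      unfolding sum by (auto simp: indicator_def)
  qed simp
qed

lemma eigen_approximable_indicators:
  assumes ind: "\<And>A. A \<in> sets M \<Longrightarrow> eigen_approximable M T (indicator A)" and f: "f \<in> L2_functions M"
  shows "eigen_approximable M T f"
proof -
  obtain F where F: "\<And>i. simple_function M (F i)" "\<And>x. x \<in> space M \<Longrightarrow> (\<lambda>i. F i x) \<longlonglongrightarrow> f x"
      "\<And>i x. x \<in> space M \<Longrightarrow> dist (F i x) 0 \<le> 2 * dist (f x) 0"
    using borel_measurable_implies_sequence_metric[OF L2_functions_measurable[OF f], of 0] by blast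
  show ?thesis
  proof (rule eigen_approximable_of_limit[OF f])
    show "eigen_approximable M T (F i)" for i
    proof (rule eigen_approximable_cong)
      show "eigen_approximable M T (\<lambda>x. \<Sum>y\<in>F i ` space M. y * indicator (F i -` {y} \<inter> space M) x)"
        using F(1)[of i] by (intro eigen_approximable_sum eigen_approximable_cmult ind simple_functionD)
      show "(\<Sum>y\<in>F i ` space M. y * indicator (F i -` {y} \<inter> space M) x) = F i x" if "x \<in> space M" for x
      proof -
        have *: "indicator A x *\<^sub>R y = y * indicator A x" for A and y :: complex
          by (simp add: indicator_def)
        show ?thesis
          using simple_function_indicator_representation_banach[OF F(1)[of i] that] unfolding * ..
      qed
    qed
    \<comment> \<open>The simple functions are bounded by \<open>2 * cmod (f x)\<close>, whence 3
      and its square 9.\<close>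
    have "(cmod (f x - F i x))\<^sup>2 \<le> 9 * (cmod (f x))\<^sup>2" if "x \<in> space M" for i x
    proof -
      have "cmod (f x - F i x) \<le> 3 * cmod (f x)"
        using norm_triangle_ineq4[of "f x" "F i x"] F(3)[OF that, of i]
        by (simp add: dist_norm)
      then have "(cmod (f x - F i x))\<^sup>2 \<le> (3 * cmod (f x))\<^sup>2" by (rule power_mono) simp
      then show ?thesis by (simp add: power_mult_distrib)
    qed
    then show "(\<lambda>i. L2_norm M (\<lambda>x. f x - F i x)) \<longlonglongrightarrow> 0"
      using L2_functions_integrable[OF f] F(1,2)
      by (intro L2_dominated_limit[OF f, where w = "\<lambda>x. 9 * (cmod (f x))\<^sup>2"])
        (auto intro: borel_measurable_simple_function)
  qed
qed

end

text \<open>Allowing a set of words instead of one word makes the family stable under lengthening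
  and intersection, as Dynkin's lemma requires.\<close>

definition cylinder :: "nat \<Rightarrow> 'a list set \<Rightarrow> (nat \<Rightarrow> 'a) set" where
  "cylinder m S = {x. map x [0..<m] \<in> S}"

lemma cylinder_extend:
  assumes "m \<le> n"
  shows "cylinder m S = cylinder n {w. take m w \<in> S}"
proof -
  have "take m (map x [0..<n]) = map x [0..<m]" for x :: "nat \<Rightarrow> 'a"
    using assms by (simp add: take_map)
  then show ?thesis by (simp add: cylinder_def)
qed

lemma Int_stable_cylinders: "Int_stable {cylinder m S | m S. True}"
proof (rule Int_stableI)
  fix A B :: "(nat \<Rightarrow> 'a) set"
  assume "A \<in> {cylinder m S | m S. True}" "B \<in> {cylinder m S | m S. True}"
  then obtain m S n S' where "A = cylinder m S" "B = cylinder n S'" by blast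
  moreover have "cylinder m S = cylinder (max m n) {w. take m w \<in> S}"
    by (rule cylinder_extend) simp
  moreover have "cylinder n S' = cylinder (max m n) {w. take n w \<in> S'}"
    by (rule cylinder_extend) simp
  ultimately have "A \<inter> B = cylinder (max m n) ({w. take m w \<in> S} \<inter> {w. take n w \<in> S'})"
    by (auto simp: cylinder_def)
  then show "A \<inter> B \<in> {cylinder m S | m S. True}" by blast
qed

text \<open>Only this inclusion is claimed: over a non-discrete alphabet a cylinder on an arbitrary
  set of words need not be Borel.\<close>

lemma sets_borel_cylinders:
  "sets (borel :: (nat \<Rightarrow> 'a::second_countable_topology) measure) \<subseteq> sigma_sets UNIV {cylinder m S | m S. True}"
proof -
  have "sets (borel :: (nat \<Rightarrow> 'a) measure) = sets (Pi\<^sub>M UNIV (\<lambda>_::nat. borel))"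
    by (rule sets_PiM_equal_borel[symmetric])
  also have "\<dots> = sigma_sets UNIV {{f. f i \<in> A} | i A. A \<in> sets borel}"
    by (subst sets_PiM_single) (simp add: PiE_UNIV_domain)
  also have "\<dots> \<subseteq> sigma_sets UNIV {cylinder m S | m S. True}"
  proof (rule sigma_sets_mono'[OF subsetI])
    fix B :: "(nat \<Rightarrow> 'a) set" assume "B \<in> {{f. f i \<in> A} | i A. A \<in> sets borel}"
    then obtain i A where "B = {f. f i \<in> A}" by blast
    then have "B = cylinder (Suc i) {w. w ! i \<in> A}"
      by (simp add: cylinder_def nth_append)
    then show "B \<in> {cylinder m S | m S. True}" by blast
  qed
  finally show ?thesis .
qed

locale measure_preserving_sequences = measure_preserving_map M T
  for M :: "(nat \<Rightarrow> 'a::second_countable_topology) measure" and T +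
  fixes X
  assumes sets_M: "sets M = sets (restrict_space borel X)"
begin

lemma space_M: "space M = X"
  using sets_eq_imp_space_eq[OF sets_M] by (simp add: space_restrict_space)

lemma eigen_approximable_cylinders:
  assumes cyl: "\<And>m S. eigen_approximable M T (indicator (cylinder m S))" and f: "f \<in> L2_functions M"
  shows "eigen_approximable M T f"
proof (rule eigen_approximable_indicators[OF _ f])
  have const: "eigen_approximable M T (\<lambda>_. 1)"
    using cyl[of 0 UNIV] by (simp add: cylinder_def indicator_def)
  have borel: "eigen_approximable M T (indicator A)" if "A \<in> sets borel" for A
  proof -
    have mem: "A \<in> sigma_sets UNIV {cylinder m S | m S. True}" using that sets_borel_cylinders by blast
    have sub: "{cylinder m S | m S. True} \<subseteq> Pow (UNIV :: (nat \<Rightarrow> 'a) set)" by simp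
    show ?thesis using Int_stable_cylinders sub mem
    proof (induction rule: sigma_sets_induct_disjoint)
      case (basic A)
      then show ?case using cyl by blast
    next
      case empty
      then show ?case using eigen_approximable_zero by (simp add: indicator_def)
    next
      case (compl A)
      have "eigen_approximable M T (\<lambda>x. 1 + (-1) * indicator A x)"
        by (intro eigen_approximable_add const eigen_approximable_cmult compl)
      moreover have "(\<lambda>x. 1 + (-1) * indicator A x) = (indicator (UNIV - A) :: _ \<Rightarrow> complex)"
        by (auto simp: indicator_def)
      ultimately show ?case by simp
    next
      case (union A)
      then show ?case by (intro eigen_approximable_disjoint_Union) auto
    qed
  qed
  fix B assume "B \<in> sets M"
  then obtain A where A: "A \<in> sets borel" "B = X \<inter> A"
    by (auto simp: sets_M sets_restrict_space)
  show "eigen_approximable M T (indicator B)"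
    by (rule eigen_approximable_cong[OF borel[OF A(1)]]) (auto simp: A(2) space_M indicator_def)
qed

end

section \<open>Mismatch frequencies of a subshift\<close>

lemma shift_map_iter: "(shift_map ^^ n) x = (\<lambda>i. x (i + n))"
  by (induction n arbitrary: x) (simp_all add: shift_map_def fun_eq_iff)

text \<open>Agreement with \<open>x\<close> on the first \<open>L\<close> places is an open
  condition, which some point of the orbit must meet.\<close>

lemma orbit_closure_factor:
  assumes "x \<in> orbit_closure u"
  shows "\<exists>m. map x [0..<L] = map u [m..<m + L]"
proof -
  let ?S = "\<Inter>i\<in>{..<L}. (\<lambda>y. y i) -` {x i}"
  have "open ?S"
    by (intro open_INT ballI open_vimage) (simp_all add: discrete_topology_class.open_discrete)
  moreover have "x \<in> ?S" by simp
  ultimately have "range (\<lambda>n. (shift_map ^^ n) u) \<inter> ?S \<noteq> {}"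
    using assms unfolding orbit_closure_def closure_iff_nhds_not_empty by blast
  then obtain m where m: "(shift_map ^^ m) u \<in> ?S" by blast
  have "map x [0..<L] = map u [m..<m + L]"
    using m by (intro nth_equalityI) (auto simp: shift_map_iter add.commute)
  then show ?thesis by blast
qed

locale invariant_measure = measure_preserving_sequences \<mu> shift_map X
  for \<mu> :: "(nat \<Rightarrow> 'a::{second_countable_topology, discrete_topology}) measure" and X
begin

definition differ :: "nat \<Rightarrow> nat \<Rightarrow> (nat \<Rightarrow> 'a) set" where
  "differ m n = {x \<in> space \<mu>. x m \<noteq> x n}"

lemma cylinder_sets: "cylinder m S \<inter> space \<mu> \<in> sets \<mu>"
proof -
  have eq: "cylinder m S = (\<Union>w\<in>{w\<in>S. length w = m}. \<Inter>i\<in>{..<m}. (\<lambda>y. y i) -` {w ! i})"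
  proof (intro equalityI subsetI)
    fix y assume "y \<in> cylinder m S"
    then show "y \<in> (\<Union>w\<in>{w\<in>S. length w = m}. \<Inter>i\<in>{..<m}. (\<lambda>y. y i) -` {w ! i})"
      by (intro UN_I[of "map y [0..<m]"]) (auto simp: cylinder_def)
  next
    fix y assume "y \<in> (\<Union>w\<in>{w\<in>S. length w = m}. \<Inter>i\<in>{..<m}. (\<lambda>y. y i) -` {w ! i})"
    then obtain w where w: "w \<in> S" "length w = m" "\<forall>i<m. y i = w ! i" by auto
    then have "map y [0..<m] = w" by (intro nth_equalityI) auto
    then show "y \<in> cylinder m S" using w by (simp add: cylinder_def)
  qed
  have "open (cylinder m S)" unfolding eq
    by (intro open_UN open_INT ballI open_vimage) (simp_all add: discrete_topology_class.open_discrete)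
  then have "cylinder m S \<in> sets borel" by simp
  then show ?thesis by (auto simp: sets_M sets_restrict_space space_M)
qed

lemma differ_cylinder: "differ m n = cylinder (Suc (max m n)) {w. w ! m \<noteq> w ! n} \<inter> space \<mu>"
proof -
  have "map x [0..<Suc (max m n)] ! m = x m" "map x [0..<Suc (max m n)] ! n = x n" for x :: "nat \<Rightarrow> 'a"
    by (simp_all del: upt_Suc)
  then show ?thesis by (auto simp: differ_def cylinder_def simp del: upt_Suc)
qed

lemma differ_sets [measurable]: "differ m n \<in> sets \<mu>"
  unfolding differ_cylinder by (rule cylinder_sets)

lemma measure_differ_shift: "measure \<mu> (differ (m + p) (n + p)) = measure \<mu> (differ m n)"
proof -
  have "measure \<mu> (differ m n) = measure (distr \<mu> \<mu> (shift_map ^^ p)) (differ m n)"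
    by (simp add: iter_distr)
  also have "\<dots> = measure \<mu> ((shift_map ^^ p) -` differ m n \<inter> space \<mu>)"
    by (rule measure_distr) auto
  also have "(shift_map ^^ p) -` differ m n \<inter> space \<mu> = differ (m + p) (n + p)"
    using measurable_space[OF iter_meas[of p]] by (auto simp: differ_def shift_map_iter)
  finally show ?thesis ..
qed

text \<open>The pseudonorm on the integers that will serve as \<open>D\<close>. By invariance, how
  often two places differ depends only on their distance.\<close>

definition mismatch :: "int \<Rightarrow> real" where
  "mismatch z = measure \<mu> (differ 0 (nat \<bar>z\<bar>))"

lemma measure_differ: "measure \<mu> (differ m n) = mismatch (int n - int m)"
proof -
  have com: "differ m n = differ n m" for m n by (auto simp: differ_def)
  have "measure \<mu> (differ m n) = mismatch (int n - int m)" if "m \<le> n" for m n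
    using measure_differ_shift[of 0 m "n - m"] that by (simp add: mismatch_def nat_diff_distrib)
  moreover have "mismatch (- z) = mismatch z" for z by (simp add: mismatch_def)
  ultimately show ?thesis using com[of m n] by (metis minus_diff_eq nat_le_linear)
qed

lemma mismatch_minus: "mismatch (- z) = mismatch z"
  by (simp add: mismatch_def)

lemma mismatch_0: "mismatch 0 = 0"
  by (simp add: mismatch_def differ_def)

lemma mismatch_add: "mismatch (y + z) \<le> mismatch y + mismatch z"
proof -
  \<comment> \<open>One-sided sequences have no negative places, so the comparison starts far enough
    to the right for \<open>a + y\<close> and \<open>a + y + z\<close> to be nonnegative.\<close>
  define a where "a = nat (\<bar>y\<bar> + \<bar>z\<bar>)"
  define b where "b = nat (int a + y)"
  define c where "c = nat (int a + y + z)"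
  have "0 \<le> \<bar>y\<bar> + \<bar>z\<bar> + y" "0 \<le> \<bar>y\<bar> + \<bar>z\<bar> + y + z" by linarith+
  then have yz: "y = int b - int a" "z = int c - int b" "y + z = int c - int a"
    by (simp_all add: a_def b_def c_def)
  have eq: "mismatch y = measure \<mu> (differ a b)" "mismatch z = measure \<mu> (differ b c)"
      "mismatch (y + z) = measure \<mu> (differ a c)"
    by (simp_all only: measure_differ flip: yz)
  have "measure \<mu> (differ a c) \<le> measure \<mu> (differ a b \<union> differ b c)"
    by (intro finite_measure_mono sets.Un differ_sets) (auto simp: differ_def)
  also have "\<dots> \<le> measure \<mu> (differ a b) + measure \<mu> (differ b c)"
    by (intro measure_Un_le) auto
  finally show ?thesis by (simp add: eq)
qed

text \<open>The bound holds at every point and can be integrated; by invariance the \<open>N\<close>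
  comparisons have equal integrals, and dividing by \<open>N\<close> removes \<open>M\<close> in the
  limit.\<close>

lemma mismatch_le_density:
  assumes "\<And>N x. x \<in> space \<mu> \<Longrightarrow> real (self_mismatch n (map x [0..<N + n])) \<le> M + c * real (N + n)"
  shows "mismatch (int n) \<le> c"
proof -
  have integrable_differ: "integrable \<mu> (indicator (differ i j) :: _ \<Rightarrow> real)" for i j
    by (intro integrable_real_indicator) (auto simp: emeasure_eq_measure)
  have "mismatch (int n) \<le> (M + c * n) / real N + c" if "N > 0" for N
  proof -
    have "real N * mismatch (int n) = (\<Sum>i<N. measure \<mu> (differ i (i + n)))"
      by (simp add: measure_differ)
    also have "\<dots> = (\<integral>x. (\<Sum>i<N. indicator (differ i (i + n)) x) \<partial>\<mu>)"
      using integrable_differ by (subst Bochner_Integration.integral_sum) auto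
    also have "\<dots> \<le> (\<integral>x. M + c * real (N + n) \<partial>\<mu>)"
    proof (rule integral_mono)
      fix x assume x: "x \<in> space \<mu>"
      have "(\<Sum>i<N. indicator (differ i (i + n)) x :: real) = real (card {i \<in> {..<N}. x \<in> differ i (i + n)})"
        by (simp add: indicator_def of_bool_def sum.If_cases Int_def)
      also have "{i \<in> {..<N}. x \<in> differ i (i + n)} =
          {i. i + n < length (map x [0..<N + n]) \<and> map x [0..<N + n] ! i \<noteq> map x [0..<N + n] ! (i + n)}"
        using x by (auto simp: differ_def)
      also have "real (card \<dots>) = real (self_mismatch n (map x [0..<N + n]))"
        by (simp only: self_mismatch_def)
      also have "\<dots> \<le> M + c * real (N + n)" by (rule assms[OF x])
      finally show "(\<Sum>i<N. indicator (differ i (i + n)) x) \<le> M + c * real (N + n)" .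
    qed (auto intro: integrable_differ)
    also have "\<dots> = M + c * real (N + n)" by (simp add: prob_space)
    finally show ?thesis using that by (simp add: field_simps)
  qed
  then have "\<forall>\<^sub>F N in sequentially. mismatch (int n) \<le> (M + c * n) / real N + c"
    by (intro eventually_mono[OF eventually_gt_at_top[of 0]])
  moreover have "(\<lambda>N. (M + c * n) / real N + c) \<longlonglongrightarrow> 0 + c"
    by (intro tendsto_add lim_const_over_n tendsto_const)
  ultimately show ?thesis using tendsto_lowerbound by (metis add_0 sequentially_bot)
qed

text \<open>The indicators can differ at \<open>x\<close> only if \<open>x\<close> and its
  \<open>n\<close>-th shift differ at one of the first \<open>m\<close> places; a union bound gives
  the factor \<open>m\<close>.\<close>

lemma cylinder_almost_periodic:
  "L2_norm \<mu> (\<lambda>x. indicator (cylinder m S) ((shift_map ^^ n) x) - indicator (cylinder m S) x) \<le>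
    sqrt (m * mismatch (int n))"
proof -
  let ?f = "indicator (cylinder m S) :: _ \<Rightarrow> complex"
  let ?D = "\<Union>i<m. differ i (i + n)"
  have [measurable]: "?f \<in> borel_measurable \<mu>"
    by (rule L2_functions_measurable) (simp add: L2_functions_indicator_iff cylinder_sets)
  have L2: "(\<lambda>x. ?f ((shift_map ^^ n) x) - ?f x) \<in> L2_functions \<mu>"
    by (intro L2_functions_diff L2_functions_iter) (simp_all add: L2_functions_indicator_iff cylinder_sets)
  have "(\<integral>x. (cmod (?f ((shift_map ^^ n) x) - ?f x))\<^sup>2 \<partial>\<mu>) \<le> (\<integral>x. indicator ?D x \<partial>\<mu>)"
  proof (rule integral_mono[OF L2_functions_integrable[OF L2]])
    fix x assume x: "x \<in> space \<mu>"
    show "(cmod (?f ((shift_map ^^ n) x) - ?f x))\<^sup>2 \<le> indicator ?D x"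
    proof (cases "x \<in> ?D")
      case False
      then have "map ((shift_map ^^ n) x) [0..<m] = map x [0..<m]"
        using x by (auto simp: differ_def shift_map_iter)
      then have "(shift_map ^^ n) x \<in> cylinder m S \<longleftrightarrow> x \<in> cylinder m S"
        by (simp only: cylinder_def mem_Collect_eq)
      then show ?thesis by (simp add: indicator_def)
    qed (auto simp: indicator_def)
  qed (intro integrable_real_indicator, auto simp: emeasure_eq_measure)
  also have "\<dots> = measure \<mu> ?D" by simp
  also have "\<dots> \<le> (\<Sum>i<m. measure \<mu> (differ i (i + n)))"
    by (intro measure_UNION_le) auto
  also have "\<dots> = m * mismatch (int n)" by (simp add: measure_differ)
  finally show ?thesis unfolding L2_norm_def by (rule real_sqrt_le_mono)
qed

end

lemma cis_near_1:
  assumes "\<delta> > 0"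
  shows "\<exists>\<delta>'>0. \<forall>x. cmod (1 - cis (2 * pi * x)) < \<delta>' \<longrightarrow> (\<exists>p::int. \<bar>x - p\<bar> < \<delta>)"
proof -
  \<comment> \<open>Keeps \<open>2 * pi * d\<close> below \<open>pi\<close>, where the cosine
    decreases; the distance to the nearest integer is at most 1/2, so the other angle lies in the
    same range.\<close>
  define d where "d = min \<delta> (1/4)"
  have d: "0 < d" "d \<le> 1/4" "d \<le> \<delta>" using assms by (auto simp: d_def)
  have "cos (2 * pi * d) < cos 0"
    using d by (intro cos_monotone_0_pi) (auto simp: field_simps)
  then have pos: "sqrt (2 - 2 * cos (2 * pi * d)) > 0" by simp
  have "\<exists>p::int. \<bar>x - p\<bar> < \<delta>" if "cmod (1 - cis (2 * pi * x)) < sqrt (2 - 2 * cos (2 * pi * d))" for x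
  proof (rule ccontr)
    assume "\<not> ?thesis"
    then have "\<bar>x - round x\<bar> \<ge> d" using d(3) by (meson le_less_trans not_less)
    define y where "y = x - round x"
    have y: "\<bar>y\<bar> \<ge> d" "\<bar>y\<bar> \<le> 1/2"
      using \<open>d \<le> \<bar>x - round x\<bar>\<close> of_int_round_abs_le[of x] by (simp_all add: y_def abs_minus_commute)
    have "cis (2 * pi * x) = cis (2 * pi * y)"
    proof -
      have "cis (2 * pi * x) = cis (2 * pi * y) * cis (2 * pi * of_int (round x))"
        by (simp add: y_def cis_mult algebra_simps)
      then show ?thesis by (simp add: cis_multiple_2pi)
    qed
    moreover have "(cmod (1 - cis z))\<^sup>2 = 2 - 2 * cos z" for z
      unfolding cmod_power2 using sin_cos_squared_add[of z] by (simp add: power2_eq_square algebra_simps)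
    moreover have "cos (2 * pi * y) \<le> cos (2 * pi * d)"
    proof -
      have "cos (2 * pi * y) = cos (2 * pi * \<bar>y\<bar>)" by (cases "y \<ge> 0") simp_all
      also have "\<dots> \<le> cos (2 * pi * d)"
        using d y by (intro cos_monotone_0_pi_le) (auto simp: field_simps)
      finally show ?thesis .
    qed
    ultimately have "(cmod (1 - cis (2 * pi * x)))\<^sup>2 \<ge> 2 - 2 * cos (2 * pi * d)" by simp
    then have "cmod (1 - cis (2 * pi * x)) \<ge> sqrt (2 - 2 * cos (2 * pi * d))"
      by (intro real_le_lsqrt) auto
    then show False using that by simp
  qed
  then show ?thesis using pos by blast
qed

theorem mainTheorem6:
  fixes k l :: nat and u :: "nat \<Rightarrow> letter" and \<mu> :: "(nat \<Rightarrow> letter) measure"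
  assumes "k \<ge> 1" and "l \<le> k"
    and "periodic_point (subst_lk l k) u"
    and "shift_invariant_prob (orbit_closure u) \<mu>"
  shows "pure_discrete_spectrum \<mu> shift_map"
proof -
  obtain \<beta> where "cubic_unit k \<beta>" using ex_cubic_unit[OF assms(1)] by blast
  interpret cubic_unit k \<beta> by fact
  from assms(4) have \<mu>: "sets \<mu> = sets (restrict_space borel (orbit_closure u))" "prob_space \<mu>"
      "shift_map \<in> \<mu> \<rightarrow>\<^sub>M \<mu>" "distr \<mu> \<mu> shift_map = \<mu>"
    by (auto simp: shift_invariant_prob_def)
  interpret prob_space \<mu> by (rule \<mu>(2))
  interpret invariant_measure \<mu> "orbit_closure u"
    by unfold_locales (use \<mu> in auto)
  let ?H = "\<lambda>j. length (iter_subst (subst_lk l k) j [La])"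
  obtain C \<rho> where C: "C \<ge> 0" "0 < \<rho>" "\<rho> < 1" and mism: "\<And>j. \<exists>M. \<forall>m n.
      real (self_mismatch (?H j) (map u [m..<n])) \<le> M + C * \<rho> ^ j * real (n - m)"
    using self_mismatch_periodic_point[OF assms(2,3)] by blast
  have mH: "mismatch (int (?H j)) \<le> C * \<rho> ^ j" for j
  proof -
    obtain M where M: "\<And>m n. real (self_mismatch (?H j) (map u [m..<n])) \<le> M + C * \<rho> ^ j * real (n - m)"
      using mism[of j] by blast
    have "real (self_mismatch (?H j) (map x [0..<N + ?H j])) \<le> M + C * \<rho> ^ j * real (N + ?H j)"
      if x: "x \<in> space \<mu>" for x N
    proof -
      \<comment> \<open>Every finite prefix of a point of the orbit closure occurs in
        \<open>u\<close>, so the bound for \<open>u\<close> holds at all points.\<close>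
      obtain m where "map x [0..<N + ?H j] = map u [m..<m + (N + ?H j)]"
        using orbit_closure_factor[of x u "N + ?H j"] x by (auto simp: space_M)
      then show ?thesis using M[of m "m + (N + ?H j)"] by simp
    qed
    then show ?thesis by (rule mismatch_le_density)
  qed
  interpret cubic_unit_lengths k \<beta> "\<lambda>j. int (?H j)" mismatch C \<rho>
  proof
    show "int (?H (j + 3)) = int k * int (?H (j + 2)) + int (?H j)" for j
      using length_iter_lk_rec(4)[OF assms(2), of j] by simp
    show "int (?H 0) = 1" "int (?H 1) = int k + 1" "int (?H 2) = int k * (int k + 1) + 1"
      using length_iter_lk_rec(1-3)[OF assms(2)] by (simp_all add: algebra_simps)
  qed (use mH C mismatch_add mismatch_minus mismatch_0 in auto)
  define t where "t = \<beta> / (\<beta> ^ 2 + \<beta> + 1)"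
  define t' where "t' = 1 / (\<beta> ^ 2 + \<beta> + 1)"
  have indep: "m = 0 \<and> m' = 0" if "m * t + m' * t' \<in> \<int>" for m m' :: int
  proof -
    from that obtain c :: int where "m * t + m' * t' = c" by (auto elim: Ints_cases)
    then show ?thesis unfolding t_def t'_def by (rule frequencies_independent)
  qed
  have "eigen_approximable \<mu> shift_map (indicator (cylinder m S))" for m S
  proof (rule almost_periodic_approximable[OF _ _ indep])
    show "(indicator (cylinder m S) :: _ \<Rightarrow> complex) \<in> borel_measurable \<mu>"
      by (rule L2_functions_measurable) (simp add: L2_functions_indicator_iff cylinder_sets)
    show "cmod (indicator (cylinder m S) x) \<le> 1" for x by (simp add: indicator_def)
    fix e :: real assume e: "e > 0"
    \<comment> \<open>The aim is \<open>sqrt (m * mismatch (int n)) < e\<close>;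
      \<open>m + 1\<close> in place of \<open>m\<close> covers \<open>m = 0\<close>.\<close>
    have "e\<^sup>2 / (real m + 1) > 0" using e by simp
    then obtain \<delta> where \<delta>: "\<delta> > 0" "\<And>n p q. \<bar>real_of_int n * t - real_of_int p\<bar> < \<delta> \<Longrightarrow>
        \<bar>real_of_int n * t' - real_of_int q\<bar> < \<delta> \<Longrightarrow> mismatch n < e\<^sup>2 / (real m + 1)"
      using D_small[of "e\<^sup>2 / (real m + 1)"] unfolding t_def t'_def by blast
    obtain \<delta>' where \<delta>': "\<delta>' > 0" "\<And>x. cmod (1 - cis (2 * pi * x)) < \<delta>' \<Longrightarrow> \<exists>p::int. \<bar>x - p\<bar> < \<delta>"
      using cis_near_1[OF \<delta>(1)] by blast
    have "L2_norm \<mu> (\<lambda>x. indicator (cylinder m S) ((shift_map ^^ n) x) - indicator (cylinder m S) x) < e"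
      if near: "cmod (1 - cis (2 * pi * real n * t)) < \<delta>'" "cmod (1 - cis (2 * pi * real n * t')) < \<delta>'" for n
    proof -
      obtain p q :: int where "\<bar>n * t - p\<bar> < \<delta>" "\<bar>n * t' - q\<bar> < \<delta>"
        using \<delta>'(2)[of "n * t"] \<delta>'(2)[of "n * t'"] near unfolding mult.assoc by blast
      then have "mismatch (int n) < e\<^sup>2 / (real m + 1)" using \<delta>(2)[of "int n" p q] by simp
      then have "(real m + 1) * mismatch (int n) < e\<^sup>2" by (simp add: field_simps)
      then have "m * mismatch (int n) < e\<^sup>2"
        using D_nonneg[of "int n"] by (simp add: distrib_right)
      then have "sqrt (m * mismatch (int n)) < e" using e by (intro real_less_lsqrt) auto
      then show ?thesis using cylinder_almost_periodic[of m S n] by linarith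
    qed
    then show "\<exists>\<delta>>0. \<forall>n. cmod (1 - cis (2 * pi * real n * t)) < \<delta> \<longrightarrow>
        cmod (1 - cis (2 * pi * real n * t')) < \<delta> \<longrightarrow>
        L2_norm \<mu> (\<lambda>x. indicator (cylinder m S) ((shift_map ^^ n) x) - indicator (cylinder m S) x) < e"
      using \<delta>'(1) by blast
  qed
  then show ?thesis
    by (rule pure_discrete_spectrumI[OF eigen_approximable_cylinders])
qed

end
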